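(* Let $\mathbb{CP}^1$ be equipped with the Fubini-Study metric and let the line bundle $O_{\mathbb{CP}^1}(-a)$ carry the induced Fubini-Study metric. Then for every integer $a\geq 1$ the Ray-Singer analytic torsion is $$T(\mathbb{CP}^1,O_{\mathbb{CP}^1}(-a))=\tfrac12(-a+1)^2+\log\left(\prod_{i=0}^{a-2}\frac{i!\,(a-2-i)!}{(a-1)!}\right)-4\zeta'(-1),$$ where $\zeta$ is the Riemann zeta function and the empty product (for $a=1$) is $1$.
   Context: Conventions: in the coordinate $z=x_1/x_0$ the Fubini-Study metric on $\mathbb{CP}^1$ is $\|\partial_z\|^2=(1+|z|^2)^{-2}$, with normalized Kähler form $\omega=\frac{\mathrm i}{2\pi}\frac{dz\wedge d\bar z}{(1+|z|^2)^2}$, and the metric on $O_{\mathbb{CP}^1}(m)$, $m\in\mathbb{Z}$, satisfies $\|x_0^m\|^2=(1+|z|^2)^{-m}$. For a Hermitian holomorphic bundle $E$ on $\mathbb{CP}^1$, the Ray-Singer analytic torsion is $T(\mathbb{CP}^1,E)=T(E)=\sum_{q\geq0}(-1)^q q\,\zeta_q'(0)$ (note the sign convention), where $\zeta_q(s)=\sum_{\lambda}\lambda^{-s}$, analytically continued to $s=0$, the sum running over the nonzero eigenvalues (with multiplicity) of the Laplacian $\bar\partial\bar\partial^*+\bar\partial^*\bar\partial$ on smooth $E$-valued $(0,q)$-forms, adjoints being taken for the $L^2$ inner products given by integrating the pointwise inner products against $\omega$. *)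

theory Defs
  imports "HOL-Complex_Analysis.Complex_Analysis" "HOL-Library.Function_Algebras"
begin

text \<open>
  Smoothness on the real plane \<open>\<complex>\<close>: \<open>differentiable\<close> is real (Frechet) differentiability.
\<close>

primrec cont_diff :: "nat \<Rightarrow> (complex \<Rightarrow> complex) \<Rightarrow> bool" where
  "cont_diff 0 f \<longleftrightarrow> continuous_on UNIV f"
| "cont_diff (Suc k) f \<longleftrightarrow> (\<forall>z. f differentiable (at z)) \<and>
     (\<forall>v. cont_diff k (\<lambda>z. frechet_derivative f (at z) v))"

definition smooth :: "(complex \<Rightarrow> complex) \<Rightarrow> bool" where
  "smooth f \<longleftrightarrow> (\<forall>k. cont_diff k f)"

text \<open>
  \<open>\<complex>P\<^sup>1\<close> is covered by the charts \<open>z = x\<^sub>1/x\<^sub>0\<close> and \<open>w = x\<^sub>0/x\<^sub>1 = 1/z\<close>, each with image \<open>\<complex>\<close>.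
  An \<open>O(m)\<close>-valued \<open>(0,q)\<close>-form, \<open>q \<le> 1\<close>, is a pair \<open>(f, g)\<close> of coefficient functions:
  it equals \<open>f(z) (d(cnj z))\<^sup>q \<otimes> x\<^sub>0\<^sup>m\<close> in the first chart and \<open>g(w) (d(cnj w))\<^sup>q \<otimes> x\<^sub>1\<^sup>m\<close> in the second.
  The gluing condition comes from \<open>x\<^sub>1\<^sup>m = z\<^sup>m x\<^sub>0\<^sup>m\<close> and \<open>d(cnj w) = - (cnj z)\<^bsup>-2\<^esup> d(cnj z)\<close>.
\<close>

type_synonym form = "(complex \<Rightarrow> complex) \<times> (complex \<Rightarrow> complex)"

definition forms :: "int \<Rightarrow> nat \<Rightarrow> form set" where
  "forms m q = (if q \<le> 1
     then {(f, g). smooth f \<and> smooth g \<and>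
             (\<forall>z. z \<noteq> 0 \<longrightarrow> f z = z powi m * (- 1 / (cnj z)\<^sup>2) ^ q * g (1 / z))}
     else {0})"

definition form_scale :: "complex \<Rightarrow> form \<Rightarrow> form" where
  "form_scale c \<alpha> = ((\<lambda>z. c * fst \<alpha> z), (\<lambda>w. c * snd \<alpha> w))"

lemma vector_space_form_scale: "vector_space form_scale"
  by unfold_locales (auto simp: form_scale_def algebra_simps fun_eq_iff prod_eq_iff)

definition wirtinger_bar :: "(complex \<Rightarrow> complex) \<Rightarrow> complex \<Rightarrow> complex" where
  "wirtinger_bar f z =
     (frechet_derivative f (at z) 1 + \<i> * frechet_derivative f (at z) \<i>) / 2"

text \<open>The frames \<open>x\<^sub>0\<^sup>m\<close> and \<open>x\<^sub>1\<^sup>m\<close> are holomorphic, so only the coefficients are differentiated.\<close>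

definition dbar :: "nat \<Rightarrow> form \<Rightarrow> form" where
  "dbar q \<alpha> = (if q = 0 then (wirtinger_bar (fst \<alpha>), wirtinger_bar (snd \<alpha>)) else 0)"

text \<open>
  The measure of \<open>\<omega> = \<i>/(2\<pi>) dz \<and> d(cnj z) / (1 + |z|\<^sup>2)\<^sup>2\<close>, where \<open>\<i> dz \<and> d(cnj z) = 2 dx \<and> dy\<close>.
  The point at infinity is a null set, so integrals over \<open>\<complex>P\<^sup>1\<close> are computed in the chart \<open>z\<close>.
\<close>

definition fubini_study :: "complex measure" where
  "fubini_study = density lborel (\<lambda>z. ennreal (1 / (pi * (1 + (cmod z)\<^sup>2)\<^sup>2)))"

text \<open>
  The \<open>L\<^sup>2\<close> inner product on \<open>(0,q)\<close>-forms:
  \<open>\<parallel>(d(cnj z))\<^sup>q \<otimes> x\<^sub>0\<^sup>m\<parallel>\<^sup>2 = (1 + |z|\<^sup>2)\<^bsup>2q - m\<^esup>\<close>, since \<open>\<parallel>d(cnj z)\<parallel>\<^sup>2 = (\<parallel>\<partial>\<^sub>z\<parallel>\<^sup>2)\<^bsup>-1\<^esup> = (1 + |z|\<^sup>2)\<^sup>2\<close>.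
\<close>

definition l2_inner :: "int \<Rightarrow> nat \<Rightarrow> form \<Rightarrow> form \<Rightarrow> complex" where
  "l2_inner m q \<alpha> \<beta> = (LINT z|fubini_study.
     fst \<alpha> z * cnj (fst \<beta> z) * complex_of_real ((1 + (cmod z)\<^sup>2) powi (2 * int q - m)))"

text \<open>\<open>dbar_adj m q\<close> maps \<open>(0,q+1)\<close>-forms to \<open>(0,q)\<close>-forms.\<close>

definition dbar_adj :: "int \<Rightarrow> nat \<Rightarrow> form \<Rightarrow> form" where
  "dbar_adj m q \<alpha> = (THE \<beta>. \<beta> \<in> forms m q \<and>
     (\<forall>\<gamma> \<in> forms m q. l2_inner m (Suc q) (dbar q \<gamma>) \<alpha> = l2_inner m q \<gamma> \<beta>))"

fun laplacian :: "int \<Rightarrow> nat \<Rightarrow> form \<Rightarrow> form" where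
  "laplacian m 0 \<alpha> = dbar_adj m 0 (dbar 0 \<alpha>)"
| "laplacian m (Suc q) \<alpha> = dbar q (dbar_adj m q \<alpha>) + dbar_adj m (Suc q) (dbar (Suc q) \<alpha>)"

definition eigenspace :: "int \<Rightarrow> nat \<Rightarrow> complex \<Rightarrow> form set" where
  "eigenspace m q l = {\<alpha> \<in> forms m q. laplacian m q \<alpha> = form_scale l \<alpha>}"

definition eigenvalues :: "int \<Rightarrow> nat \<Rightarrow> complex set" where
  "eigenvalues m q = {l. \<exists>\<alpha> \<in> eigenspace m q l. \<alpha> \<noteq> 0}"

text \<open>The eigenspaces are finite-dimensional by ellipticity (in general, the library's \<open>dim\<close> of an
  infinite-dimensional space is \<open>0\<close>).\<close>

definition multiplicity_of :: "int \<Rightarrow> nat \<Rightarrow> complex \<Rightarrow> nat" where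
  "multiplicity_of m q l = vector_space.dim form_scale (eigenspace m q l)"

text \<open>
  \<open>F\<close> is the spectral zeta function on \<open>(0,q)\<close>-forms: it equals the Dirichlet series over the
  nonzero spectrum where \<open>Re s\<close> is large, and it is meromorphic on a half-plane that contains \<open>0\<close>,
  and regular at \<open>0\<close>.  By the identity theorem, \<open>deriv F 0\<close> does not depend on \<open>F\<close>.
\<close>

definition is_spectral_zeta :: "int \<Rightarrow> nat \<Rightarrow> (complex \<Rightarrow> complex) \<Rightarrow> bool" where
  "is_spectral_zeta m q F \<longleftrightarrow>
     (\<exists>c<0. F meromorphic_on {s. Re s > c}) \<and> F analytic_on {0} \<and>
     (\<exists>b. \<forall>s. Re s > b \<longrightarrow>
        ((\<lambda>l. of_nat (multiplicity_of m q l) * l powr (- s)) has_sum F s) (eigenvalues m q - {0}))"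

definition spectral_zeta_deriv_0 :: "int \<Rightarrow> nat \<Rightarrow> complex" where
  "spectral_zeta_deriv_0 m q = (THE d. \<exists>F. is_spectral_zeta m q F \<and> d = deriv F 0)"

text \<open>The torsion of \<open>O(m)\<close>; there are no nonzero \<open>(0,q)\<close>-forms for \<open>q > 1\<close>.\<close>

definition analytic_torsion :: "int \<Rightarrow> complex" where
  "analytic_torsion m = (\<Sum>q\<le>1. (- 1) ^ q * of_nat q * spectral_zeta_deriv_0 m q)"

text \<open>The value at the pole \<open>1\<close> is a convention that makes the function unique.\<close>

definition riemann_zeta :: "complex \<Rightarrow> complex" where
  "riemann_zeta = (THE F. F holomorphic_on - {1} \<and> F 1 = 0 \<and>
     (\<forall>s. Re s > 1 \<longrightarrow> (\<lambda>n. of_nat (Suc n) powr (- s)) sums F s))"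

end

theory Submission
  imports Defs "HOL-Probability.Sinc_Integral"
begin

text \<open>
  Trivialising \<open>d(cnj z)\<close> by the metric turns a \<open>(0,1)\<close>-form with values in \<open>O(m)\<close> into a section of
  \<open>O(m + 2)\<close>, and the Laplacian into \<open>D D\<^sup>*\<close> with \<open>D : O(m) \<rightarrow> O(m + 2)\<close>.  On sections of \<open>O(k)\<close>
  one has \<open>D D\<^sup>* = D\<^sup>* D + k\<close>, so \<open>D\<close> carries eigensections up in degree, the eigenvalue of \<open>D\<^sup>* D\<close>
  falling by the degree at each step.  By positivity this must stop at a holomorphic section, that is
  at a polynomial.  With \<open>b = a - 1\<close> the nonzero spectrum on \<open>O(-a)\<close> is therefore \<open>n (n + b)\<close>, \<open>n \<ge> 1\<close>,
  with multiplicity \<open>2 n + b\<close>.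

  With \<open>p = n\<^bsup>-s\<^esup>\<close>, \<open>q = (n + b)\<^bsup>-s\<^esup>\<close> one has
  \<open>(2 n + b) p q = n p\<^sup>2 + (n + b) q\<^sup>2 + b (1 - s) / 2 (p\<^sup>2 - q\<^sup>2) + r\<^sub>n(s)\<close> where
  \<open>r\<^sub>n(s) = O(s\<^sup>2 n\<^bsup>-2 Re s - 2\<^esup>)\<close>.  The first two terms sum to \<open>2 \<zeta>(2 s - 1)\<close> minus a finite sum, the
  third one telescopes to a finite sum, and the last one contributes nothing to the derivative at \<open>0\<close>.
\<close>

section \<open>Continuation of the Riemann zeta function\<close>

text \<open>A \<open>(0,1)\<close>-form with values in \<open>O(-a)\<close> becomes a section of
  degree \<open>1 - b\<close>. After \<open>j\<close> steps up, the eigenvalue \<open>l\<close> has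
  turned into \<open>l - (j + 1) * (j + 1 - b)\<close>, which tends to minus infinity with
  \<open>j\<close>, whereas positivity keeps it nonnegative on nonzero sections. So the ladder ends
  where this number is 0, and \<open>l > 0\<close> leaves only \<open>j + 1 = n + b\<close> with
  \<open>n \<ge> 1\<close>. The polynomials met there have degree at most
  \<open>1 - b + 2 * j = 2 * n + b - 1\<close>, hence dimension \<open>2 * n + b\<close>. The
  multiplicity is exact because the steps down invert the steps up, except for the product of the
  intermediate eigenvalues, all of them positive. Zeta functions, adjoints and spectral derivatives
  are definite descriptions, so each needs uniqueness besides a formula: the identity theorem for
  functions, definiteness of the inner product for adjoints. In the derivative at 0, the factor 4 is
  two copies of zeta times the inner derivative of \<open>2 * s - 1\<close>; \<open>b^2 / 2\<close>
  comes from differentiating \<open>1 - s\<close> in front of the telescoped sum, which has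
  \<open>b\<close> terms; the logarithms are those of the factorial product. The torsion takes this
  derivative with a minus sign.\<close>

lemma holomorphic_on_half_plane_suminf:
  fixes f :: "nat \<Rightarrow> complex \<Rightarrow> complex"
  assumes hol: "\<And>n. f n holomorphic_on {s. Re s > c}"
    and bound: "\<And>\<sigma> R. \<sigma> > c \<Longrightarrow> R \<ge> 0 \<Longrightarrow> \<exists>M. summable M \<and> (\<forall>n s. \<sigma> \<le> Re s \<longrightarrow> norm s \<le> R \<longrightarrow> norm (f n s) \<le> M n)"
  shows "(\<lambda>s. \<Sum>n. f n s) holomorphic_on {s. Re s > c}"
proof (rule holomorphic_uniform_sequence)
  show "open {s. Re s > c}" by (rule open_halfspace_Re_gt)
  show "(\<lambda>s. \<Sum>i<n. f i s) holomorphic_on {s. Re s > c}" for n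
    by (intro holomorphic_intros hol)
next
  fix x assume x: "x \<in> {s. Re s > c}"
  \<comment> \<open>Half the distance to the boundary line: the closed disc of this radius stays in
    \<open>Re s \<ge> c + d\<close>, where the majorant applies.\<close>
  define d where "d = (Re x - c) / 2"
  have d: "d > 0" using x by (simp add: d_def)
  obtain M where M: "summable M" "\<And>n s. c + d \<le> Re s \<Longrightarrow> norm s \<le> norm x + d \<Longrightarrow> norm (f n s) \<le> M n"
    using bound[of "c + d" "norm x + d"] d by auto
  have *: "c + d \<le> Re y \<and> norm y \<le> norm x + d" if "y \<in> cball x d" for y
  proof -
    have "\<bar>Re (x - y)\<bar> \<le> d" using that abs_Re_le_cmod[of "x - y"] by (simp add: dist_norm)
    moreover have "norm y \<le> norm x + norm (x - y)"
      by (metis add.commute norm_minus_commute norm_triangle_sub)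
    moreover have "norm (x - y) \<le> d" using that by (simp add: dist_norm)
    moreover have "Re x = c + 2 * d" by (simp add: d_def field_simps)
    ultimately show ?thesis by auto
  qed
  have "uniform_limit (cball x d) (\<lambda>n s. \<Sum>i<n. f i s) (\<lambda>s. \<Sum>n. f n s) sequentially"
    by (rule Weierstrass_m_test) (use M * in auto)
  moreover have "cball x d \<subseteq> {s. Re s > c}"
    using * d by fastforce
  ultimately show "\<exists>d>0. cball x d \<subseteq> {s. Re s > c} \<and>
      uniform_limit (cball x d) (\<lambda>n s. \<Sum>i<n. f i s) (\<lambda>s. \<Sum>n. f n s) sequentially"
    using d by blast
qed

lemma norm_of_nat_powr: "norm (of_nat n powr s :: complex) = real n powr Re s"
  using norm_powr_real_powr[of "of_nat n" s] by simp

lemma summable_Suc_powr: "p < -1 \<Longrightarrow> summable (\<lambda>n. real (Suc n) powr p)"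
  using summable_Suc_iff[of "\<lambda>n. real n powr p"] summable_real_powr_iff[of p] by simp

lemma holomorphic_of_nat_powr [holomorphic_intros]:
  assumes "f holomorphic_on A" "n > 0"
  shows "(\<lambda>s. of_nat n powr f s) holomorphic_on A"
  using assms by (intro holomorphic_intros) auto

lemma holomorphic_gbinomial [holomorphic_intros]:
  "f holomorphic_on A \<Longrightarrow> (\<lambda>s. f s gchoose k) holomorphic_on A"
  unfolding gbinomial_prod_rev by (intro holomorphic_intros) auto

text \<open>
  The Taylor remainder of \<open>(x + 1)\<^bsup>1 - s\<^esup>\<close> at \<open>x = n + 1\<close>.  Summing over \<open>n\<close>, the left-hand side telescopes
  and the Taylor polynomial becomes a combination of \<open>\<zeta>(s), \<zeta>(s + 1), \<dots>\<close>; this recursion continues \<open>\<zeta>\<close>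
  to the left one unit at a time.
\<close>

definition zeta_rem :: "nat \<Rightarrow> nat \<Rightarrow> complex \<Rightarrow> complex" where
  "zeta_rem K n s = of_nat (Suc (Suc n)) powr (1 - s)
     - (\<Sum>j\<le>K. ((1 - s) gchoose j) * of_nat (Suc n) powr (1 - s - of_nat j))"

text \<open>Taylor's theorem on the segment from \<open>n + 1\<close> to \<open>n + 2\<close>. The
  derivative of order \<open>K + 1\<close> of \<open>x powr (1 - s)\<close> has size proportional to
  \<open>x powr (- Re s - K)\<close>, which the hypothesis makes largest at the left end.\<close>

lemma norm_zeta_rem_le:
  assumes "Re s + real K \<ge> 0"
  shows "norm (zeta_rem K n s) \<le> (\<Prod>l<Suc K. norm (1 - s - of_nat l)) * real (Suc n) powr (- Re s - real K)"
proof -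
  define f where "f = (\<lambda>i x. (\<Prod>l<i. (1 - s - of_nat l)) * x powr (1 - s - of_nat i))"
  define S where "S = closed_segment (of_nat (Suc n)) (of_nat (Suc (Suc n)) :: complex)"
  define B where "B = (\<Prod>l<Suc K. norm (1 - s - of_nat l)) * real (Suc n) powr (- Re s - real K)"
  have S: "\<exists>t. x = of_real t \<and> t \<ge> real (Suc n)" if xS: "x \<in> S" for x
  proof -
    obtain u where u: "0 \<le> u" "u \<le> 1" "x = (1 - u) *\<^sub>R of_nat (Suc n) + u *\<^sub>R of_nat (Suc (Suc n))"
      using xS by (auto simp: S_def in_segment)
    hence "x = of_real (real (Suc n) + u)" by (simp add: scaleR_conv_of_real algebra_simps)
    thus ?thesis using u by (intro exI[of _ "real (Suc n) + u"]) auto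
  qed
  have "norm (f 0 (of_nat (Suc (Suc n))) - (\<Sum>i\<le>K. f i (of_nat (Suc n)) * (of_nat (Suc (Suc n)) - of_nat (Suc n)) ^ i / fact i))
      \<le> B * norm (of_nat (Suc (Suc n)) - of_nat (Suc n) :: complex) ^ Suc K / fact K"
  proof (rule complex_Taylor[of S])
    show "convex S" by (simp add: S_def)
    show "of_nat (Suc n) \<in> S" "of_nat (Suc (Suc n)) \<in> S" by (auto simp: S_def)
    show "(f i has_field_derivative f (Suc i) x) (at x within S)" if xS: "x \<in> S" for i x
    proof -
      obtain t where "x = of_real t" "t \<ge> real (Suc n)" using S[OF xS] by blast
      hence "x \<notin> \<real>\<^sub>\<le>\<^sub>0" by auto
      thus ?thesis unfolding f_def
        by (auto intro!: derivative_eq_intros simp: algebra_simps)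
    qed
    show "norm (f (Suc K) x) \<le> B" if xS: "x \<in> S" for x
    proof -
      obtain t where t: "x = of_real t" "t \<ge> real (Suc n)" using S[OF xS] by blast
      have "norm (f (Suc K) x) = (\<Prod>l<Suc K. norm (1 - s - of_nat l)) * t powr (- Re s - real K)"
        using t by (simp add: f_def norm_mult prod_norm norm_powr_real_powr del: prod.lessThan_Suc)
      also have "\<dots> \<le> B" unfolding B_def
        using t assms by (intro mult_left_mono powr_mono2' prod_nonneg) auto
      finally show ?thesis .
    qed
  qed
  also have "f 0 (of_nat (Suc (Suc n))) - (\<Sum>i\<le>K. f i (of_nat (Suc n)) * (of_nat (Suc (Suc n)) - of_nat (Suc n)) ^ i / fact i) = zeta_rem K n s"
    by (simp add: f_def zeta_rem_def gbinomial_prod_rev atLeast0LessThan)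
  also have "B * norm (of_nat (Suc (Suc n)) - of_nat (Suc n) :: complex) ^ Suc K / fact K \<le> B"
  proof -
    have "B \<ge> 0" by (auto simp: B_def intro!: mult_nonneg_nonneg prod_nonneg)
    moreover have "(1::real) \<le> fact K" by (rule fact_ge_1)
    ultimately have "B / fact K \<le> B" by (simp add: divide_le_eq mult_le_cancel_left1)
    thus ?thesis by simp
  qed
  finally show ?thesis by (simp add: B_def)
qed

lemma holomorphic_sum_zeta_rem:
  "(\<lambda>s. \<Sum>n. zeta_rem K n s) holomorphic_on {s. Re s > 1 - real K}"
proof (rule holomorphic_on_half_plane_suminf)
  show "zeta_rem K n holomorphic_on {s. Re s > 1 - real K}" for n
    unfolding zeta_rem_def by (intro holomorphic_intros) auto
  fix \<sigma> R :: real assume \<sigma>: "\<sigma> > 1 - real K" and R: "R \<ge> 0"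
  define M where "M n = (\<Prod>l<Suc K. 1 + R + real l) * real (Suc n) powr (- \<sigma> - real K)" for n
  have "summable M" unfolding M_def using \<sigma> by (intro summable_mult summable_Suc_powr) auto
  moreover have "norm (zeta_rem K n s) \<le> M n" if "\<sigma> \<le> Re s" "norm s \<le> R" for n s
  proof -
    have "norm (zeta_rem K n s) \<le> (\<Prod>l<Suc K. norm (1 - s - of_nat l)) * real (Suc n) powr (- Re s - real K)"
      using that \<sigma> by (intro norm_zeta_rem_le) auto
    also have "\<dots> \<le> M n" unfolding M_def
    proof (intro mult_mono prod_mono conjI)
      fix l
      have "norm (1 - s - of_nat l) \<le> norm (1 - s) + norm (of_nat l :: complex)" by (rule norm_triangle_ineq4)
      also have "norm (1 - s) \<le> 1 + norm s" using norm_triangle_ineq4[of 1 s] by simp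
      finally show "norm (1 - s - of_nat l) \<le> 1 + R + real l" using that by simp
    qed (use that R in \<open>auto intro!: powr_mono prod_nonneg mult_nonneg_nonneg\<close>)
    finally show ?thesis .
  qed
  ultimately show "\<exists>M. summable M \<and> (\<forall>n s. \<sigma> \<le> Re s \<longrightarrow> norm s \<le> R \<longrightarrow> norm (zeta_rem K n s) \<le> M n)"
    by blast
qed

lemma tendsto_of_nat_powr_0:
  assumes "Re s < 0"
  shows "(\<lambda>n. of_nat (Suc n) powr s :: complex) \<longlonglongrightarrow> 0"
proof (rule tendsto_norm_zero_cancel)
  have "(\<lambda>n. real n powr Re s) \<longlonglongrightarrow> 0"
    using assms by (intro tendsto_neg_powr filterlim_real_sequentially)
  hence "(\<lambda>n. real (Suc n) powr Re s) \<longlonglongrightarrow> 0" by (rule LIMSEQ_Suc)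
  thus "(\<lambda>n. norm (of_nat (Suc n) powr s :: complex)) \<longlonglongrightarrow> 0"
    by (simp only: norm_of_nat_powr)
qed

definition zeta_series :: "complex \<Rightarrow> complex" where
  "zeta_series s = (\<Sum>n. of_nat (Suc n) powr (- s))"

lemma zeta_series_sums:
  assumes "Re s > 1"
  shows "(\<lambda>n. of_nat (Suc n) powr (- s)) sums zeta_series s"
proof -
  have "summable (\<lambda>n. norm (of_nat (Suc n) powr (- s) :: complex))"
    unfolding norm_of_nat_powr by (rule summable_Suc_powr) (use assms in simp)
  thus ?thesis unfolding zeta_series_def by (rule summable_sums[OF summable_norm_cancel])
qed

lemma holomorphic_zeta_series: "zeta_series holomorphic_on {s. Re s > 1}"
  unfolding zeta_series_def
proof (rule holomorphic_on_half_plane_suminf)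
  show "(\<lambda>s. of_nat (Suc n) powr (- s)) holomorphic_on {s. Re s > 1}" for n
    by (intro holomorphic_intros) auto
  fix \<sigma> R :: real assume \<sigma>: "\<sigma> > 1"
  have "summable (\<lambda>n. real (Suc n) powr (- \<sigma>))" by (rule summable_Suc_powr) (use \<sigma> in simp)
  moreover have "norm (of_nat (Suc n) powr (- s) :: complex) \<le> real (Suc n) powr (- \<sigma>)" if "\<sigma> \<le> Re s" for n s
    unfolding norm_of_nat_powr using that by (intro powr_mono) auto
  ultimately show "\<exists>M. summable M \<and> (\<forall>n s. \<sigma> \<le> Re s \<longrightarrow> norm s \<le> R \<longrightarrow> norm (of_nat (Suc n) powr (- s) :: complex) \<le> M n)"
    by blast
qed

text \<open>The term \<open>j = 0\<close> of the Taylor polynomial telescopes to \<open>- 1\<close>,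
  the term \<open>j = 1\<close> yields the left-hand side. Each further zeta value is grouped with
  the factor \<open>s + i\<close>, so that only \<open>(t - 1) * zeta_series t\<close> at
  \<open>t = s + i + 1\<close> occurs, a function without pole.\<close>

lemma zeta_series_recursion:
  assumes s: "Re s > 1"
  shows "(s - 1) * zeta_series s = 1 + (\<Sum>n. zeta_rem (Suc m) n s) -
    (\<Sum>i<m. ((1 - s) gchoose (Suc i)) / of_nat (i + 2) * ((s + of_nat i) * zeta_series (s + of_nat i + 1)))"
proof -
  let ?p = "\<lambda>n. of_nat (Suc n) powr (1 - s) :: complex"
  have "(\<lambda>n. ?p (Suc n) - ?p n) sums (0 - ?p 0)"
    using s by (intro telescope_sums tendsto_of_nat_powr_0) auto
  moreover have "(\<lambda>n. \<Sum>j<Suc m. ((1 - s) gchoose (Suc j)) * of_nat (Suc n) powr (- (s + of_nat j)))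
      sums (\<Sum>j<Suc m. ((1 - s) gchoose (Suc j)) * zeta_series (s + of_nat j))"
    using s by (intro sums_sum sums_mult zeta_series_sums) auto
  ultimately have "(\<lambda>n. (?p (Suc n) - ?p n) - (\<Sum>j<Suc m. ((1 - s) gchoose (Suc j)) * of_nat (Suc n) powr (- (s + of_nat j))))
     sums ((0 - ?p 0) - (\<Sum>j<Suc m. ((1 - s) gchoose (Suc j)) * zeta_series (s + of_nat j)))"
    by (rule sums_diff)
  also have "(\<lambda>n. (?p (Suc n) - ?p n) - (\<Sum>j<Suc m. ((1 - s) gchoose (Suc j)) * of_nat (Suc n) powr (- (s + of_nat j))))
      = (\<lambda>n. zeta_rem (Suc m) n s)"
    unfolding zeta_rem_def
  proof
    fix n
    have "1 - s - of_nat (Suc j) = - (s + of_nat j)" for j by simp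
    thus "(?p (Suc n) - ?p n) - (\<Sum>j<Suc m. ((1 - s) gchoose (Suc j)) * of_nat (Suc n) powr (- (s + of_nat j))) =
      of_nat (Suc (Suc n)) powr (1 - s) - (\<Sum>j\<le>Suc m. ((1 - s) gchoose j) * of_nat (Suc n) powr (1 - s - of_nat j))"
      by (subst sum.atMost_Suc_shift) (simp only: lessThan_Suc_atMost gbinomial_0 of_nat_0 diff_zero mult_1_left diff_diff_eq)
  qed
  finally have eq: "(\<Sum>n. zeta_rem (Suc m) n s) = - 1 - (\<Sum>j<Suc m. ((1 - s) gchoose (Suc j)) * zeta_series (s + of_nat j))"
    by (simp add: sums_iff)
  \<comment> \<open>Splits off the last factor of the binomial coefficient; it is the zero that
    cancels the pole of zeta at \<open>s + j = 1\<close>.\<close>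
  have g: "((1 - s) gchoose (Suc j)) = - (((1 - s) gchoose j) * (s + of_nat j - 1)) / of_nat (Suc j)" for j
    unfolding gbinomial_prod_rev by (simp add: field_simps del: of_nat_Suc)
  have "(\<Sum>j<Suc m. ((1 - s) gchoose (Suc j)) * zeta_series (s + of_nat j))
     = - (s - 1) * zeta_series s + (\<Sum>i<m. ((1 - s) gchoose (Suc (Suc i))) * zeta_series (s + of_nat (Suc i)))"
    by (subst sum.lessThan_Suc_shift) simp
  also have "(\<Sum>i<m. ((1 - s) gchoose (Suc (Suc i))) * zeta_series (s + of_nat (Suc i))) =
     - (\<Sum>i<m. ((1 - s) gchoose (Suc i)) / of_nat (i + 2) * ((s + of_nat i) * zeta_series (s + of_nat i + 1)))"
    unfolding sum_negf[symmetric]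
  proof (rule sum.cong[OF refl])
    fix i
    show "((1 - s) gchoose (Suc (Suc i))) * zeta_series (s + of_nat (Suc i)) =
      - (((1 - s) gchoose (Suc i)) / of_nat (i + 2) * ((s + of_nat i) * zeta_series (s + of_nat i + 1)))"
      by (subst g) (simp add: add_ac)
  qed
  finally show ?thesis unfolding eq by (simp only: algebra_simps) (simp add: algebra_simps)
qed

text \<open>The recursion at \<open>s\<close> calls the function only at points whose real part is
  larger by at least 1, where it is known by induction, and the remainder series of order
  \<open>Suc m\<close> converges on the half-plane wider by one unit.\<close>

lemma zeta_continuation_step:
  "\<exists>g. g holomorphic_on {s. Re s > 1 - real m} \<and> (\<forall>s. Re s > 1 \<longrightarrow> g s = (s - 1) * zeta_series s)"
proof (induction m)
  case 0
  show ?case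
    by (intro exI[of _ "\<lambda>s. (s - 1) * zeta_series s"]) (auto intro!: holomorphic_intros holomorphic_zeta_series)
next
  case (Suc m)
  then obtain g where g: "g holomorphic_on {s. Re s > 1 - real m}" "\<And>s. Re s > 1 \<Longrightarrow> g s = (s - 1) * zeta_series s"
    by blast
  define h where "h s = 1 + (\<Sum>n. zeta_rem (Suc m) n s) -
    (\<Sum>i<m. ((1 - s) gchoose (Suc i)) / of_nat (i + 2) * g (s + of_nat i + 1))" for s
  have "h holomorphic_on {s. Re s > 1 - real (Suc m)}"
    unfolding h_def
  proof (intro holomorphic_intros holomorphic_sum_zeta_rem)
    fix i
    have "(g \<circ> (\<lambda>s. s + of_nat i + 1)) holomorphic_on {s. Re s > 1 - real (Suc m)}"
      by (rule holomorphic_on_compose_gen[OF _ g(1)]) (auto intro!: holomorphic_intros)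
    thus "(\<lambda>s. g (s + of_nat i + 1)) holomorphic_on {s. Re s > 1 - real (Suc m)}"
      by (simp add: o_def)
    show "of_nat (i + 2) \<noteq> (0 :: complex)" unfolding of_nat_eq_0_iff by presburger
  qed
  moreover have "h s = (s - 1) * zeta_series s" if "Re s > 1" for s
    using zeta_series_recursion[OF that, of m] that by (simp add: h_def g(2))
  ultimately show ?case by blast
qed

text \<open>The functions on the nested half-planes agree by the identity theorem and glue to an
  entire function, evaluated at \<open>s\<close> through any half-plane containing
  \<open>s\<close>.\<close>

lemma zeta_continuation:
  obtains \<xi> where "\<xi> holomorphic_on UNIV" "\<And>s. Re s > 1 \<Longrightarrow> \<xi> s = (s - 1) * zeta_series s"
proof -
  obtain g where g: "\<And>m. g m holomorphic_on {s. Re s > 1 - real m}"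
    "\<And>m s. Re s > 1 \<Longrightarrow> g m s = (s - 1) * zeta_series s"
    using zeta_continuation_step by metis
  have eq: "g m s = g n s" if "Re s > 1 - real m" "m \<le> n" for m n s
  proof (rule analytic_continuation_open[of "{s. Re s > 1}" "{s. Re s > 1 - real m}" "g m" "g n"])
    show "g n holomorphic_on {s. Re s > 1 - real m}"
      using that by (intro holomorphic_on_subset[OF g(1)]) auto
    show "{s. Re s > 1} \<noteq> {}" by (auto intro!: exI[of _ 2])
    show "connected {s. Re s > 1 - real m}" by (intro convex_connected convex_halfspace_Re_gt)
  qed (use that g in \<open>auto intro: open_halfspace_Re_gt\<close>)
  define k where "k s = nat \<lceil>2 - Re s\<rceil>" for s
  define \<xi> where "\<xi> s = g (k s) s" for s
  have k: "Re s > 1 - real (k s)" for s unfolding k_def by linarith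
  have \<xi>: "\<xi> s = g m s" if "Re s > 1 - real m" for s m
    using eq[of m s "k s"] eq[of "k s" s m] that k[of s] unfolding \<xi>_def by (metis linear)
  have "\<xi> holomorphic_on (\<Union>m. {s. Re s > 1 - real m})"
  proof (rule holomorphic_on_UN_open)
    show "\<xi> holomorphic_on {s. Re s > 1 - real m}" for m
      using g(1)[of m] by (rule holomorphic_transform) (use \<xi> in auto)
  qed (auto intro: open_halfspace_Re_gt)
  moreover have "(\<Union>m. {s. Re s > 1 - real m}) = UNIV" using k by blast
  ultimately show ?thesis using that[of \<xi>] g(2) by (auto simp: \<xi>_def)
qed

text \<open>Makes the definite description usable. Uniqueness is the identity theorem on the plane
  without 1, which is still connected; the value at 1 is settled by the convention.\<close>

lemma riemann_zeta_properties:
  "riemann_zeta holomorphic_on - {1} \<and> riemann_zeta 1 = 0 \<and>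
   (\<forall>s. Re s > 1 \<longrightarrow> (\<lambda>n. of_nat (Suc n) powr (- s)) sums riemann_zeta s)"
proof -
  obtain \<xi> where \<xi>: "\<xi> holomorphic_on UNIV" "\<And>s. Re s > 1 \<Longrightarrow> \<xi> s = (s - 1) * zeta_series s"
    using zeta_continuation by blast
  define Z where "Z s = (if s = 1 then 0 else \<xi> s / (s - 1))" for s
  have "(\<lambda>s. \<xi> s / (s - 1)) holomorphic_on - {1}"
    by (intro holomorphic_intros holomorphic_on_subset[OF \<xi>(1)]) auto
  hence Z: "Z holomorphic_on - {1}" by (rule holomorphic_transform) (auto simp: Z_def)
  have Z': "Z s = zeta_series s" if "Re s > 1" for s
    using that by (auto simp: Z_def \<xi>(2))
  have ex: "Z holomorphic_on - {1} \<and> Z 1 = 0 \<and> (\<forall>s. Re s > 1 \<longrightarrow> (\<lambda>n. of_nat (Suc n) powr (- s)) sums Z s)"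
    using Z Z' zeta_series_sums by (auto simp: Z_def[of 1])
  have uniq: "F = Z" if F: "F holomorphic_on - {1} \<and> F 1 = 0 \<and> (\<forall>s. Re s > 1 \<longrightarrow> (\<lambda>n. of_nat (Suc n) powr (- s)) sums F s)" for F
  proof
    fix s
    show "F s = Z s"
    proof (cases "s = 1")
      case False
      show ?thesis
      proof (rule analytic_continuation_open[of "{s. Re s > 1}" "- {1}" F Z])
        show "{s. Re s > 1} \<noteq> {}" by (auto intro!: exI[of _ 2])
        show "connected (- {1::complex})" by (rule connected_punctured_universe) simp
        show "F s = Z s" if "s \<in> {s. Re s > 1}" for s
          using F that Z'[of s] zeta_series_sums[of s] by (metis mem_Collect_eq sums_unique2)
        show "F holomorphic_on - {1}" using F by blast
      qed (use Z False in \<open>auto intro: open_halfspace_Re_gt\<close>)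
    qed (use F in \<open>simp add: Z_def\<close>)
  qed
  have "\<exists>!F. F holomorphic_on - {1} \<and> F 1 = 0 \<and> (\<forall>s. Re s > 1 \<longrightarrow> (\<lambda>n. of_nat (Suc n) powr (- s)) sums F s)"
    using ex uniq by (rule ex1I)
  from theI'[OF this] show ?thesis unfolding riemann_zeta_def .
qed

lemma riemann_zeta_sums:
  "Re s > 1 \<Longrightarrow> (\<lambda>n. of_nat (Suc n) powr (- s)) sums riemann_zeta s"
  using riemann_zeta_properties by blast

text \<open>Shows the singularity at 1 to be at most a simple pole, in the form from which the
  spectral zeta function is seen to be meromorphic near \<open>s = 1\<close>.\<close>

lemma riemann_zeta_pole:
  obtains \<xi> where "\<xi> holomorphic_on UNIV" "\<And>s. s \<noteq> 1 \<Longrightarrow> riemann_zeta s = \<xi> s / (s - 1)"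
proof -
  obtain \<xi> where \<xi>: "\<xi> holomorphic_on UNIV" "\<And>s. Re s > 1 \<Longrightarrow> \<xi> s = (s - 1) * zeta_series s"
    using zeta_continuation by blast
  have "riemann_zeta s = \<xi> s / (s - 1)" if "s \<noteq> 1" for s
  proof (rule analytic_continuation_open[of "{s. Re s > 1}" "- {1}" riemann_zeta "\<lambda>s. \<xi> s / (s - 1)"])
    show "{s. Re s > 1} \<noteq> {}" by (auto intro!: exI[of _ 2])
    show "connected (- {1::complex})" by (rule connected_punctured_universe) simp
    show "(\<lambda>s. \<xi> s / (s - 1)) holomorphic_on - {1}"
      by (intro holomorphic_intros holomorphic_on_subset[OF \<xi>(1)]) auto
    show "riemann_zeta s = \<xi> s / (s - 1)" if "s \<in> {s. Re s > 1}" for s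
    proof -
      have s: "Re s > 1" using that by simp
      hence "s \<noteq> 1" by auto
      thus ?thesis using sums_unique2[OF riemann_zeta_sums[OF s] zeta_series_sums[OF s]] \<xi>(2)[OF s] by simp
    qed
    show "riemann_zeta holomorphic_on - {1}" using riemann_zeta_properties by blast
  qed (use that in \<open>auto intro: open_halfspace_Re_gt\<close>)
  thus ?thesis by (rule that[OF \<xi>(1)])
qed

section \<open>The spectral zeta function\<close>

text \<open>Mean value inequality on the segment; \<open>Re w \<le> 1\<close> makes the derivative
  largest at the left end \<open>x\<close>.\<close>

lemma norm_powr_diff_le:
  fixes x y :: real and w :: complex
  assumes "0 < x" "x \<le> y" "Re w \<le> 1"
  shows "norm (of_real y powr w - of_real x powr w :: complex) \<le> norm w * x powr (Re w - 1) * (y - x)"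
proof -
  have "norm (of_real y powr w - of_real x powr w :: complex) \<le> norm w * x powr (Re w - 1) * norm (of_real y - of_real x :: complex)"
  proof (rule field_differentiable_bound[of "closed_segment (of_real x) (of_real y)" _ "\<lambda>z. w * z powr (w - 1)"])
    fix z :: complex assume z: "z \<in> closed_segment (of_real x) (of_real y)"
    then obtain t where t: "z = of_real t" "x \<le> t"
      using assms by (auto simp: closed_segment_of_real closed_segment_eq_real_ivl)
    hence "z \<notin> \<real>\<^sub>\<le>\<^sub>0" using assms by auto
    thus "((\<lambda>z. z powr w) has_field_derivative w * z powr (w - 1)) (at z within closed_segment (of_real x) (of_real y))"
      by (auto intro!: derivative_eq_intros)
    show "norm (w * z powr (w - 1)) \<le> norm w * x powr (Re w - 1)"
      using assms t by (auto simp: norm_mult norm_powr_real_powr intro!: mult_left_mono powr_mono2')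
  qed auto
  also have "norm (of_real y - of_real x :: complex) = y - x"
    using assms by (simp flip: of_real_diff)
  finally show ?thesis .
qed

text \<open>The mean value inequality for the power minus its tangent at \<open>x\<close>: the
  derivative of this difference is itself a difference of powers, bounded by the previous lemma.
  This gives the second factor \<open>y - x\<close>.\<close>

lemma norm_powr_diff_linear_le:
  fixes x y :: real and s :: complex
  assumes "0 < x" "x \<le> y" "Re s \<ge> -1"
  shows "norm (of_real y powr (1 - s) - of_real x powr (1 - s) - (1 - s) * of_real (y - x) * of_real x powr (- s) :: complex)
    \<le> norm (1 - s) * norm s * x powr (- Re s - 1) * (y - x)\<^sup>2"
proof -
  define f where "f z = z powr (1 - s) - (1 - s) * of_real x powr (- s) * z" for z :: complex
  have "norm (f (of_real y) - f (of_real x)) \<le> norm (1 - s) * (norm s * x powr (- Re s - 1) * (y - x)) * norm (of_real y - of_real x :: complex)"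
  proof (rule field_differentiable_bound[of "closed_segment (of_real x) (of_real y)" _ "\<lambda>z. (1 - s) * (z powr (- s) - of_real x powr (- s))"])
    fix z :: complex assume z: "z \<in> closed_segment (of_real x) (of_real y)"
    then obtain t where t: "z = of_real t" "x \<le> t" "t \<le> y"
      using assms by (auto simp: closed_segment_of_real closed_segment_eq_real_ivl)
    hence "z \<notin> \<real>\<^sub>\<le>\<^sub>0" using assms by auto
    thus "(f has_field_derivative (1 - s) * (z powr (- s) - of_real x powr (- s))) (at z within closed_segment (of_real x) (of_real y))"
      unfolding f_def by (auto intro!: derivative_eq_intros simp: algebra_simps)
    have "norm (z powr (- s) - of_real x powr (- s)) \<le> norm (- s) * x powr (Re (- s) - 1) * (t - x)"
      unfolding t by (rule norm_powr_diff_le) (use assms t in auto)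
    also have "\<dots> \<le> norm s * x powr (- Re s - 1) * (y - x)"
      using t by (auto intro!: mult_left_mono)
    finally show "norm ((1 - s) * (z powr (- s) - of_real x powr (- s))) \<le> norm (1 - s) * (norm s * x powr (- Re s - 1) * (y - x))"
      by (auto simp: norm_mult intro!: mult_left_mono)
  qed auto
  also have "norm (of_real y - of_real x :: complex) = y - x"
    using assms by (simp flip: of_real_diff)
  also have "f (of_real y) - f (of_real x) = of_real y powr (1 - s) - of_real x powr (1 - s) - (1 - s) * of_real (y - x) * of_real x powr (- s)"
    by (simp add: f_def algebra_simps)
  finally show ?thesis by (simp add: power2_eq_square algebra_simps)
qed

text \<open>With \<open>x = n + 1\<close>, \<open>y = x + b\<close> and \<open>p\<close>,
  \<open>q\<close> their powers with exponent \<open>- s\<close>, one has \<open>(x + y) * p * q = x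
  * p^2 + y * q^2 + (p - q) * (y * q - x * p)\<close>. Here \<open>y * q - x * p\<close> is
  \<open>1 - s\<close> times the integral of \<open>t powr (- s)\<close> from \<open>x\<close> to
  \<open>y\<close>. Replacing the integral by the trapezoidal rule gives the telescoping term;
  \<open>spec_rem\<close> is the error. Both of its factors vanish at \<open>s = 0\<close>.\<close>

definition spec_rem :: "nat \<Rightarrow> nat \<Rightarrow> complex \<Rightarrow> complex" where
  "spec_rem b n s = (of_nat (Suc n) powr (- s) - of_nat (Suc n + b) powr (- s)) *
     (of_nat (Suc n + b) powr (1 - s) - of_nat (Suc n) powr (1 - s)
      - of_nat b * (1 - s) / 2 * (of_nat (Suc n) powr (- s) + of_nat (Suc n + b) powr (- s)))"

lemma norm_spec_rem_le:
  assumes "Re s \<ge> -1"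
  shows "norm (spec_rem b n s) \<le> 2 * real b ^ 3 * (norm s)\<^sup>2 * norm (1 - s) * real (Suc n) powr (- 2 * Re s - 2)"
proof -
  let ?x = "real (Suc n)" and ?y = "real (Suc n + b)"
  define p q :: complex where "p = of_nat (Suc n) powr (- s)" and "q = of_nat (Suc n + b) powr (- s)"
  define P Q :: complex where "P = of_nat (Suc n) powr (1 - s)" and "Q = of_nat (Suc n + b) powr (1 - s)"
  define X where "X = ?x powr (- Re s - 1)"
  have X: "X \<ge> 0" by (simp add: X_def)
  have 1: "norm (q - p) \<le> norm s * X * real b"
    using norm_powr_diff_le[of ?x ?y "- s"] assms by (simp add: p_def q_def X_def)
  have 2: "norm (Q - P - (1 - s) * of_nat b * p) \<le> norm (1 - s) * norm s * X * (real b)\<^sup>2"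
    using norm_powr_diff_linear_le[of ?x ?y s] assms by (simp add: p_def P_def Q_def X_def)
  \<comment> \<open>The trapezoidal rule differs from the left endpoint rule by a multiple of
    \<open>p - q\<close>, which is already estimated in \<open>1\<close>. The rough constant 2
    suffices.\<close>
  have "norm (Q - P - of_nat b * (1 - s) / 2 * (p + q))
      = norm ((Q - P - (1 - s) * of_nat b * p) + of_nat b * (1 - s) / 2 * (p - q))"
    by (rule arg_cong[of _ _ norm]) (simp add: field_simps)
  also have "\<dots> \<le> norm (1 - s) * norm s * X * (real b)\<^sup>2 + real b * norm (1 - s) / 2 * (norm s * X * real b)"
    using 1 by (intro order.trans[OF norm_triangle_ineq] add_mono 2) (auto simp: norm_mult norm_divide norm_minus_commute intro!: mult_left_mono)
  also have "\<dots> \<le> 2 * (norm (1 - s) * norm s * X * (real b)\<^sup>2)"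
    using X by (simp add: power2_eq_square mult_ac)
  finally have 3: "norm (Q - P - of_nat b * (1 - s) / 2 * (p + q)) \<le> 2 * (norm (1 - s) * norm s * X * (real b)\<^sup>2)" .
  have "norm (spec_rem b n s) = norm (q - p) * norm (Q - P - of_nat b * (1 - s) / 2 * (p + q))"
    by (simp add: spec_rem_def norm_mult p_def q_def P_def Q_def norm_minus_commute del: of_nat_add of_nat_Suc)
  also have "\<dots> \<le> (norm s * X * real b) * (2 * (norm (1 - s) * norm s * X * (real b)\<^sup>2))"
    by (intro mult_mono 1 3) (use X in auto)
  also have "\<dots> = 2 * real b ^ 3 * (norm s)\<^sup>2 * norm (1 - s) * (X * X)"
    by (simp add: power2_eq_square power3_eq_cube mult_ac)
  also have "X * X = ?x powr (- 2 * Re s - 2)"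
    by (simp add: X_def powr_add[symmetric] del: of_nat_Suc)
  finally show ?thesis .
qed

text \<open>Uniform in \<open>s\<close> except for the explicit factor
  \<open>(norm s)\<^sup>2\<close>, which later makes the derivative at 0 vanish. The condition on
  \<open>\<sigma>\<close> is what brings the exponent below \<open>- 1\<close>.\<close>

lemma spec_rem_bound:
  assumes "\<sigma> > -1/2" "R \<ge> 0" "\<sigma> \<le> Re s" "norm s \<le> R"
  shows "norm (spec_rem b n s) \<le> 2 * real b ^ 3 * (norm s)\<^sup>2 * (1 + R) * real (Suc n) powr (- 2 * \<sigma> - 2)"
proof -
  have "norm (1 - s) \<le> 1 + R" using norm_triangle_ineq4[of 1 s] assms by simp
  hence "2 * real b ^ 3 * (norm s)\<^sup>2 * norm (1 - s) * real (Suc n) powr (- 2 * Re s - 2) \<le>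
    2 * real b ^ 3 * (norm s)\<^sup>2 * (1 + R) * real (Suc n) powr (- 2 * \<sigma> - 2)"
    using assms by (intro mult_mono mult_left_mono powr_mono) auto
  thus ?thesis using norm_spec_rem_le[of s b n] assms by auto
qed

lemma summable_spec_rem_bound:
  "\<sigma> > -1/2 \<Longrightarrow> summable (\<lambda>n. C * real (Suc n) powr (- 2 * \<sigma> - 2))"
  by (intro summable_mult summable_Suc_powr) auto

lemma spec_rem_sums:
  assumes "Re s > -1/2"
  shows "(\<lambda>n. spec_rem b n s) sums (\<Sum>n. spec_rem b n s)"
proof (rule summable_sums, rule summable_comparison_test[OF _ summable_spec_rem_bound[OF assms]])
  show "\<exists>N. \<forall>n\<ge>N. norm (spec_rem b n s) \<le> (2 * real b ^ 3 * (norm s)\<^sup>2 * (1 + norm s)) * real (Suc n) powr (- 2 * Re s - 2)"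
    using spec_rem_bound[OF assms, of "norm s" s b] by auto
qed

lemma holomorphic_sum_spec_rem:
  "(\<lambda>s. \<Sum>n. spec_rem b n s) holomorphic_on {s. Re s > -1/2}"
proof (rule holomorphic_on_half_plane_suminf)
  show "spec_rem b n holomorphic_on {s. Re s > -1/2}" for n
    unfolding spec_rem_def by (intro holomorphic_intros) auto
  fix \<sigma> R :: real assume \<sigma>: "\<sigma> > -1/2" and R: "R \<ge> 0"
  have "norm (spec_rem b n s) \<le> (2 * real b ^ 3 * R\<^sup>2 * (1 + R)) * real (Suc n) powr (- 2 * \<sigma> - 2)"
    if "\<sigma> \<le> Re s" "norm s \<le> R" for n s
  proof -
    have "2 * real b ^ 3 * (norm s)\<^sup>2 * (1 + R) * real (Suc n) powr (- 2 * \<sigma> - 2) \<le> (2 * real b ^ 3 * R\<^sup>2 * (1 + R)) * real (Suc n) powr (- 2 * \<sigma> - 2)"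
      using that R by (intro mult_mono mult_left_mono power_mono) auto
    thus ?thesis using spec_rem_bound[OF \<sigma> R that, of b n] by linarith
  qed
  thus "\<exists>M. summable M \<and> (\<forall>n s. \<sigma> \<le> Re s \<longrightarrow> norm s \<le> R \<longrightarrow> norm (spec_rem b n s) \<le> M n)"
    using summable_spec_rem_bound[OF \<sigma>] by blast
qed

lemma deriv_sum_spec_rem_0:
  "((\<lambda>s. \<Sum>n. spec_rem b n s) has_field_derivative 0) (at 0)"
proof -
  define E where "E s = (\<Sum>n. spec_rem b n s)" for s
  \<comment> \<open>The case \<open>\<sigma> = - 1/4\<close>, \<open>R = 1/4\<close> of
    \<open>spec_rem_bound\<close>: then \<open>1 + R = 5/4\<close> and
    \<open>- 2 * \<sigma> - 2 = - 3/2\<close>.\<close>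
  define C where "C = (\<Sum>n. (2 * real b ^ 3 * (5/4)) * real (Suc n) powr (-3/2))"
  have summ: "summable (\<lambda>n. (2 * real b ^ 3 * (5/4)) * real (Suc n) powr (-3/2))"
    by (intro summable_mult summable_Suc_powr) auto
  have E0: "E 0 = 0" by (simp add: E_def spec_rem_def del: of_nat_Suc of_nat_add)
  have bd: "norm (E s) \<le> C * (norm s)\<^sup>2" if s: "norm s \<le> 1/4" for s
  proof -
    have "Re s \<ge> -1/4" using s abs_Re_le_cmod[of s] by linarith
    hence *: "norm (spec_rem b n s) \<le> ((2 * real b ^ 3 * (5/4)) * real (Suc n) powr (-3/2)) * (norm s)\<^sup>2" for n
      using spec_rem_bound[of "-1/4" "1/4" s b n] s by (simp add: mult_ac)
    have "norm (E s) \<le> (\<Sum>n. ((2 * real b ^ 3 * (5/4)) * real (Suc n) powr (-3/2)) * (norm s)\<^sup>2)"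
      unfolding E_def by (rule norm_suminf_le[OF *]) (intro summable_mult2 summ)
    also have "\<dots> = C * (norm s)\<^sup>2" unfolding C_def by (rule suminf_mult2[symmetric, OF summ])
    finally show ?thesis .
  qed
  have "((\<lambda>h. (E (0 + h) - E 0) / h) \<longlongrightarrow> 0) (at 0)"
  proof (rule Lim_null_comparison)
    have "eventually (\<lambda>h::complex. h \<in> ball 0 (1/4)) (at 0)"
      by (intro eventually_at_in_open') auto
    thus "eventually (\<lambda>h. norm ((E (0 + h) - E 0) / h) \<le> C * norm h) (at 0)"
    proof (rule eventually_mono)
      fix h :: complex assume "h \<in> ball 0 (1/4)"
      thus "norm ((E (0 + h) - E 0) / h) \<le> C * norm h"
        using bd[of h] by (cases "h = 0") (auto simp: E0 norm_divide field_simps power2_eq_square)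
    qed
    show "((\<lambda>h::complex. C * norm h) \<longlongrightarrow> 0) (at 0)"
      by (auto intro!: tendsto_eq_intros)
  qed
  thus ?thesis by (simp add: DERIV_def E_def)
qed

lemma spectral_term_identity:
  fixes s :: complex
  shows "of_nat (2 * Suc n + b) * of_nat (Suc n * (Suc n + b)) powr (- s) =
    of_nat (Suc n) powr (- (2 * s - 1)) + of_nat (Suc n + b) powr (- (2 * s - 1))
    + of_nat b * (1 - s) / 2 * (of_nat (Suc n) powr (- (2 * s)) - of_nat (Suc n + b) powr (- (2 * s)))
    + spec_rem b n s"
proof -
  define x y :: complex where "x = of_nat (Suc n)" and "y = of_nat (Suc n + b)"
  define p q where "p = x powr (- s)" and "q = y powr (- s)"
  have nz: "x \<noteq> 0" "y \<noteq> 0" unfolding x_def y_def of_nat_eq_0_iff by auto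
  have 1: "x powr (1 - s) = x * p" "y powr (1 - s) = y * q"
    using nz powr_add[of x 1 "- s"] powr_add[of y 1 "- s"] by (simp_all add: p_def q_def)
  have 2: "x powr (- (2 * s)) = p * p" "y powr (- (2 * s)) = q * q"
    by (simp_all add: p_def q_def powr_add[symmetric])
  have 3: "x powr (- (2 * s - 1)) = x * (p * p)" "y powr (- (2 * s - 1)) = y * (q * q)"
    using nz powr_add[of x 1 "- (2 * s)"] powr_add[of y 1 "- (2 * s)"] 2 by (simp_all add: algebra_simps)
  have "of_nat (Suc n * (Suc n + b)) powr (- s) = p * q"
    unfolding p_def q_def x_def y_def of_nat_mult by (subst powr_times_real) auto
  moreover have "of_nat (2 * Suc n + b) = x + y" "of_nat b = y - x"
    by (simp_all add: x_def y_def)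
  ultimately show ?thesis
    unfolding spec_rem_def x_def[symmetric] y_def[symmetric] 1 2 3 p_def[symmetric] q_def[symmetric]
    by (simp only: \<open>of_nat b = y - x\<close>) (simp add: field_simps)
qed

lemma spectral_series_sums:
  assumes s: "Re s > 1"
  shows "(\<lambda>n. of_nat (2 * Suc n + b) * of_nat (Suc n * (Suc n + b)) powr (- s)) sums
    (2 * riemann_zeta (2 * s - 1) - (\<Sum>n<b. of_nat (Suc n) powr (1 - 2 * s))
     + of_nat b * (1 - s) / 2 * (\<Sum>n<b. of_nat (Suc n) powr (- (2 * s)))
     + (\<Sum>n. spec_rem b n s))"
proof -
  have A: "(\<lambda>n. of_nat (Suc n) powr (- (2 * s - 1))) sums riemann_zeta (2 * s - 1)"
    by (rule riemann_zeta_sums) (use s in simp)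
  \<comment> \<open>The value at \<open>2 * s\<close> enters twice with opposite signs; of the
    difference only the first \<open>b\<close> terms survive.\<close>
  have C: "(\<lambda>n. of_nat (Suc n) powr (- (2 * s))) sums riemann_zeta (2 * s)"
    by (rule riemann_zeta_sums) (use s in simp)
  have "(\<lambda>n. of_nat (Suc n + b) powr (- (2 * s - 1))) sums
      (riemann_zeta (2 * s - 1) - (\<Sum>n<b. of_nat (Suc n) powr (- (2 * s - 1))))"
    using sums_split_initial_segment[OF A, of b] by (simp add: add_ac)
  moreover have "(\<lambda>n. of_nat (Suc n + b) powr (- (2 * s))) sums
      (riemann_zeta (2 * s) - (\<Sum>n<b. of_nat (Suc n) powr (- (2 * s))))"
    using sums_split_initial_segment[OF C, of b] by (simp add: add_ac)
  moreover have "(\<lambda>n. spec_rem b n s) sums (\<Sum>n. spec_rem b n s)"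
    by (rule spec_rem_sums) (use s in simp)
  ultimately have "(\<lambda>n. of_nat (Suc n) powr (- (2 * s - 1)) + of_nat (Suc n + b) powr (- (2 * s - 1))
      + of_nat b * (1 - s) / 2 * (of_nat (Suc n) powr (- (2 * s)) - of_nat (Suc n + b) powr (- (2 * s)))
      + spec_rem b n s) sums
    (riemann_zeta (2 * s - 1) + (riemann_zeta (2 * s - 1) - (\<Sum>n<b. of_nat (Suc n) powr (- (2 * s - 1))))
      + of_nat b * (1 - s) / 2 * (riemann_zeta (2 * s) - (riemann_zeta (2 * s) - (\<Sum>n<b. of_nat (Suc n) powr (- (2 * s)))))
      + (\<Sum>n. spec_rem b n s))"
    using A C by (intro sums_add sums_mult sums_diff)
  thus ?thesis unfolding spectral_term_identity by (simp add: algebra_simps)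
qed

text \<open>The spectral zeta function is an unordered sum over eigenvalues, so the ordered series
  has to be upgraded by absolute convergence. The majorant uses
  \<open>2 * Suc n + b \<le> (2 + b) * Suc n\<close> and drops \<open>b\<close> inside the
  power.\<close>

lemma spectral_series_has_sum:
  assumes s: "Re s > 1"
  shows "((\<lambda>n. of_nat (2 * Suc n + b) * of_nat (Suc n * (Suc n + b)) powr (- s)) has_sum
    (2 * riemann_zeta (2 * s - 1) - (\<Sum>n<b. of_nat (Suc n) powr (1 - 2 * s))
     + of_nat b * (1 - s) / 2 * (\<Sum>n<b. of_nat (Suc n) powr (- (2 * s)))
     + (\<Sum>n. spec_rem b n s))) UNIV"
proof (rule norm_summable_imp_has_sum[OF _ spectral_series_sums[OF s]])
  have le: "norm (of_nat (2 * Suc n + b) * of_nat (Suc n * (Suc n + b)) powr (- s) :: complex)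
      \<le> real (2 + b) * real (Suc n) powr (1 - 2 * Re s)" for n
  proof -
    have "norm (of_nat (2 * Suc n + b) * of_nat (Suc n * (Suc n + b)) powr (- s) :: complex)
      = real (2 * Suc n + b) * real (Suc n * (Suc n + b)) powr (- Re s)"
      unfolding norm_mult norm_of_nat_powr norm_of_nat by simp
    also have "\<dots> \<le> (real (2 + b) * real (Suc n)) * real (Suc n * Suc n) powr (- Re s)"
    proof (intro mult_mono powr_mono2')
      have "b \<le> b * Suc n" by simp
      hence "2 * Suc n + b \<le> (2 + b) * Suc n" by (simp only: add_mult_distrib)
      thus "real (2 * Suc n + b) \<le> real (2 + b) * real (Suc n)"
        by (simp only: of_nat_mult[symmetric] of_nat_le_iff)
      have "Suc n * Suc n \<le> Suc n * (Suc n + b)" by (rule mult_le_mono2) simp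
      thus "real (Suc n * Suc n) \<le> real (Suc n * (Suc n + b))" by (simp only: of_nat_le_iff)
      show "0 < real (Suc n * Suc n)" unfolding of_nat_0_less_iff by simp
    qed (use s in auto)
    also have "real (Suc n * Suc n) powr (- Re s) = real (Suc n) powr (- 2 * Re s)"
      unfolding of_nat_mult by (subst powr_mult) (auto simp: powr_add[symmetric] simp del: of_nat_Suc)
    also have "real (2 + b) * real (Suc n) * real (Suc n) powr (- 2 * Re s) = real (2 + b) * real (Suc n) powr (1 - 2 * Re s)"
      using powr_add[of "real (Suc n)" 1 "- 2 * Re s"] by (simp del: of_nat_Suc)
    finally show ?thesis .
  qed
  have "summable (\<lambda>n. real (2 + b) * real (Suc n) powr (1 - 2 * Re s))"
    by (rule summable_mult, rule summable_Suc_powr) (use s in simp)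
  thus "summable (\<lambda>n. norm (of_nat (2 * Suc n + b) * of_nat (Suc n * (Suc n + b)) powr (- s) :: complex))"
    by (rule summable_comparison_test[rotated]) (simp only: real_norm_def abs_norm_cancel, use le in blast)
qed

lemma spectral_continuation:
  obtains F where "F meromorphic_on {s. Re s > -1/2}" "F analytic_on {0}"
    "\<And>s. Re s > 1 \<Longrightarrow> ((\<lambda>n. of_nat (2 * Suc n + b) * of_nat (Suc n * (Suc n + b)) powr (- s)) has_sum F s) UNIV"
    "deriv F 0 = 4 * deriv riemann_zeta (- 1) + of_real (2 * (\<Sum>n<b. real (Suc n) * ln (real (Suc n))) - (real b)\<^sup>2 / 2 - real b * ln (fact b))"
proof -
  obtain \<xi> where \<xi>: "\<xi> holomorphic_on UNIV" "\<And>s. s \<noteq> 1 \<Longrightarrow> riemann_zeta s = \<xi> s / (s - 1)"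
    using riemann_zeta_pole by blast
  define G where "G s = - (\<Sum>n<b. of_nat (Suc n) powr (1 - 2 * s))
     + of_nat b * (1 - s) / 2 * (\<Sum>n<b. of_nat (Suc n) powr (- (2 * s)))
     + (\<Sum>n. spec_rem b n s)" for s
  \<comment> \<open>The first summand is \<open>2 * riemann_zeta (2 * s - 1)\<close> for
    \<open>s \<noteq> 1\<close>, because \<open>(2 * s - 1) - 1 = 2 * (s - 1)\<close>; the quotient
    form displays the only possible pole.\<close>
  define F where "F s = \<xi> (2 * s - 1) / (s - 1) + G s" for s
  have op: "open {s. Re s > -1/2}" by (rule open_halfspace_Re_gt)
  have G: "G holomorphic_on {s. Re s > -1/2}"
    unfolding G_def by (intro holomorphic_intros holomorphic_sum_spec_rem) auto
  have "(\<xi> \<circ> (\<lambda>s. 2 * s - 1)) holomorphic_on UNIV"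
    by (rule holomorphic_on_compose_gen[OF _ \<xi>(1)]) (auto intro!: holomorphic_intros)
  hence \<xi>2: "(\<lambda>s. \<xi> (2 * s - 1)) analytic_on UNIV"
    by (simp add: o_def analytic_on_open)
  have Ga: "G analytic_on {s. Re s > -1/2}" using G op by (simp add: analytic_on_open)
  have mero: "F meromorphic_on {s. Re s > -1/2}"
    unfolding F_def
    by (intro meromorphic_intros analytic_on_imp_meromorphic_on Ga analytic_on_subset[OF \<xi>2]) auto
  have ana: "F analytic_on {0}"
    unfolding F_def by (intro analytic_intros analytic_on_subset[OF \<xi>2] analytic_on_subset[OF Ga]) auto
  have Feq: "F s = 2 * riemann_zeta (2 * s - 1) + G s" if "s \<noteq> 1" for s
    using that \<xi>(2)[of "2 * s - 1"] by (simp add: F_def field_simps)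
  have sum: "((\<lambda>n. of_nat (2 * Suc n + b) * of_nat (Suc n * (Suc n + b)) powr (- s)) has_sum F s) UNIV"
    if s: "Re s > 1" for s
  proof -
    have "s \<noteq> 1" using s by auto
    hence "F s = 2 * riemann_zeta (2 * s - 1) - (\<Sum>n<b. of_nat (Suc n) powr (1 - 2 * s))
     + of_nat b * (1 - s) / 2 * (\<Sum>n<b. of_nat (Suc n) powr (- (2 * s)))
     + (\<Sum>n. spec_rem b n s)"
      using Feq[of s] G_def[of s] by simp
    thus ?thesis using spectral_series_has_sum[OF s, of b] by (simp only:)
  qed
  have Z: "(riemann_zeta has_field_derivative deriv riemann_zeta (-1)) (at (-1))"
    using riemann_zeta_properties by (intro holomorphic_derivI[of _ "- {1}"]) auto
  have "((\<lambda>s. 2 * riemann_zeta (2 * s - 1)) has_field_derivative 2 * (deriv riemann_zeta (-1) * 2)) (at 0)"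
  proof -
    have "((\<lambda>s::complex. 2 * s - 1) has_field_derivative 2) (at 0)" by (auto intro!: derivative_eq_intros)
    from DERIV_chain2[OF _ this, of riemann_zeta "deriv riemann_zeta (-1)"] Z show ?thesis
      by (intro DERIV_cmult) simp
  qed
  moreover have "(G has_field_derivative
     (- (\<Sum>n<b. - 2 * Ln (of_nat (Suc n)) * of_nat (Suc n)) + (of_nat b / 2 * (\<Sum>n<b. - 2 * Ln (of_nat (Suc n))) - of_nat b / 2 * of_nat b) + 0)) (at 0)"
    unfolding G_def
  proof (intro DERIV_add DERIV_minus deriv_sum_spec_rem_0)
    have pow: "((\<lambda>s. of_nat (Suc n) powr (c - 2 * s)) has_field_derivative (- 2 * Ln (of_nat (Suc n)) * of_nat (Suc n) powr c)) (at 0)"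
      for n and c :: complex
    proof -
      define N :: complex where "N = of_nat (Suc n)"
      have "N \<noteq> 0" unfolding N_def of_nat_eq_0_iff by simp
      show ?thesis unfolding N_def[symmetric]
        by (rule DERIV_cong[OF DERIV_chain2[where f = "\<lambda>z. N powr z" and g = "\<lambda>s. c - 2 * s", OF has_field_derivative_powr_right[OF \<open>N \<noteq> 0\<close>]]])
          (auto intro!: derivative_eq_intros)
    qed
    show "((\<lambda>s. \<Sum>n<b. of_nat (Suc n) powr (1 - 2 * s)) has_field_derivative (\<Sum>n<b. - 2 * Ln (of_nat (Suc n)) * of_nat (Suc n))) (at 0)"
      by (rule DERIV_sum) (use pow[of _ 1] in \<open>simp del: of_nat_Suc\<close>)
    have "((\<lambda>s. \<Sum>n<b. of_nat (Suc n) powr (- (2 * s))) has_field_derivative (\<Sum>n<b. - 2 * Ln (of_nat (Suc n)))) (at 0)"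
      by (rule DERIV_sum) (use pow[of _ 0] in \<open>simp del: of_nat_Suc\<close>)
    moreover have "((\<lambda>s. of_nat b * (1 - s) / 2) has_field_derivative - (of_nat b / 2)) (at (0::complex))"
      by (auto intro!: derivative_eq_intros)
    ultimately have "((\<lambda>s. of_nat b * (1 - s) / 2 * (\<Sum>n<b. of_nat (Suc n) powr (- (2 * s)))) has_field_derivative
      - (of_nat b / 2) * (\<Sum>n<b. of_nat (Suc n) powr (- (2 * 0))) + (\<Sum>n<b. - 2 * Ln (of_nat (Suc n))) * (of_nat b * (1 - 0) / 2)) (at 0)"
      by (rule DERIV_mult[rotated])
    \<comment> \<open>At \<open>s = 0\<close> each of the \<open>b\<close> powers equals 1, so
      differentiating \<open>1 - s\<close> contributes \<open>- b / 2 * b\<close>, the source of the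
      square in the torsion.\<close>
    moreover have "(\<Sum>n<b. of_nat (Suc n) powr (- (2 * 0))) = (of_nat b :: complex)"
      by (simp del: of_nat_Suc)
    ultimately show "((\<lambda>s. of_nat b * (1 - s) / 2 * (\<Sum>n<b. of_nat (Suc n) powr (- (2 * s)))) has_field_derivative
      (of_nat b / 2 * (\<Sum>n<b. - 2 * Ln (of_nat (Suc n))) - of_nat b / 2 * of_nat b)) (at 0)"
      by (simp only:) (simp add: mult.commute del: of_nat_Suc)
  qed
  ultimately have D': "((\<lambda>s. 2 * riemann_zeta (2 * s - 1) + G s) has_field_derivative
     2 * (deriv riemann_zeta (-1) * 2) + (- (\<Sum>n<b. - 2 * Ln (of_nat (Suc n)) * of_nat (Suc n)) + (of_nat b / 2 * (\<Sum>n<b. - 2 * Ln (of_nat (Suc n))) - of_nat b / 2 * of_nat b) + 0)) (at 0)"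
    by (rule DERIV_add)
  have "eventually (\<lambda>s. F s = 2 * riemann_zeta (2 * s - 1) + G s) (nhds 0)"
    using t1_space_nhds[of "0::complex" 1] by (rule eventually_mono) (use Feq in auto)
  hence "deriv F 0 = deriv (\<lambda>s. 2 * riemann_zeta (2 * s - 1) + G s) 0" by (rule deriv_cong_ev) simp
  hence D: "deriv F 0 = 2 * (deriv riemann_zeta (-1) * 2) + (- (\<Sum>n<b. - 2 * Ln (of_nat (Suc n)) * of_nat (Suc n)) + (of_nat b / 2 * (\<Sum>n<b. - 2 * Ln (of_nat (Suc n))) - of_nat b / 2 * of_nat b) + 0)"
    using DERIV_imp_deriv[OF D'] by (rule trans)
  have Ln: "Ln (of_nat (Suc n)) = of_real (ln (real (Suc n)))" for n
    using Ln_of_real[of "real (Suc n)"] by simp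
  have "(\<Sum>n<b. ln (real (Suc n))) = ln (fact b)"
    by (induction b) (auto simp: ln_mult)
  hence "(\<Sum>n<b. - 2 * Ln (of_nat (Suc n))) = of_real (- 2 * ln (fact b))"
    unfolding Ln sum_distrib_left[symmetric] of_real_sum[symmetric] by simp
  moreover have "(\<Sum>n<b. - 2 * Ln (of_nat (Suc n)) * of_nat (Suc n)) = of_real (- 2 * (\<Sum>n<b. real (Suc n) * ln (real (Suc n))))"
    unfolding Ln by (simp add: sum_distrib_left mult_ac sum_negf del: of_nat_Suc)
  ultimately have "deriv F 0 = 4 * deriv riemann_zeta (- 1) + of_real (2 * (\<Sum>n<b. real (Suc n) * ln (real (Suc n))) - (real b)\<^sup>2 / 2 - real b * ln (fact b))"
    unfolding D by (simp only: of_real_diff of_real_mult of_real_divide of_real_power of_real_of_nat_eq of_real_numeral of_real_minus) (simp add: power2_eq_square algebra_simps del: of_nat_Suc)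
  with mero ana sum show ?thesis by (rule that)
qed

text \<open>For \<open>1 \<le> m \<le> b\<close>, the number \<open>ln m\<close> occurs in
  \<open>ln (fact i)\<close> exactly for \<open>m \<le> i < b\<close>, that is \<open>b - m\<close>
  times.\<close>

lemma sum_ln_fact: "(\<Sum>i<b. ln (fact i :: real)) = real b * ln (fact b) - (\<Sum>n<b. real (Suc n) * ln (real (Suc n)))"
proof (induction b)
  case (Suc b)
  have "ln (fact (Suc b) :: real) = ln (real (Suc b)) + ln (fact b)"
    unfolding fact_Suc by (subst ln_mult) auto
  thus ?case using Suc by (simp add: algebra_simps)
qed simp

text \<open>Recognises the logarithms left by the derivative at 0 as the factorial product of the
  theorem; the reflection of \<open>i\<close> to \<open>b - 1 - i\<close> makes the two factorial
  sums equal.\<close>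

lemma ln_prod_fact:
  "ln (\<Prod>i<b. fact i * fact (b - 1 - i) / fact b :: real) =
     real b * ln (fact b) - 2 * (\<Sum>n<b. real (Suc n) * ln (real (Suc n)))"
proof -
  have "ln (\<Prod>i<b. fact i * fact (b - 1 - i) / fact b :: real) = (\<Sum>i<b. ln (fact i * fact (b - 1 - i) / fact b :: real))"
    by (rule ln_prod) auto
  also have "\<dots> = (\<Sum>i<b. ln (fact i)) + (\<Sum>i<b. ln (fact (b - 1 - i))) - real b * ln (fact b)"
    by (simp add: ln_mult ln_div sum.distrib sum_subtractf)
  also have "(\<Sum>i<b. ln (fact (b - 1 - i) :: real)) = (\<Sum>i<b. ln (fact i))"
    using sum.nat_diff_reindex[of "\<lambda>i. ln (fact i :: real)" b] by simp
  finally show ?thesis unfolding sum_ln_fact by simp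
qed

text \<open>Identity theorem for meromorphic functions. \<open>F\<close> and \<open>G\<close> agree
  far to the right, but their values at singularities are arbitrary, so the difference is first
  normalised by \<open>remove_sings\<close>; analyticity at 0 then brings the conclusion back to
  \<open>F\<close> and \<open>G\<close> near 0.\<close>

lemma spectral_zeta_deriv_unique:
  assumes "is_spectral_zeta m q F" "is_spectral_zeta m q G"
  shows "deriv F 0 = deriv G 0"
proof -
  obtain c where c: "c < 0" "F meromorphic_on {s. Re s > c}" using assms(1) by (auto simp: is_spectral_zeta_def)
  obtain d where d: "d < 0" "G meromorphic_on {s. Re s > d}" using assms(2) by (auto simp: is_spectral_zeta_def)
  obtain b where b: "\<And>s. Re s > b \<Longrightarrow> ((\<lambda>l. of_nat (multiplicity_of m q l) * l powr (- s)) has_sum F s) (eigenvalues m q - {0})"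
    using assms(1) by (auto simp: is_spectral_zeta_def)
  obtain b' where b': "\<And>s. Re s > b' \<Longrightarrow> ((\<lambda>l. of_nat (multiplicity_of m q l) * l powr (- s)) has_sum G s) (eigenvalues m q - {0})"
    using assms(2) by (auto simp: is_spectral_zeta_def)
  have an: "F analytic_on {0}" "G analytic_on {0}" using assms by (auto simp: is_spectral_zeta_def)
  define A where "A = {s. Re s > (max c d)}"
  \<comment> \<open>The maximum with 0 puts the point \<open>B + 1\<close> into \<open>A\<close>,
    since \<open>c\<close> and \<open>d\<close> are negative.\<close>
  define B where "B = max (max b b') 0"
  define D where "D s = F s - G s" for s
  have A: "open A" "connected A"
    unfolding A_def by (rule open_halfspace_Re_gt, rule convex_connected[OF convex_halfspace_Re_gt])
  have "F meromorphic_on A" by (rule meromorphic_on_subset[OF c(2)]) (auto simp: A_def)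
  moreover have "G meromorphic_on A" by (rule meromorphic_on_subset[OF d(2)]) (auto simp: A_def)
  ultimately have D: "D meromorphic_on A" unfolding D_def by (intro meromorphic_intros)
  have D0: "D s = 0" if "Re s > B" for s
    using has_sum_unique[OF b b', of s] that by (simp add: D_def B_def)
  have ev0: "remove_sings D s = 0" if "Re s > B" for s
  proof (rule remove_sings_eqI)
    have "eventually (\<lambda>w. w \<in> {s. Re s > B}) (at s)"
      using that by (intro eventually_at_in_open' open_halfspace_Re_gt) auto
    hence "eventually (\<lambda>w. D w = 0) (at s)" by (rule eventually_mono) (use D0 in auto)
    thus "D \<midarrow>s\<rightarrow> 0" by (rule tendsto_eventually)
  qed
  define z0 :: complex where "z0 = of_real (B + 1)"
  have "eventually (\<lambda>w. w \<in> {s. Re s > B}) (at z0)"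
    by (intro eventually_at_in_open' open_halfspace_Re_gt) (auto simp: z0_def)
  hence "eventually (\<lambda>w. remove_sings D w = 0) (at z0)" by (rule eventually_mono) (use ev0 in auto)
  hence "frequently (\<lambda>w. remove_sings D w = 0) (at z0)" by (intro eventually_frequently) auto
  moreover have "z0 \<in> A" using c d by (auto simp: z0_def A_def B_def)
  moreover have "0 \<in> A" using c d by (auto simp: A_def)
  ultimately have D_eq_0: "remove_sings D w = 0" if "w \<in> A" for w
    using frequently_eq_meromorphic_imp_constant[OF _ remove_sings_nicely_meromorphic[OF D] A] that by blast
  have "D analytic_on {0}" unfolding D_def using an by (intro analytic_intros)
  hence "eventually (\<lambda>w. remove_sings D w = D w) (nhds 0)"
    by (rule eventually_remove_sings_eq_nhds)
  moreover have "eventually (\<lambda>w. w \<in> A) (nhds 0)" using A \<open>0 \<in> A\<close> by (intro eventually_nhds_in_open)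
  ultimately have "eventually (\<lambda>w. F w = G w) (nhds 0)"
    by eventually_elim (use D_eq_0 in \<open>auto simp: D_def\<close>)
  thus ?thesis by (rule deriv_cong_ev) simp
qed

lemma spectral_zeta_deriv_0_eq:
  assumes "is_spectral_zeta m q F"
  shows "spectral_zeta_deriv_0 m q = deriv F 0"
  unfolding spectral_zeta_deriv_0_def
  using assms spectral_zeta_deriv_unique by (intro the_equality) blast+

section \<open>Smooth functions and Wirtinger derivatives\<close>

lemma cont_diff_Suc_imp: "cont_diff (Suc k) f \<Longrightarrow> cont_diff k f"
proof (induction k arbitrary: f)
  case 0
  thus ?case by (auto simp: continuous_on_eq_continuous_at intro: differentiable_imp_continuous_within)
qed simp

lemma cont_diff_const: "cont_diff k (\<lambda>_. c)"
proof (induction k arbitrary: c)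
  case (Suc k)
  have "(\<lambda>z::complex. frechet_derivative (\<lambda>_. c) (at z) v) = (\<lambda>_. 0)" for v by (auto simp: frechet_derivative_const)
  thus ?case using Suc by simp
qed simp

lemma cont_diff_bounded_linear:
  assumes "bounded_linear f"
  shows "cont_diff k f"
proof (cases k)
  case 0
  thus ?thesis using assms by (simp add: linear_continuous_on)
next
  case (Suc n)
  have "(f has_derivative f) (at z)" for z using assms by (rule bounded_linear_imp_has_derivative)
  hence "f differentiable (at z)" "frechet_derivative f (at z) = f" for z
    by (auto simp: differentiable_def frechet_derivative_at[symmetric])
  thus ?thesis unfolding Suc by (simp add: cont_diff_const)
qed

lemma cont_diff_add: "cont_diff k f \<Longrightarrow> cont_diff k g \<Longrightarrow> cont_diff k (\<lambda>z. f z + g z)"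
proof (induction k arbitrary: f g)
  case (Suc k)
  have "frechet_derivative (\<lambda>z. f z + g z) (at z) = (\<lambda>v. frechet_derivative f (at z) v + frechet_derivative g (at z) v)" for z
    using Suc.prems by (intro frechet_derivative_at[symmetric] has_derivative_add) (auto simp: frechet_derivative_works[symmetric])
  thus ?case using Suc by auto
qed (auto intro: continuous_intros)

lemma cont_diff_mult: "cont_diff k f \<Longrightarrow> cont_diff k g \<Longrightarrow> cont_diff k (\<lambda>z. f z * g z)"
proof (induction k arbitrary: f g)
  case (Suc k)
  have *: "cont_diff k f" "cont_diff k g" using Suc.prems cont_diff_Suc_imp by blast+
  have "frechet_derivative (\<lambda>z. f z * g z) (at z) = (\<lambda>v. f z * frechet_derivative g (at z) v + frechet_derivative f (at z) v * g z)" for z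
    using Suc.prems by (intro frechet_derivative_at[symmetric] has_derivative_mult) (auto simp: frechet_derivative_works[symmetric])
  thus ?case using Suc * by (auto intro!: cont_diff_add)
qed (auto intro: continuous_intros)

lemma cont_diff_inverse:
  assumes "cont_diff k f" and nz: "\<And>z. f z \<noteq> 0"
  shows "cont_diff k (\<lambda>z. inverse (f z))"
  using assms(1)
proof (induction k)
  case 0
  thus ?case using nz by (simp add: continuous_on_inverse)
next
  case (Suc k)
  have inv: "cont_diff k (\<lambda>z. inverse (f z))" by (rule Suc.IH[OF cont_diff_Suc_imp[OF Suc.prems]])
  have diff: "f differentiable (at z)" for z using Suc.prems by simp
  have "(\<lambda>z. inverse (f z)) differentiable (at z)" for z
    by (rule differentiable_inverse[OF diff nz])
  moreover have "cont_diff k (\<lambda>z. frechet_derivative (\<lambda>z. inverse (f z)) (at z) v)" for v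
  proof -
    have "frechet_derivative (\<lambda>z. inverse (f z)) (at z) v = - 1 * (inverse (f z) * frechet_derivative f (at z) v * inverse (f z))" for z
    proof -
      have "(f has_derivative frechet_derivative f (at z)) (at z)" using diff by (simp add: frechet_derivative_works)
      from frechet_derivative_at[OF Deriv.has_derivative_inverse[OF nz this], symmetric] show ?thesis by simp
    qed
    moreover have "cont_diff k (\<lambda>z. - 1 * (inverse (f z) * frechet_derivative f (at z) v * inverse (f z)))"
      using Suc.prems by (intro cont_diff_mult cont_diff_const inv) simp
    ultimately show ?thesis by (simp only:)
  qed
  ultimately show ?case by simp
qed

named_theorems smooth_intros

lemma smooth_const [smooth_intros]: "smooth (\<lambda>_. c)"
  by (simp add: smooth_def cont_diff_const)

lemma smooth_id [smooth_intros]: "smooth (\<lambda>z. z)"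
  by (simp add: smooth_def cont_diff_bounded_linear)

lemma smooth_cnj_id [smooth_intros]: "smooth cnj"
  by (simp add: smooth_def cont_diff_bounded_linear bounded_linear_cnj)

lemma smooth_add [smooth_intros]: "smooth f \<Longrightarrow> smooth g \<Longrightarrow> smooth (\<lambda>z. f z + g z)"
  by (simp add: smooth_def cont_diff_add)

lemma smooth_mult [smooth_intros]: "smooth f \<Longrightarrow> smooth g \<Longrightarrow> smooth (\<lambda>z. f z * g z)"
  by (simp add: smooth_def cont_diff_mult)

lemma smooth_inverse: "smooth f \<Longrightarrow> (\<And>z. f z \<noteq> 0) \<Longrightarrow> smooth (\<lambda>z. inverse (f z))"
  by (simp add: smooth_def cont_diff_inverse)

lemma smooth_minus [smooth_intros]: "smooth f \<Longrightarrow> smooth (\<lambda>z. - f z)"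
  using smooth_mult[OF smooth_const[of "-1"], of f] by simp

lemma smooth_diff [smooth_intros]: "smooth f \<Longrightarrow> smooth g \<Longrightarrow> smooth (\<lambda>z. f z - g z)"
  using smooth_add[of f "\<lambda>z. - g z"] smooth_minus[of g] by simp

lemma smooth_power [smooth_intros]: "smooth f \<Longrightarrow> smooth (\<lambda>z. f z ^ n)"
  by (induction n) (auto intro: smooth_intros)

lemma smooth_powi: "smooth f \<Longrightarrow> (\<And>z. f z \<noteq> 0) \<Longrightarrow> smooth (\<lambda>z. f z powi n)"
  by (cases "n \<ge> 0") (auto simp: power_int_def intro!: smooth_intros smooth_inverse)

lemma smooth_imp_differentiable: "smooth f \<Longrightarrow> f differentiable (at z)"
  unfolding smooth_def by (metis cont_diff.simps(2))

lemma smooth_frechet: "smooth f \<Longrightarrow> smooth (\<lambda>z. frechet_derivative f (at z) v)"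
  unfolding smooth_def by (metis cont_diff.simps(2))

lemma smooth_imp_continuous: "smooth f \<Longrightarrow> continuous_on A f"
  unfolding smooth_def by (metis cont_diff.simps(1) continuous_on_subset subset_UNIV)

definition wirtinger :: "(complex \<Rightarrow> complex) \<Rightarrow> complex \<Rightarrow> complex" where
  "wirtinger f z = (frechet_derivative f (at z) 1 - \<i> * frechet_derivative f (at z) \<i>) / 2"

lemma smooth_wirtinger [smooth_intros]: "smooth f \<Longrightarrow> smooth (wirtinger f)"
  unfolding wirtinger_def divide_inverse by (intro smooth_intros smooth_frechet)

lemma smooth_wirtinger_bar [smooth_intros]: "smooth f \<Longrightarrow> smooth (wirtinger_bar f)"
  unfolding wirtinger_bar_def divide_inverse by (intro smooth_intros smooth_frechet)

text \<open>Every real-linear map of the plane is uniquely of the form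
  \<open>a * v + b * cnj v\<close>. Recording both coefficients at once turns the rules for
  \<open>has_derivative\<close> into a calculus for both Wirtinger derivatives.\<close>

definition has_wirtinger :: "(complex \<Rightarrow> complex) \<Rightarrow> complex \<Rightarrow> complex \<Rightarrow> complex \<Rightarrow> bool" where
  "has_wirtinger f a b z \<longleftrightarrow> (f has_derivative (\<lambda>v. a * v + b * cnj v)) (at z)"

lemma has_wirtinger_imp:
  assumes "has_wirtinger f a b z"
  shows "wirtinger f z = a" "wirtinger_bar f z = b" "f differentiable (at z)"
    "frechet_derivative f (at z) v = a * v + b * cnj v"
proof -
  have "frechet_derivative f (at z) = (\<lambda>v. a * v + b * cnj v)"
    using assms unfolding has_wirtinger_def by (rule frechet_derivative_at[symmetric])
  thus "wirtinger f z = a" "wirtinger_bar f z = b" "frechet_derivative f (at z) v = a * v + b * cnj v"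
    by (simp_all add: wirtinger_def wirtinger_bar_def algebra_simps)
  show "f differentiable (at z)" using assms by (auto simp: has_wirtinger_def differentiable_def)
qed

lemma smooth_has_wirtinger:
  assumes "smooth f"
  shows "has_wirtinger f (wirtinger f z) (wirtinger_bar f z) z"
proof -
  let ?f' = "frechet_derivative f (at z)"
  have d: "(f has_derivative ?f') (at z)"
    using smooth_imp_differentiable[OF assms] by (simp add: frechet_derivative_works)
  have "?f' v = wirtinger f z * v + wirtinger_bar f z * cnj v" for v
  proof -
    have lin: "linear ?f'" using d has_derivative_linear by blast
    have "v = Re v *\<^sub>R 1 + Im v *\<^sub>R \<i>" by (simp add: complex_eq_iff)
    hence "?f' v = ?f' (Re v *\<^sub>R 1 + Im v *\<^sub>R \<i>)" by (rule arg_cong)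
    also have "\<dots> = of_real (Re v) * ?f' 1 + of_real (Im v) * ?f' \<i>"
      by (simp only: linear_add[OF lin] linear_scale[OF lin]) (simp add: scaleR_conv_of_real)
    also have "\<dots> = wirtinger f z * (of_real (Re v) + \<i> * of_real (Im v)) + wirtinger_bar f z * (of_real (Re v) - \<i> * of_real (Im v))"
      by (simp add: wirtinger_def wirtinger_bar_def field_simps)
    also have "of_real (Re v) + \<i> * of_real (Im v) = v" by (simp add: complex_eq_iff)
    also have "of_real (Re v) - \<i> * of_real (Im v) = cnj v" by (simp add: complex_eq_iff)
    finally show ?thesis .
  qed
  hence "?f' = (\<lambda>v. wirtinger f z * v + wirtinger_bar f z * cnj v)" by blast
  with d show ?thesis unfolding has_wirtinger_def by simp
qed

lemma has_wirtinger_eq: "has_wirtinger f a b z \<Longrightarrow> a = a' \<Longrightarrow> b = b' \<Longrightarrow> has_wirtinger f a' b' z"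
  by simp

lemma has_wirtinger_const: "has_wirtinger (\<lambda>_. c) 0 0 z"
  by (simp add: has_wirtinger_def)

lemma has_wirtinger_id: "has_wirtinger (\<lambda>z. z) 1 0 z"
  by (simp add: has_wirtinger_def)

lemma has_wirtinger_add: "has_wirtinger f a b z \<Longrightarrow> has_wirtinger g c d z \<Longrightarrow> has_wirtinger (\<lambda>z. f z + g z) (a + c) (b + d) z"
  unfolding has_wirtinger_def by (drule (1) has_derivative_add) (simp add: algebra_simps)

lemma has_wirtinger_mult: "has_wirtinger f a b z \<Longrightarrow> has_wirtinger g c d z \<Longrightarrow>
  has_wirtinger (\<lambda>z. f z * g z) (a * g z + f z * c) (b * g z + f z * d) z"
  unfolding has_wirtinger_def by (drule (1) has_derivative_mult) (simp add: algebra_simps)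

lemma has_wirtinger_cmult: "has_wirtinger g c d z \<Longrightarrow> has_wirtinger (\<lambda>z. k * g z) (k * c) (k * d) z"
  using has_wirtinger_mult[OF has_wirtinger_const[of k], of g c d z] by simp

lemma has_wirtinger_cnj: "has_wirtinger f a b z \<Longrightarrow> has_wirtinger (\<lambda>z. cnj (f z)) (cnj b) (cnj a) z"
  unfolding has_wirtinger_def
  by (drule bounded_linear.has_derivative[OF bounded_linear_cnj]) (simp add: algebra_simps)

lemma has_wirtinger_holomorphic:
  "(f has_field_derivative a) (at z) \<Longrightarrow> has_wirtinger f a 0 z"
  by (simp add: has_wirtinger_def has_field_derivative_def)

lemma has_wirtinger_compose_outer:
  assumes "has_wirtinger f a b z" "(h has_field_derivative c) (at (f z))"
  shows "has_wirtinger (\<lambda>z. h (f z)) (c * a) (c * b) z"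
  using has_derivative_compose[OF assms(1)[unfolded has_wirtinger_def] assms(2)[unfolded has_field_derivative_def]]
  by (simp add: has_wirtinger_def algebra_simps)

lemma has_wirtinger_compose_inner:
  assumes "has_wirtinger g a b (h z)" "(h has_field_derivative c) (at z)"
  shows "has_wirtinger (\<lambda>z. g (h z)) (a * c) (b * cnj c) z"
  using has_derivative_compose[OF assms(2)[unfolded has_field_derivative_def] assms(1)[unfolded has_wirtinger_def]]
  by (simp add: has_wirtinger_def algebra_simps)

lemma has_wirtinger_transform:
  assumes "has_wirtinger f a b z" "open S" "z \<in> S" "\<And>w. w \<in> S \<Longrightarrow> f w = g w"
  shows "has_wirtinger g a b z"
  using has_derivative_transform_within_open[OF assms(1)[unfolded has_wirtinger_def] assms(2,3)] assms(4)
  unfolding has_wirtinger_def by blast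

lemma smooth_cnj [smooth_intros]:
  assumes "smooth f" shows "smooth (\<lambda>z. cnj (f z))"
proof -
  have "cont_diff k f \<Longrightarrow> cont_diff k (\<lambda>z. cnj (f z))" for k and f :: "complex \<Rightarrow> complex"
  proof (induction k arbitrary: f)
    case (Suc k)
    have D: "((\<lambda>z. cnj (f z)) has_derivative (\<lambda>v. cnj (frechet_derivative f (at z) v))) (at z)" for z
      by (rule bounded_linear.has_derivative[OF bounded_linear_cnj])
        (use Suc.prems in \<open>simp add: frechet_derivative_works\<close>)
    have "(\<lambda>z. cnj (f z)) differentiable (at z)" for z using D unfolding differentiable_def by blast
    moreover have "frechet_derivative (\<lambda>z. cnj (f z)) (at z) v = cnj (frechet_derivative f (at z) v)" for z v
      by (simp add: frechet_derivative_at[OF D, symmetric])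
    ultimately show ?case using Suc by simp
  qed (simp add: continuous_on_cnj)
  thus ?thesis using assms by (auto simp: smooth_def)
qed

section \<open>Symmetry of second derivatives\<close>

lemma has_real_derivative_line:
  assumes "smooth f"
  shows "((\<lambda>t. Re (f (p + of_real t * v))) has_real_derivative Re (frechet_derivative f (at (p + of_real t * v)) v)) (at t)"
proof -
  let ?f' = "frechet_derivative f (at (p + of_real t * v))"
  have f': "(f has_derivative ?f') (at (p + of_real t * v))"
    using smooth_imp_differentiable[OF assms] by (simp add: frechet_derivative_works)
  have "((\<lambda>t. p + of_real t * v) has_derivative (\<lambda>h. of_real h * v)) (at t)"
    by (auto intro!: derivative_eq_intros)
  from has_derivative_compose[OF this f']
  have "((\<lambda>t. f (p + of_real t * v)) has_derivative (\<lambda>h. ?f' (of_real h * v))) (at t)" .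
  from bounded_linear.has_derivative[OF bounded_linear_Re this]
  have D: "((\<lambda>t. Re (f (p + of_real t * v))) has_derivative (\<lambda>h. Re (?f' (of_real h * v)))) (at t)" .
  have "?f' (of_real h * v) = of_real h * ?f' v" for h
    using linear_scale[OF has_derivative_linear[OF f'], of h v] by (simp add: scaleR_conv_of_real)
  hence "(\<lambda>h. Re (?f' (of_real h * v))) = (*) (Re (?f' v))" by (simp add: fun_eq_iff mult.commute)
  with D show ?thesis unfolding has_field_derivative_def by (simp only:)
qed

text \<open>Two applications of the mean value theorem: along \<open>v\<close> to a difference in
  direction \<open>w\<close>, then along \<open>w\<close> to the derivative \<open>g\<close>. The
  real part is taken because the theorem fails for complex values.\<close>

lemma second_difference_mvt:
  assumes "smooth f" "h > 0"
  shows "\<exists>s t. 0 < s \<and> s < h \<and> 0 < t \<and> t < h \<and>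
    Re (f (z + of_real h * v + of_real h * w) - f (z + of_real h * v) - f (z + of_real h * w) + f z)
      = h * (h * Re (frechet_derivative (\<lambda>z. frechet_derivative f (at z) v) (at (z + of_real s * v + of_real t * w)) w))"
proof -
  define g where "g = (\<lambda>z. frechet_derivative f (at z) v)"
  have g: "smooth g" unfolding g_def by (rule smooth_frechet[OF assms(1)])
  define \<phi> where "\<phi> t = Re (f ((z + of_real h * w) + of_real t * v)) - Re (f (z + of_real t * v))" for t
  have "\<exists>s. 0 < s \<and> s < h \<and> \<phi> h - \<phi> 0 = (h - 0) * (Re (g ((z + of_real h * w) + of_real s * v)) - Re (g (z + of_real s * v)))"
    using assms(2) unfolding \<phi>_def g_def
    by (intro MVT2 DERIV_diff has_real_derivative_line assms(1))
  then obtain s where s: "0 < s" "s < h" "\<phi> h - \<phi> 0 = h * (Re (g ((z + of_real s * v) + of_real h * w)) - Re (g ((z + of_real s * v) + of_real 0 * w)))"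
    by (auto simp: add_ac)
  have "\<exists>t. 0 < t \<and> t < h \<and> Re (g ((z + of_real s * v) + of_real h * w)) - Re (g ((z + of_real s * v) + of_real 0 * w))
     = (h - 0) * Re (frechet_derivative g (at ((z + of_real s * v) + of_real t * w)) w)"
    using assms(2) by (intro MVT2 has_real_derivative_line g)
  then obtain t where t: "0 < t" "t < h" "Re (g ((z + of_real s * v) + of_real h * w)) - Re (g ((z + of_real s * v) + of_real 0 * w))
     = h * Re (frechet_derivative g (at ((z + of_real s * v) + of_real t * w)) w)" by auto
  have "Re (f (z + of_real h * v + of_real h * w) - f (z + of_real h * v) - f (z + of_real h * w) + f z) = \<phi> h - \<phi> 0"
    by (simp add: \<phi>_def add_ac)
  thus ?thesis using s t unfolding g_def by metis
qed

text \<open>The second difference is symmetric in \<open>v\<close> and \<open>w\<close>, so the two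
  mixed derivatives agree at some intermediate points; these tend to \<open>z\<close> as
  \<open>h\<close> shrinks, and both derivatives are continuous.\<close>

lemma Re_mixed_partials_commute:
  assumes "smooth f"
  shows "Re (frechet_derivative (\<lambda>z. frechet_derivative f (at z) v) (at z) w) =
         Re (frechet_derivative (\<lambda>z. frechet_derivative f (at z) w) (at z) v)"
proof -
  define G where "G v w = (\<lambda>z. Re (frechet_derivative (\<lambda>z. frechet_derivative f (at z) v) (at z) w))" for v w
  define h where "h n = inverse (real (Suc n))" for n
  have h: "h n > 0" for n by (simp add: h_def)
  have h0: "h \<longlonglongrightarrow> 0" unfolding h_def by (rule LIMSEQ_inverse_real_of_nat)
  have cont: "isCont (G v w) z" for v w
  proof -
    have "continuous_on UNIV (G v w)" unfolding G_def
      by (intro continuous_intros smooth_imp_continuous smooth_frechet assms)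
    thus ?thesis by (simp add: continuous_on_eq_continuous_at)
  qed
  have "\<exists>s t s' t'. (0 < s \<and> s < h n \<and> 0 < t \<and> t < h n) \<and> (0 < s' \<and> s' < h n \<and> 0 < t' \<and> t' < h n) \<and>
     G v w (z + of_real s * v + of_real t * w) = G w v (z + of_real s' * w + of_real t' * v)" for n
  proof -
    obtain s t where st: "0 < s" "s < h n" "0 < t" "t < h n" "Re (f (z + of_real (h n) * v + of_real (h n) * w) - f (z + of_real (h n) * v) - f (z + of_real (h n) * w) + f z)
      = h n * (h n * G v w (z + of_real s * v + of_real t * w))"
      using second_difference_mvt[OF assms h, of n z v w] unfolding G_def by blast
    obtain s' t' where st': "0 < s'" "s' < h n" "0 < t'" "t' < h n" "Re (f (z + of_real (h n) * w + of_real (h n) * v) - f (z + of_real (h n) * w) - f (z + of_real (h n) * v) + f z)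
      = h n * (h n * G w v (z + of_real s' * w + of_real t' * v))"
      using second_difference_mvt[OF assms h, of n z w v] unfolding G_def by blast
    have "h n * (h n * G v w (z + of_real s * v + of_real t * w)) = h n * (h n * G w v (z + of_real s' * w + of_real t' * v))"
      unfolding st(5)[symmetric] st'(5)[symmetric] by (simp add: add_ac)
    hence "G v w (z + of_real s * v + of_real t * w) = G w v (z + of_real s' * w + of_real t' * v)"
      using h[of n] by simp
    thus ?thesis using st st' by blast
  qed
  then obtain s t s' t' where *: "\<And>n. 0 < s n \<and> s n < h n \<and> 0 < t n \<and> t n < h n"
      "\<And>n. 0 < s' n \<and> s' n < h n \<and> 0 < t' n \<and> t' n < h n"
      and eq: "\<And>n. G v w (z + of_real (s n) * v + of_real (t n) * w) = G w v (z + of_real (s' n) * w + of_real (t' n) * v)"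
    by metis
  have lim: "x \<longlonglongrightarrow> 0" if "\<And>n. 0 < x n \<and> x n < h n" for x
    by (rule tendsto_sandwich[OF _ _ tendsto_const h0]) (use that in \<open>auto intro!: always_eventually less_imp_le\<close>)
  have lims: "s \<longlonglongrightarrow> 0" "t \<longlonglongrightarrow> 0" "s' \<longlonglongrightarrow> 0" "t' \<longlonglongrightarrow> 0"
    using * by (auto intro!: lim)
  have "(\<lambda>n. z + of_real (s n) * v + of_real (t n) * w) \<longlonglongrightarrow> z + of_real 0 * v + of_real 0 * w"
    by (intro tendsto_intros lims)
  hence "(\<lambda>n. G v w (z + of_real (s n) * v + of_real (t n) * w)) \<longlonglongrightarrow> G v w z"
    using cont by (intro isCont_tendsto_compose[OF cont]) auto
  moreover have "(\<lambda>n. z + of_real (s' n) * w + of_real (t' n) * v) \<longlonglongrightarrow> z + of_real 0 * w + of_real 0 * v"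
    by (intro tendsto_intros lims)
  hence "(\<lambda>n. G w v (z + of_real (s' n) * w + of_real (t' n) * v)) \<longlonglongrightarrow> G w v z"
    using cont by (intro isCont_tendsto_compose[OF cont]) auto
  ultimately have "G v w z = G w v z" unfolding eq by (rule LIMSEQ_unique)
  thus ?thesis by (simp add: G_def)
qed

lemma frechet_derivative_cmult:
  "smooth f \<Longrightarrow> frechet_derivative (\<lambda>z. c * f z) (at z) v = c * frechet_derivative f (at z) v"
  using has_wirtinger_imp(4)[OF has_wirtinger_cmult[OF smooth_has_wirtinger], of f c z v]
    has_wirtinger_imp(4)[OF smooth_has_wirtinger, of f z v] by (simp add: algebra_simps)

lemma mixed_partials_commute:
  assumes "smooth f"
  shows "frechet_derivative (\<lambda>z. frechet_derivative f (at z) v) (at z) w =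
         frechet_derivative (\<lambda>z. frechet_derivative f (at z) w) (at z) v"
proof (rule complex_eqI)
  show "Re (frechet_derivative (\<lambda>z. frechet_derivative f (at z) v) (at z) w) =
         Re (frechet_derivative (\<lambda>z. frechet_derivative f (at z) w) (at z) v)"
    by (rule Re_mixed_partials_commute[OF assms])
  \<comment> \<open>The real part of \<open>- \<i> * f\<close> is the imaginary part of
    \<open>f\<close>.\<close>
  have "smooth (\<lambda>z. - \<i> * f z)" by (intro smooth_intros assms)
  from Re_mixed_partials_commute[OF this, of v z w]
  show "Im (frechet_derivative (\<lambda>z. frechet_derivative f (at z) v) (at z) w) =
         Im (frechet_derivative (\<lambda>z. frechet_derivative f (at z) w) (at z) v)"
    unfolding frechet_derivative_cmult[OF assms] frechet_derivative_cmult[OF smooth_frechet[OF assms]] by simp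
qed

text \<open>Once the mixed partial derivatives agree, both sides are a quarter of the Euclidean
  Laplacian.\<close>

lemma wirtinger_commute:
  assumes "smooth f"
  shows "wirtinger (wirtinger_bar f) z = wirtinger_bar (wirtinger f) z"
proof -
  let ?d = "\<lambda>v z. frechet_derivative f (at z) v"
  have s: "smooth (?d v)" for v by (rule smooth_frechet[OF assms])
  have comb: "frechet_derivative (\<lambda>z. c * ?d 1 z + e * ?d \<i> z) (at z) v
     = c * frechet_derivative (?d 1) (at z) v + e * frechet_derivative (?d \<i>) (at z) v" for c e v
    using has_wirtinger_imp(4)[OF has_wirtinger_add[OF has_wirtinger_cmult[OF smooth_has_wirtinger[OF s[of 1]], of c z]
        has_wirtinger_cmult[OF smooth_has_wirtinger[OF s[of \<i>]], of e z]], of v]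
      has_wirtinger_imp(4)[OF smooth_has_wirtinger[OF s[of 1]], of z v]
      has_wirtinger_imp(4)[OF smooth_has_wirtinger[OF s[of \<i>]], of z v]
    by (simp add: algebra_simps)
  have "wirtinger_bar f = (\<lambda>z. (1/2) * ?d 1 z + (\<i>/2) * ?d \<i> z)" by (simp add: fun_eq_iff wirtinger_bar_def field_simps)
  moreover have "wirtinger f = (\<lambda>z. (1/2) * ?d 1 z + (- \<i>/2) * ?d \<i> z)" by (simp add: fun_eq_iff wirtinger_def field_simps)
  ultimately have fd: "frechet_derivative (wirtinger_bar f) (at z) v = (1/2) * frechet_derivative (?d 1) (at z) v + (\<i>/2) * frechet_derivative (?d \<i>) (at z) v"
    "frechet_derivative (wirtinger f) (at z) v = (1/2) * frechet_derivative (?d 1) (at z) v + (- \<i>/2) * frechet_derivative (?d \<i>) (at z) v" for v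
    by (simp_all only: comb)
  have "frechet_derivative (?d 1) (at z) \<i> = frechet_derivative (?d \<i>) (at z) 1"
    by (rule mixed_partials_commute[OF assms])
  thus ?thesis
    unfolding wirtinger_def[of "wirtinger_bar f"] wirtinger_bar_def[of "wirtinger f"] fd by (simp add: algebra_simps)
qed

section \<open>Integration over the complex plane\<close>

lemma measurable_Complex [measurable]: "(\<lambda>p. Complex (fst p) (snd p)) \<in> borel_measurable (lborel \<Otimes>\<^sub>M lborel)"
  unfolding lborel_prod by (simp add: borel_measurable_continuous_onI continuous_on_Complex continuous_intros)

lemma lborel_complex: "(lborel :: complex measure) = distr (lborel \<Otimes>\<^sub>M lborel) borel (\<lambda>p. Complex (fst p) (snd p))"
proof (rule lborel_eqI)
  fix l u :: complex assume lu: "\<And>b. b \<in> Basis \<Longrightarrow> l \<bullet> b \<le> u \<bullet> b"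
  have lu': "Re l \<le> Re u" "Im l \<le> Im u"
    using lu[of 1] lu[of \<i>] by (auto simp: Basis_complex_def)
  have "(\<lambda>p. Complex (fst p) (snd p)) -` box l u \<inter> space (lborel \<Otimes>\<^sub>M lborel) = {Re l<..<Re u} \<times> {Im l<..<Im u}"
    by (auto simp: space_pair_measure in_box_complex_iff)
  hence "emeasure (distr (lborel \<Otimes>\<^sub>M lborel) borel (\<lambda>p. Complex (fst p) (snd p))) (box l u)
     = emeasure (lborel \<Otimes>\<^sub>M lborel) ({Re l<..<Re u} \<times> {Im l<..<Im u})"
    using measurable_Complex by (subst emeasure_distr) auto
  also have "\<dots> = ennreal (Re u - Re l) * ennreal (Im u - Im l)"
    using lu' by (subst lborel.emeasure_pair_measure_Times) auto
  also have "\<dots> = (\<Prod>b\<in>Basis. (u - l) \<bullet> b)"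
    using lu' by (simp add: Basis_complex_def ennreal_mult)
  finally show "emeasure (distr (lborel \<Otimes>\<^sub>M lborel) borel (\<lambda>p. Complex (fst p) (snd p))) (box l u) = (\<Prod>b\<in>Basis. (u - l) \<bullet> b)" .
qed simp

text \<open>Squares rather than discs: the fundamental theorem of calculus can be used along each
  coordinate line, and the boundary terms live on axis-parallel sides.\<close>

definition csq :: "real \<Rightarrow> complex set" where
  "csq R = {z. \<bar>Re z\<bar> \<le> R \<and> \<bar>Im z\<bar> \<le> R}"

lemma csq_cbox: "csq R = cbox (Complex (-R) (-R)) (Complex R R)"
  by (auto simp: csq_def in_cbox_complex_iff abs_le_iff)

text \<open>Both orders of integration are needed: a derivative in direction 1 is integrated over
  \<open>x\<close> first, one in direction \<open>\<i>\<close> over \<open>y\<close> first.\<close>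

lemma integral_csq:
  fixes H :: "complex \<Rightarrow> complex"
  assumes H: "continuous_on UNIV H"
  shows "(LINT z|lborel. indicator (csq R) z *\<^sub>R H z) =
      (LINT x|lborel. indicator {-R..R} x *\<^sub>R (LINT y|lborel. indicator {-R..R} y *\<^sub>R H (Complex x y)))" (is "?L = ?A")
    and "(LINT z|lborel. indicator (csq R) z *\<^sub>R H z) =
      (LINT y|lborel. indicator {-R..R} y *\<^sub>R (LINT x|lborel. indicator {-R..R} x *\<^sub>R H (Complex x y)))" (is "_ = ?B")
proof -
  have csq [measurable]: "csq R \<in> sets borel" by (simp add: csq_cbox)
  have Hm [measurable]: "H \<in> borel_measurable borel" using H by (rule borel_measurable_continuous_onI)
  define f where "f = (\<lambda>x y. indicator (csq R) (Complex x y) *\<^sub>R H (Complex x y))"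
  have f: "f x y = indicator {-R..R} x *\<^sub>R (indicator {-R..R} y *\<^sub>R H (Complex x y))" for x y
    by (auto simp: f_def csq_def indicator_def abs_le_iff)
  have f': "f x y = indicator {-R..R} y *\<^sub>R (indicator {-R..R} x *\<^sub>R H (Complex x y))" for x y
    by (auto simp: f_def csq_def indicator_def abs_le_iff)
  have "?L = (LINT p|(lborel \<Otimes>\<^sub>M lborel). indicator (csq R) (Complex (fst p) (snd p)) *\<^sub>R H (Complex (fst p) (snd p)))"
    by (subst lborel_complex, rule integral_distr) measurable
  hence L: "?L = (LINT p|(lborel \<Otimes>\<^sub>M lborel). case_prod f p)" by (simp add: f_def case_prod_unfold)
  have "integrable lborel (\<lambda>p. indicator (cbox (-R, -R) (R, R)) p *\<^sub>R H (Complex (fst p) (snd p)))"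
    by (rule borel_integrable_compact)
       (auto intro!: continuous_on_compose2[OF H] continuous_intros continuous_on_Complex)
  also have "(\<lambda>p. indicator (cbox (-R, -R) (R, R)) p *\<^sub>R H (Complex (fst p) (snd p))) = case_prod f"
    by (auto simp: fun_eq_iff f indicator_def cbox_Pair_eq)
  finally have int: "integrable (lborel \<Otimes>\<^sub>M lborel) (case_prod f)" by (simp add: lborel_prod)
  show "?L = ?A"
    unfolding L lborel_pair.integral_fst[OF int, symmetric]
  proof (rule Bochner_Integration.integral_cong[OF refl])
    fix x
    show "(LINT y|lborel. f x y) = indicator {-R..R} x *\<^sub>R (LINT y|lborel. indicator {-R..R} y *\<^sub>R H (Complex x y))"
      by (cases "x \<in> {-R..R}") (simp_all add: f)
  qed
  show "?L = ?B"
    unfolding L lborel_pair.integral_snd[OF int, symmetric]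
  proof (rule Bochner_Integration.integral_cong[OF refl])
    fix y
    show "(LINT x|lborel. f x y) = indicator {-R..R} y *\<^sub>R (LINT x|lborel. indicator {-R..R} x *\<^sub>R H (Complex x y))"
      by (cases "y \<in> {-R..R}") (simp_all add: f')
  qed
qed

section \<open>Stokes' theorem for decaying functions on the plane\<close>

lemma norm_integral_interval_le:
  fixes h :: "real \<Rightarrow> complex"
  assumes "R \<ge> 0" "\<And>x. \<bar>x\<bar> \<le> R \<Longrightarrow> norm (h x) \<le> M" "M \<ge> 0"
  shows "norm (LINT x|lborel. indicator {-R..R} x *\<^sub>R h x) \<le> 2 * R * M"
proof -
  have "norm (LINT x|lborel. indicator {-R..R} x *\<^sub>R h x) \<le> (LINT x|lborel. norm (indicator {-R..R} x *\<^sub>R h x))"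
    by (rule integral_norm_bound)
  also have "\<dots> \<le> (LINT x|lborel. indicator {-R..R} x * M)"
  proof (rule integral_mono')
    have "integrable lborel (\<lambda>x. indicator {-R..R} x *\<^sub>R M)"
      by (rule borel_integrable_compact) auto
    thus "integrable lborel (\<lambda>x. indicator {-R..R} x * M)" by simp
  qed (use assms in \<open>auto simp: indicator_def\<close>)
  also have "\<dots> = 2 * R * M" using assms(1) by simp
  finally show ?thesis .
qed

lemma has_vector_derivative_line:
  assumes "smooth f"
  shows "((\<lambda>t. f (p + of_real t * v)) has_vector_derivative frechet_derivative f (at (p + of_real t * v)) v) (at t within S)"
proof -
  let ?f' = "frechet_derivative f (at (p + of_real t * v))"
  have f': "(f has_derivative ?f') (at (p + of_real t * v))"
    using smooth_imp_differentiable[OF assms] by (simp add: frechet_derivative_works)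
  have "((\<lambda>t. p + of_real t * v) has_derivative (\<lambda>h. of_real h * v)) (at t within S)"
    by (auto intro!: derivative_eq_intros)
  from has_derivative_compose[OF this f']
  have D: "((\<lambda>t. f (p + of_real t * v)) has_derivative (\<lambda>h. ?f' (of_real h * v))) (at t within S)" .
  have "?f' (of_real h * v) = h *\<^sub>R ?f' v" for h
    using linear_scale[OF has_derivative_linear[OF f'], of h v] by (simp add: scaleR_conv_of_real)
  with D show ?thesis by (simp add: has_vector_derivative_def)
qed

lemma integral_line_derivative:
  assumes "smooth f" "R \<ge> 0"
  shows "(LINT t|lborel. indicator {-R..R} t *\<^sub>R frechet_derivative f (at (p + of_real t * v)) v) = f (p + of_real R * v) - f (p + of_real (- R) * v)"
proof (rule integral_FTC_Icc)
  show "continuous_on {- R..R} (\<lambda>t. frechet_derivative f (at (p + of_real t * v)) v)"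
    by (intro continuous_on_compose2[OF smooth_imp_continuous[OF smooth_frechet[OF assms(1)], of UNIV]] continuous_intros) auto
qed (use assms in \<open>auto intro: has_vector_derivative_line\<close>)

text \<open>Integrating the derivative leaves two opposite sides of length \<open>2 * R\<close>, on
  which \<open>norm (F z)\<close> is at most \<open>C / R\<^sup>2\<close>.\<close>

lemma norm_integral_csq_derivative_le:
  assumes F: "smooth F" and bound: "\<And>z. norm (F z) * (1 + (cmod z)\<^sup>2) \<le> C" and C: "C \<ge> 0" and R: "R > 0"
    and v: "v = 1 \<or> v = \<i>"
  shows "norm (LINT z|lborel. indicator (csq R) z *\<^sub>R frechet_derivative F (at z) v) \<le> 4 * C / R"
proof -
  have b: "norm (F z) \<le> C / R\<^sup>2" if "R \<le> cmod z" for z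
  proof -
    have "norm (F z) * R\<^sup>2 \<le> norm (F z) * (1 + (cmod z)\<^sup>2)"
      using that R by (intro mult_left_mono) (auto intro: add_increasing power_mono)
    also have "\<dots> \<le> C" by (rule bound)
    finally show ?thesis using R by (simp add: field_simps)
  qed
  have cont: "continuous_on UNIV (\<lambda>z. frechet_derivative F (at z) v)"
    by (rule smooth_imp_continuous[OF smooth_frechet[OF F]])
  have le: "norm (a - b) \<le> 2 * (C / R\<^sup>2)" if "norm a \<le> C / R\<^sup>2" "norm b \<le> C / R\<^sup>2" for a b :: complex
    using norm_triangle_ineq4[of a b] that by simp
  have "norm (LINT z|lborel. indicator (csq R) z *\<^sub>R frechet_derivative F (at z) v) \<le> 2 * R * (2 * (C / R\<^sup>2))"
    using v
  proof
    assume v: "v = 1"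
    have "(LINT z|lborel. indicator (csq R) z *\<^sub>R frechet_derivative F (at z) v) =
      (LINT y|lborel. indicator {-R..R} y *\<^sub>R (F (Complex 0 y + of_real R * 1) - F (Complex 0 y + of_real (- R) * 1)))"
      unfolding v integral_csq(2)[OF cont[unfolded v]]
    proof (rule Bochner_Integration.integral_cong[OF refl])
      fix y
      define c where "c = Complex 0 y"
      have "Complex x y = c + of_real x * 1" for x by (simp add: complex_eq_iff c_def)
      thus "indicator {-R..R} y *\<^sub>R (LINT x|lborel. indicator {-R..R} x *\<^sub>R frechet_derivative F (at (Complex x y)) 1) =
         indicator {-R..R} y *\<^sub>R (F (Complex 0 y + of_real R * 1) - F (Complex 0 y + of_real (- R) * 1))"
        using integral_line_derivative[OF F, of R c 1] R unfolding c_def[symmetric] by (simp only: less_imp_le)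
    qed
    also have "norm \<dots> \<le> 2 * R * (2 * (C / R\<^sup>2))"
    proof (rule norm_integral_interval_le)
      fix y assume "\<bar>y\<bar> \<le> R"
      have "R \<le> cmod (Complex 0 y + of_real R * 1)" "R \<le> cmod (Complex 0 y + of_real (- R) * 1)"
        using R abs_Re_le_cmod[of "Complex 0 y + of_real R * 1"] abs_Re_le_cmod[of "Complex 0 y + of_real (- R) * 1"] by auto
      thus "norm (F (Complex 0 y + of_real R * 1) - F (Complex 0 y + of_real (- R) * 1)) \<le> 2 * (C / R\<^sup>2)"
        by (intro le b)
    qed (use R C in auto)
    finally show ?thesis .
  next
    assume v: "v = \<i>"
    have "(LINT z|lborel. indicator (csq R) z *\<^sub>R frechet_derivative F (at z) v) =
      (LINT x|lborel. indicator {-R..R} x *\<^sub>R (F (Complex x 0 + of_real R * \<i>) - F (Complex x 0 + of_real (- R) * \<i>)))"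
      unfolding v integral_csq(1)[OF cont[unfolded v]]
    proof (rule Bochner_Integration.integral_cong[OF refl])
      fix x
      define c where "c = Complex x 0"
      have "Complex x y = c + of_real y * \<i>" for y by (simp add: complex_eq_iff c_def)
      thus "indicator {-R..R} x *\<^sub>R (LINT y|lborel. indicator {-R..R} y *\<^sub>R frechet_derivative F (at (Complex x y)) \<i>) =
         indicator {-R..R} x *\<^sub>R (F (Complex x 0 + of_real R * \<i>) - F (Complex x 0 + of_real (- R) * \<i>))"
        using integral_line_derivative[OF F, of R c \<i>] R unfolding c_def[symmetric] by (simp only: less_imp_le)
    qed
    also have "norm \<dots> \<le> 2 * R * (2 * (C / R\<^sup>2))"
    proof (rule norm_integral_interval_le)
      fix x assume "\<bar>x\<bar> \<le> R"
      have "R \<le> cmod (Complex x 0 + of_real R * \<i>)" "R \<le> cmod (Complex x 0 + of_real (- R) * \<i>)"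
        using R abs_Im_le_cmod[of "Complex x 0 + of_real R * \<i>"] abs_Im_le_cmod[of "Complex x 0 + of_real (- R) * \<i>"] by auto
      thus "norm (F (Complex x 0 + of_real R * \<i>) - F (Complex x 0 + of_real (- R) * \<i>)) \<le> 2 * (C / R\<^sup>2)"
        by (intro le b)
    qed (use R C in auto)
    finally show ?thesis .
  qed
  thus ?thesis using R by (simp add: power2_eq_square field_simps)
qed

text \<open>The integrals over growing squares converge to the full integral by dominated
  convergence, and to 0 because their boundary terms are of order \<open>1 / R\<close>.\<close>

lemma integral_wirtinger_bar_eq_0:
  assumes F: "smooth F" and bound: "\<And>z. norm (F z) * (1 + (cmod z)\<^sup>2) \<le> C"
    and int: "integrable lborel (wirtinger_bar F)"
  shows "(LINT z|lborel. wirtinger_bar F z) = 0"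
proof -
  have C: "C \<ge> 0" using bound[of 0] norm_ge_zero[of "F 0"] by (metis add.right_neutral mult.right_neutral norm_zero order_trans power_zero_numeral)
  have csq [measurable]: "csq R \<in> sets borel" for R by (simp add: csq_cbox)
  have lim: "(\<lambda>n. LINT z|lborel. indicator (csq (real n)) z *\<^sub>R wirtinger_bar F z) \<longlonglongrightarrow> (LINT z|lborel. wirtinger_bar F z)"
  proof (rule integral_dominated_convergence[where w = "\<lambda>z. norm (wirtinger_bar F z)"])
    show "AE z in lborel. (\<lambda>n. indicator (csq (real n)) z *\<^sub>R wirtinger_bar F z) \<longlonglongrightarrow> wirtinger_bar F z"
    proof (rule AE_I2)
      fix z
      obtain N where N: "cmod z \<le> real N" using real_arch_simple by blast
      have "z \<in> csq (real n)" if "n \<ge> N" for n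
        using N that abs_Re_le_cmod[of z] abs_Im_le_cmod[of z] by (auto simp: csq_def)
      hence "eventually (\<lambda>n. indicator (csq (real n)) z *\<^sub>R wirtinger_bar F z = wirtinger_bar F z) sequentially"
        by (intro eventually_sequentiallyI[of N]) auto
      thus "(\<lambda>n. indicator (csq (real n)) z *\<^sub>R wirtinger_bar F z) \<longlonglongrightarrow> wirtinger_bar F z"
        by (rule tendsto_eventually)
    qed
  qed (use int in \<open>auto simp: indicator_def\<close>)
  have le: "norm (LINT z|lborel. indicator (csq (real (Suc n))) z *\<^sub>R wirtinger_bar F z) \<le> 4 * C / real (Suc n)" for n
  proof -
    let ?I = "\<lambda>v. LINT z|lborel. indicator (csq (real (Suc n))) z *\<^sub>R frechet_derivative F (at z) v"
    have i: "integrable lborel (\<lambda>z. indicator (csq (real (Suc n))) z *\<^sub>R frechet_derivative F (at z) v)" for v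
      by (rule borel_integrable_compact) (auto simp: csq_cbox intro!: smooth_imp_continuous smooth_frechet F)
    have "(LINT z|lborel. indicator (csq (real (Suc n))) z *\<^sub>R wirtinger_bar F z) =
       (LINT z|lborel. (indicator (csq (real (Suc n))) z *\<^sub>R frechet_derivative F (at z) 1 + \<i> * (indicator (csq (real (Suc n))) z *\<^sub>R frechet_derivative F (at z) \<i>)) / 2)"
      by (rule Bochner_Integration.integral_cong) (auto simp: wirtinger_bar_def indicator_def)
    also have "\<dots> = (?I 1 + \<i> * ?I \<i>) / 2"
      by (simp only: integral_divide_zero Bochner_Integration.integral_add[OF i Bochner_Integration.integrable_mult_right[OF i]] integral_mult_right_zero)
    also have "norm \<dots> \<le> (norm (?I 1) + norm (?I \<i>)) / 2"
      using norm_triangle_ineq[of "?I 1" "\<i> * ?I \<i>"] by (simp add: norm_divide norm_mult)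
    also have "\<dots> \<le> 4 * C / real (Suc n)"
      using norm_integral_csq_derivative_le[OF F bound C, of "real (Suc n)" 1]
        norm_integral_csq_derivative_le[OF F bound C, of "real (Suc n)" \<i>] by simp
    finally show ?thesis .
  qed
  have "(\<lambda>n. LINT z|lborel. indicator (csq (real (Suc n))) z *\<^sub>R wirtinger_bar F z) \<longlonglongrightarrow> 0"
  proof (rule Lim_null_comparison)
    show "eventually (\<lambda>n. norm (LINT z|lborel. indicator (csq (real (Suc n))) z *\<^sub>R wirtinger_bar F z) \<le> 4 * C * inverse (real (Suc n))) sequentially"
      using le by (simp add: divide_inverse)
    show "(\<lambda>n. 4 * C * inverse (real (Suc n))) \<longlonglongrightarrow> 0"
      using tendsto_mult_right_zero[OF LIMSEQ_inverse_real_of_nat] .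
  qed
  with LIMSEQ_Suc[OF lim] show ?thesis by (rule LIMSEQ_unique)
qed

text \<open>Comparison with a product of two Cauchy densities, by
  \<open>(1 + x^2) * (1 + y^2) \<le> (1 + x^2 + y^2)^2\<close>.\<close>

lemma finite_measure_fubini_study: "finite_measure fubini_study"
proof
  have 1: "integrable lborel (\<lambda>x::real. inverse (1 + x\<^sup>2))"
    using integrable_inverse_1_plus_square by (simp add: set_integrable_def einterval_def)
  have "emeasure fubini_study (space fubini_study) = (\<integral>\<^sup>+z. ennreal (1 / (pi * (1 + (cmod z)\<^sup>2)\<^sup>2)) \<partial>lborel)"
    by (simp add: fubini_study_def emeasure_density)
  also have "\<dots> = (\<integral>\<^sup>+p. ennreal (1 / (pi * (1 + (cmod (Complex (fst p) (snd p)))\<^sup>2)\<^sup>2)) \<partial>(lborel \<Otimes>\<^sub>M lborel))"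
    by (subst lborel_complex, rule nn_integral_distr) measurable
  also have "\<dots> \<le> (\<integral>\<^sup>+p. ennreal (inverse (1 + (fst p)\<^sup>2)) * ennreal (inverse (1 + (snd p)\<^sup>2)) \<partial>(lborel \<Otimes>\<^sub>M lborel))"
  proof (rule nn_integral_mono)
    fix p :: "real \<times> real"
    define x y where "x = (fst p)\<^sup>2" and "y = (snd p)\<^sup>2"
    have xy: "x \<ge> 0" "y \<ge> 0" by (auto simp: x_def y_def)
    have "(1 + x) * (1 + y) \<le> (1 + (x + y)) * (1 + (x + y))"
      using xy by (intro mult_mono) auto
    also have "\<dots> \<le> pi * (1 + (x + y))\<^sup>2"
      using pi_gt3 mult_right_mono[of 1 pi "(1 + (x + y))\<^sup>2"] by (simp add: power2_eq_square)
    finally have "1 / (pi * (1 + (x + y))\<^sup>2) \<le> inverse (1 + x) * inverse (1 + y)"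
      using xy unfolding inverse_eq_divide times_divide_times_eq mult_1_left
      by (intro divide_left_mono mult_pos_pos) auto
    thus "ennreal (1 / (pi * (1 + (cmod (Complex (fst p) (snd p)))\<^sup>2)\<^sup>2)) \<le> ennreal (inverse (1 + (fst p)\<^sup>2)) * ennreal (inverse (1 + (snd p)\<^sup>2))"
      by (simp add: cmod_power2 x_def y_def ennreal_mult[symmetric])
  qed
  also have "\<dots> = (\<integral>\<^sup>+x. ennreal (inverse (1 + x\<^sup>2)) \<partial>lborel) * (\<integral>\<^sup>+x. ennreal (inverse (1 + x\<^sup>2)) \<partial>lborel)"
    by (subst lborel.nn_integral_fst[symmetric]) (auto simp: nn_integral_cmult nn_integral_multc)
  also have "\<dots> < \<infinity>"
    using 1 by (simp add: integrable_iff_bounded ennreal_mult_less_top)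
  finally show "emeasure fubini_study (space fubini_study) \<noteq> \<infinity>" by simp
qed

section \<open>Sections and ladder operators\<close>

text \<open>The weight \<open>1 + |z|^2\<close> as a complex-valued function, so that it can be
  differentiated by the Wirtinger calculus.\<close>

definition fs_weight :: "complex \<Rightarrow> complex" where
  "fs_weight z = 1 + z * cnj z"

lemma fs_weight_of_real: "fs_weight z = of_real (1 + (cmod z)\<^sup>2)"
  using complex_norm_square[of z] by (simp add: fs_weight_def)

lemma one_plus_norm_pos: "1 + (cmod z)\<^sup>2 > 0"
  by (simp add: add_pos_nonneg)

lemma fs_weight_nz [simp]: "fs_weight z \<noteq> 0"
  unfolding fs_weight_of_real of_real_eq_0_iff using one_plus_norm_pos[of z] by linarith

lemma fs_weight_powi: "fs_weight z powi n = of_real ((1 + (cmod z)\<^sup>2) powi n)"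
  by (simp add: fs_weight_of_real)

lemma cnj_fs_weight [simp]: "cnj (fs_weight z) = fs_weight z"
  by (simp add: fs_weight_def mult.commute)

lemma fs_weight_inverse: "z \<noteq> 0 \<Longrightarrow> fs_weight (1 / z) = fs_weight z / (z * cnj z)"
  by (simp add: fs_weight_def field_simps)

lemma has_wirtinger_fs_weight: "has_wirtinger fs_weight (cnj z) z z"
  unfolding fs_weight_def[abs_def]
  by (rule has_wirtinger_eq[OF has_wirtinger_add[OF has_wirtinger_const has_wirtinger_mult[OF has_wirtinger_id has_wirtinger_cnj[OF has_wirtinger_id]]]]) auto

lemma smooth_fs_weight [smooth_intros]: "smooth fs_weight"
  unfolding fs_weight_def[abs_def] by (intro smooth_intros)

lemma smooth_fs_weight_powi [smooth_intros]: "smooth (\<lambda>z. fs_weight z powi n)"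
  by (intro smooth_powi smooth_intros) simp

lemma smooth_divide_fs_weight [smooth_intros]: "smooth f \<Longrightarrow> smooth (\<lambda>z. f z / fs_weight z)"
  unfolding divide_inverse by (intro smooth_intros smooth_inverse) simp_all

lemma has_wirtinger_fs_weight_powi:
  "has_wirtinger (\<lambda>z. fs_weight z powi n) (of_int n * fs_weight z powi (n - 1) * cnj z) (of_int n * fs_weight z powi (n - 1) * z) z"
proof -
  have "((\<lambda>w. w powi n) has_field_derivative (of_int n * fs_weight z powi (n - 1))) (at (fs_weight z))"
    by (auto intro!: derivative_eq_intros)
  from has_wirtinger_compose_outer[OF has_wirtinger_fs_weight this] show ?thesis .
qed

lemma forms_0_iff: "(f, g) \<in> forms k 0 \<longleftrightarrow> smooth f \<and> smooth g \<and> (\<forall>z. z \<noteq> 0 \<longrightarrow> f z = z powi k * g (1 / z))"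
  by (simp add: forms_def)

lemma forms_1_iff: "(f, g) \<in> forms k (Suc 0) \<longleftrightarrow> smooth f \<and> smooth g \<and> (\<forall>z. z \<noteq> 0 \<longrightarrow> f z = - (z powi k) / (cnj z)\<^sup>2 * g (1 / z))"
  by (simp add: forms_def)

text \<open>Chain rule through the inversion, whose derivative is \<open>- 1 / z\<^sup>2\<close>.
  The transition factor is holomorphic, so it leaves a term of order zero only in
  \<open>wirtinger\<close>.\<close>

lemma wirtinger_glued:
  assumes f: "smooth f" and g: "smooth g" and fg: "\<And>z. z \<noteq> 0 \<Longrightarrow> f z = z powi k * g (1 / z)" and z: "z \<noteq> 0"
  shows "wirtinger f z = of_int k * z powi (k - 1) * g (1 / z) - z powi k * wirtinger g (1 / z) / z\<^sup>2"
    and "wirtinger_bar f z = - (z powi k) / (cnj z)\<^sup>2 * wirtinger_bar g (1 / z)"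
proof -
  have 1: "((\<lambda>z. 1 / z) has_field_derivative (- 1 / z\<^sup>2)) (at z)"
    using z by (auto intro!: derivative_eq_intros simp: power2_eq_square)
  have 2: "((\<lambda>w. w powi k) has_field_derivative (of_int k * z powi (k - 1))) (at z)"
    using z by (auto intro!: derivative_eq_intros)
  have 3: "has_wirtinger (\<lambda>z. z powi k * g (1 / z))
     (of_int k * z powi (k - 1) * g (1 / z) + z powi k * (wirtinger g (1 / z) * (- 1 / z\<^sup>2)))
     (0 * g (1 / z) + z powi k * (wirtinger_bar g (1 / z) * cnj (- 1 / z\<^sup>2))) z"
    by (rule has_wirtinger_mult[OF has_wirtinger_holomorphic[OF 2] has_wirtinger_compose_inner[OF smooth_has_wirtinger[OF g] 1]])
  have 4: "has_wirtinger f
     (of_int k * z powi (k - 1) * g (1 / z) + z powi k * (wirtinger g (1 / z) * (- 1 / z\<^sup>2)))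
     (0 * g (1 / z) + z powi k * (wirtinger_bar g (1 / z) * cnj (- 1 / z\<^sup>2))) z"
    by (rule has_wirtinger_transform[OF 3, of "- {0}"]) (use z fg in auto)
  show "wirtinger f z = of_int k * z powi (k - 1) * g (1 / z) - z powi k * wirtinger g (1 / z) / z\<^sup>2"
    using has_wirtinger_imp(1)[OF 4] by (simp add: field_simps)
  show "wirtinger_bar f z = - (z powi k) / (cnj z)\<^sup>2 * wirtinger_bar g (1 / z)"
    using has_wirtinger_imp(2)[OF 4] by (simp add: field_simps)
qed

lemma dbar_in_forms:
  assumes "\<alpha> \<in> forms k 0"
  shows "dbar 0 \<alpha> \<in> forms k (Suc 0)"
proof -
  obtain f g where \<alpha>: "\<alpha> = (f, g)" by (cases \<alpha>)
  have "smooth f" "smooth g" "\<And>z. z \<noteq> 0 \<Longrightarrow> f z = z powi k * g (1 / z)"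
    using assms unfolding \<alpha> forms_0_iff by blast+
  thus ?thesis unfolding \<alpha> dbar_def using wirtinger_glued(2)[of f g k]
    by (simp add: forms_1_iff smooth_wirtinger_bar)
qed

text \<open>A section is represented by its coefficient in the chart \<open>z\<close> alone; the
  other coefficient is determined by it, see \<open>form_eqI\<close>.\<close>

definition is_section :: "int \<Rightarrow> (complex \<Rightarrow> complex) \<Rightarrow> bool" where
  "is_section k f \<longleftrightarrow> (\<exists>g. (f, g) \<in> forms k 0)"

text \<open>\<open>dbar\<close> followed by the isometry from \<open>O(k)\<close>-valued
  \<open>(0,1)\<close>-forms to sections of \<open>O(k + 2)\<close>, which multiplies coefficients
  by the squared weight.\<close>

definition raise_op :: "(complex \<Rightarrow> complex) \<Rightarrow> complex \<Rightarrow> complex" where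
  "raise_op f = (\<lambda>z. (fs_weight z)\<^sup>2 * wirtinger_bar f z)"

text \<open>Minus the \<open>(1,0)\<close> part of the Chern connection of \<open>O(k)\<close>: the
  metric has weight \<open>fs_weight z powi (- k)\<close>, whose logarithmic derivative is
  \<open>- k * cnj z / fs_weight z\<close>. The index is the degree of the source; the image has
  degree \<open>k - 2\<close>.\<close>

definition lower_op :: "int \<Rightarrow> (complex \<Rightarrow> complex) \<Rightarrow> complex \<Rightarrow> complex" where
  "lower_op k f = (\<lambda>z. of_int k * (cnj z * f z) / fs_weight z - wirtinger f z)"

lemma smooth_raise_op [smooth_intros]: "smooth f \<Longrightarrow> smooth (raise_op f)"
  unfolding raise_op_def by (intro smooth_intros)

lemma smooth_lower_op [smooth_intros]: "smooth f \<Longrightarrow> smooth (lower_op k f)"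
  unfolding lower_op_def by (intro smooth_intros)

lemma is_section_smooth: "is_section k f \<Longrightarrow> smooth f"
  by (auto simp: is_section_def forms_0_iff)

text \<open>By \<open>fs_weight_inverse\<close>, the squared weight changes between the charts by
  \<open>(z * cnj z)^2\<close>. Its antiholomorphic part cancels the transition factor of
  \<open>d(cnj z)\<close>, its holomorphic part raises the degree by 2; the sign is absorbed in the
  second chart.\<close>

lemma is_section_iff_forms_1:
  "is_section (k + 2) (\<lambda>z. (fs_weight z)\<^sup>2 * f z) \<longleftrightarrow> (\<exists>g. (f, g) \<in> forms k (Suc 0))"
proof
  assume "is_section (k + 2) (\<lambda>z. (fs_weight z)\<^sup>2 * f z)"
  then obtain g where g: "smooth (\<lambda>z. (fs_weight z)\<^sup>2 * f z)" "smooth g"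
    "\<And>z. z \<noteq> 0 \<Longrightarrow> (fs_weight z)\<^sup>2 * f z = z powi (k + 2) * g (1 / z)"
    by (auto simp: is_section_def forms_0_iff)
  have "smooth (\<lambda>z. (fs_weight z)\<^sup>2 * f z / fs_weight z / fs_weight z)" by (intro smooth_intros g)
  hence "smooth f" by (simp add: power2_eq_square)
  moreover have "smooth (\<lambda>w. - (g w / fs_weight w / fs_weight w))" by (intro smooth_intros g)
  moreover have "f z = - (z powi k) / (cnj z)\<^sup>2 * (- (g (1 / z) / fs_weight (1 / z) / fs_weight (1 / z)))" if "z \<noteq> 0" for z
  proof -
    have "f z = z powi (k + 2) * g (1 / z) / (fs_weight z)\<^sup>2"
      using g(3)[OF that] by (simp add: field_simps)
    also have "\<dots> = - (z powi k) / (cnj z)\<^sup>2 * (- (g (1 / z) / fs_weight (1 / z) / fs_weight (1 / z)))"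
      using that by (simp add: fs_weight_inverse power_int_add field_simps power2_eq_square)
    finally show ?thesis .
  qed
  ultimately show "\<exists>g. (f, g) \<in> forms k (Suc 0)" unfolding forms_1_iff by blast
next
  assume "\<exists>g. (f, g) \<in> forms k (Suc 0)"
  then obtain g where g: "smooth f" "smooth g" "\<And>z. z \<noteq> 0 \<Longrightarrow> f z = - (z powi k) / (cnj z)\<^sup>2 * g (1 / z)"
    by (auto simp: forms_1_iff)
  have "smooth (\<lambda>z. (fs_weight z)\<^sup>2 * f z)" "smooth (\<lambda>w. - ((fs_weight w)\<^sup>2 * g w))" by (intro smooth_intros g)+
  moreover have "(fs_weight z)\<^sup>2 * f z = z powi (k + 2) * (- ((fs_weight (1 / z))\<^sup>2 * g (1 / z)))" if "z \<noteq> 0" for z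
    using that g(3)[OF that] by (simp add: fs_weight_inverse power_int_add field_simps power2_eq_square)
  ultimately show "is_section (k + 2) (\<lambda>z. (fs_weight z)\<^sup>2 * f z)"
    unfolding is_section_def forms_0_iff by blast
qed

lemma is_section_raise_op:
  assumes "is_section k f"
  shows "is_section (k + 2) (raise_op f)"
proof -
  obtain g where "(f, g) \<in> forms k 0" using assms by (auto simp: is_section_def)
  hence "(wirtinger_bar f, wirtinger_bar g) \<in> forms k (Suc 0)"
    using dbar_in_forms[of "(f, g)" k] by (simp add: dbar_def)
  thus ?thesis unfolding raise_op_def is_section_iff_forms_1 by blast
qed

lemma is_section_lower_op:
  assumes "is_section (k + 2) f"
  shows "is_section k (lower_op (k + 2) f)"
proof -
  define j where "j = k + 2"
  obtain g where g: "smooth f" "smooth g" "\<And>z. z \<noteq> 0 \<Longrightarrow> f z = z powi j * g (1 / z)"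
    using assms by (auto simp: is_section_def forms_0_iff j_def)
  have "lower_op j f z = z powi k * (- lower_op j g (1 / z))" if z: "z \<noteq> 0" for z
  proof -
    have k: "z powi j = z powi k * z\<^sup>2" "z powi (j - 1) = z powi k * z"
      using z power_int_add[of z k 2] power_int_add[of z k 1] by (simp_all add: j_def add.commute)
    \<comment> \<open>The term from differentiating the transition factor and the connection term
      combine into this difference; its value 1 is what turns them into the connection term of the
      other chart.\<close>
    have W: "fs_weight z - z * cnj z = 1" by (simp add: fs_weight_def)
    have "lower_op j f z = of_int j * (cnj z * (z powi j * g (1 / z))) / fs_weight z
        - (of_int j * z powi (j - 1) * g (1 / z) - z powi j * wirtinger g (1 / z) / z\<^sup>2)"
      using wirtinger_glued(1)[OF g(1,2) g(3) z] unfolding lower_op_def g(3)[OF z] by simp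
    also have "\<dots> = z powi k * (wirtinger g (1 / z) - of_int j * g (1 / z) * (z * (fs_weight z - z * cnj z)) / fs_weight z)"
      unfolding k using z by (simp add: field_simps power2_eq_square)
    also have "\<dots> = z powi k * (wirtinger g (1 / z) - of_int j * g (1 / z) * z / fs_weight z)"
      unfolding W by simp
    also have "\<dots> = z powi k * (- lower_op j g (1 / z))"
      using z by (simp add: lower_op_def fs_weight_inverse field_simps)
    finally show ?thesis .
  qed
  moreover have "smooth (lower_op j f)" "smooth (\<lambda>w. - lower_op j g w)" by (intro smooth_intros g)+
  ultimately show ?thesis unfolding is_section_def forms_0_iff j_def[symmetric] by blast
qed

text \<open>The curvature identity behind the ladder of eigenvalues.\<close>

lemma raise_lower_commute:
  assumes f: "smooth f"
  shows "raise_op (lower_op k f) z = lower_op (k + 2) (raise_op f) z + of_int k * f z"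
proof -
  define w where "w = fs_weight z"
  have w: "w \<noteq> 0" "z * cnj z = w - 1" by (simp_all add: w_def) (simp add: fs_weight_def)
  have inv: "has_wirtinger (\<lambda>z. inverse (fs_weight z)) (- (cnj z / w\<^sup>2)) (- (z / w\<^sup>2)) z"
    using has_wirtinger_fs_weight_powi[of "-1" z] by (simp add: power_int_minus w_def divide_inverse mult.commute)
  have "has_wirtinger (\<lambda>z. of_int k * (cnj z * f z * inverse (fs_weight z)) + (- 1) * wirtinger f z)
    (of_int k * ((0 * f z + cnj z * wirtinger f z) * inverse (fs_weight z) + cnj z * f z * (- (cnj z / w\<^sup>2))) + (- 1) * wirtinger (wirtinger f) z)
    (of_int k * ((1 * f z + cnj z * wirtinger_bar f z) * inverse (fs_weight z) + cnj z * f z * (- (z / w\<^sup>2))) + (- 1) * wirtinger_bar (wirtinger f) z) z"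
    using has_wirtinger_cnj[OF has_wirtinger_id, of z]
    by (intro has_wirtinger_add has_wirtinger_cmult has_wirtinger_mult smooth_has_wirtinger smooth_intros f inv) simp_all
  moreover have "(\<lambda>z. of_int k * (cnj z * f z * inverse (fs_weight z)) + (- 1) * wirtinger f z) = lower_op k f"
    by (simp add: fun_eq_iff lower_op_def divide_inverse)
  ultimately have 1: "wirtinger_bar (lower_op k f) z =
     of_int k * ((f z + cnj z * wirtinger_bar f z) / w - (z * cnj z) * f z / w\<^sup>2) - wirtinger_bar (wirtinger f) z"
    using has_wirtinger_imp(2) by (fastforce simp: w_def divide_inverse algebra_simps)
  have "has_wirtinger (\<lambda>z. fs_weight z powi 2 * wirtinger_bar f z)
     ((of_int 2 * fs_weight z powi (2 - 1) * cnj z) * wirtinger_bar f z + fs_weight z powi 2 * wirtinger (wirtinger_bar f) z)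
     ((of_int 2 * fs_weight z powi (2 - 1) * z) * wirtinger_bar f z + fs_weight z powi 2 * wirtinger_bar (wirtinger_bar f) z) z"
    by (intro has_wirtinger_mult has_wirtinger_fs_weight_powi smooth_has_wirtinger smooth_intros f)
  moreover have "(\<lambda>z. fs_weight z powi 2 * wirtinger_bar f z) = raise_op f"
    by (simp add: fun_eq_iff raise_op_def)
  ultimately have 2: "wirtinger (raise_op f) z = 2 * w * cnj z * wirtinger_bar f z + w\<^sup>2 * wirtinger_bar (wirtinger f) z"
    using has_wirtinger_imp(1)[of "raise_op f"] wirtinger_commute[OF f, of z] by (simp add: w_def)
  have "raise_op (lower_op k f) z = of_int k * (w * (f z + cnj z * wirtinger_bar f z) - (z * cnj z) * f z) - w\<^sup>2 * wirtinger_bar (wirtinger f) z"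
    unfolding raise_op_def[of "lower_op k f"] 1 w_def[symmetric] using w(1) by (simp add: field_simps power2_eq_square)
  \<comment> \<open>The term \<open>k * f\<close> arises from \<open>w - z * cnj z = 1\<close>, that
    is, from constant curvature.\<close>
  also have "\<dots> = of_int k * (w * cnj z * wirtinger_bar f z + f z) - w\<^sup>2 * wirtinger_bar (wirtinger f) z"
    unfolding w(2) by (simp add: algebra_simps)
  also have "\<dots> = lower_op (k + 2) (raise_op f) z + of_int k * f z"
    unfolding lower_op_def 2 w_def[symmetric] unfolding raise_op_def w_def[symmetric] using w(1) by (simp add: field_simps power2_eq_square)
  finally show ?thesis .
qed

lemma raise_op_cmult: "smooth f \<Longrightarrow> raise_op (\<lambda>z. c * f z) = (\<lambda>z. c * raise_op f z)"
  using has_wirtinger_imp(2)[OF has_wirtinger_cmult[OF smooth_has_wirtinger]]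
  by (simp add: fun_eq_iff raise_op_def)

lemma lower_op_cmult: "smooth f \<Longrightarrow> lower_op k (\<lambda>z. c * f z) = (\<lambda>z. c * lower_op k f z)"
  using has_wirtinger_imp(1)[OF has_wirtinger_cmult[OF smooth_has_wirtinger]]
  by (simp add: fun_eq_iff lower_op_def field_simps)

lemma raise_op_add: "smooth f \<Longrightarrow> smooth g \<Longrightarrow> raise_op (\<lambda>z. f z + g z) = (\<lambda>z. raise_op f z + raise_op g z)"
  using has_wirtinger_imp(2)[OF has_wirtinger_add[OF smooth_has_wirtinger smooth_has_wirtinger]]
  by (simp add: fun_eq_iff raise_op_def algebra_simps)

lemma lower_op_add: "smooth f \<Longrightarrow> smooth g \<Longrightarrow> lower_op k (\<lambda>z. f z + g z) = (\<lambda>z. lower_op k f z + lower_op k g z)"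
  using has_wirtinger_imp(1)[OF has_wirtinger_add[OF smooth_has_wirtinger smooth_has_wirtinger]]
  by (simp add: fun_eq_iff lower_op_def add_divide_distrib algebra_simps)

lemma is_section_cmult: "is_section k f \<Longrightarrow> is_section k (\<lambda>z. c * f z)"
  unfolding is_section_def forms_0_iff
  by (elim exE, rule_tac x = "\<lambda>w. c * g w" in exI) (auto intro!: smooth_intros)

lemma is_section_add: "is_section k f \<Longrightarrow> is_section k g \<Longrightarrow> is_section k (\<lambda>z. f z + g z)"
  unfolding is_section_def forms_0_iff
  by (elim exE, rule_tac x = "\<lambda>w. ga w + gaa w" in exI) (auto intro!: smooth_intros simp: algebra_simps)

section \<open>Adjoints and the Laplacian\<close>

text \<open>The pointwise norm does not depend on the chart, and the closed unit discs of the two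
  charts are compact and cover the sphere.\<close>

lemma section_bounded:
  assumes "is_section k f"
  shows "\<exists>C. \<forall>z. (cmod (f z))\<^sup>2 * (1 + (cmod z)\<^sup>2) powi (- k) \<le> C"
proof -
  obtain g where g: "smooth f" "smooth g" "\<And>z. z \<noteq> 0 \<Longrightarrow> f z = z powi k * g (1 / z)"
    using assms by (auto simp: is_section_def forms_0_iff)
  define N where "N h z = (cmod (h z))\<^sup>2 * (1 + (cmod z)\<^sup>2) powi (- k)" for h :: "complex \<Rightarrow> complex" and z
  have bdd: "\<exists>C. \<forall>z\<in>cball 0 1. N h z \<le> C" if "smooth h" for h
  proof -
    have nz: "1 + (cmod z)\<^sup>2 \<noteq> 0" for z using one_plus_norm_pos[of z] by linarith
    have "continuous_on (cball 0 1) (N h)" unfolding N_def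
      by (intro continuous_intros smooth_imp_continuous that) (use nz in auto)
    hence "compact (N h ` cball 0 1)" by (intro compact_continuous_image compact_cball)
    hence "bounded (N h ` cball 0 1)" by (rule compact_imp_bounded)
    then obtain C where "\<forall>z\<in>cball 0 1. \<bar>N h z\<bar> \<le> C" unfolding bounded_iff by auto
    thus ?thesis by (intro exI[of _ C]) force
  qed
  obtain C1 where C1: "\<forall>z\<in>cball 0 1. N f z \<le> C1" using bdd[OF g(1)] by blast
  obtain C2 where C2: "\<forall>z\<in>cball 0 1. N g z \<le> C2" using bdd[OF g(2)] by blast
  have "N f z \<le> max C1 C2" for z
  proof (cases "cmod z \<le> 1")
    case False
    hence z: "z \<noteq> 0" by auto
    define r where "r = cmod z"
    have r: "r > 1" using False by (simp add: r_def)
    have eq: "1 + (cmod (1 / z))\<^sup>2 = (1 + r\<^sup>2) / r\<^sup>2" using r by (simp add: norm_divide r_def[symmetric] power_divide add_divide_distrib)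
    have "N f z = N g (1 / z)"
      unfolding N_def g(3)[OF z] eq
      using r by (simp add: norm_mult norm_power_int r_def[symmetric] power_int_divide_distrib power_int_minus power_mult_distrib field_simps)
        (simp add: power2_eq_square power_int_mult_distrib)
    also have "1 / z \<in> cball 0 1" using r by (simp add: norm_divide r_def[symmetric])
    hence "N g (1 / z) \<le> C2" using C2 by blast
    finally show ?thesis by simp
  qed (use C1 in \<open>auto intro: max.coboundedI1\<close>)
  thus ?thesis by (auto simp: N_def)
qed

definition section_inner :: "int \<Rightarrow> (complex \<Rightarrow> complex) \<Rightarrow> (complex \<Rightarrow> complex) \<Rightarrow> complex" where
  "section_inner k f h = (LINT z|fubini_study. f z * cnj (h z) * fs_weight z powi (- k))"

lemma section_inner_integrable:
  assumes f: "is_section k f" and h: "is_section k h"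
  shows "integrable fubini_study (\<lambda>z. f z * cnj (h z) * fs_weight z powi (- k))"
proof -
  obtain C where C: "\<And>z. (cmod (f z))\<^sup>2 * (1 + (cmod z)\<^sup>2) powi (- k) \<le> C" using section_bounded[OF f] by blast
  obtain D where D: "\<And>z. (cmod (h z))\<^sup>2 * (1 + (cmod z)\<^sup>2) powi (- k) \<le> D" using section_bounded[OF h] by blast
  have "norm (f z * cnj (h z) * fs_weight z powi (- k)) \<le> C + D" for z
  proof -
    define N where "N = (1 + (cmod z)\<^sup>2) powi (- k)"
    have N: "N \<ge> 0" using one_plus_norm_pos[of z] by (simp add: N_def)
    have "norm (f z * cnj (h z) * fs_weight z powi (- k)) = (cmod (f z) * cmod (h z)) * N"
      using N unfolding fs_weight_powi N_def[symmetric] by (simp add: norm_mult)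
    also have "\<dots> \<le> ((cmod (f z))\<^sup>2 + (cmod (h z))\<^sup>2) * N"
    proof (rule mult_right_mono[OF _ N])
      have "2 * (cmod (f z) * cmod (h z)) \<le> (cmod (f z))\<^sup>2 + (cmod (h z))\<^sup>2"
        using sum_squares_bound[of "cmod (f z)" "cmod (h z)"] by simp
      moreover have "0 \<le> cmod (f z) * cmod (h z)" by simp
      ultimately show "cmod (f z) * cmod (h z) \<le> (cmod (f z))\<^sup>2 + (cmod (h z))\<^sup>2" by linarith
    qed
    also have "\<dots> \<le> C + D" using C[of z] D[of z] by (simp add: N_def distrib_right)
    finally show ?thesis .
  qed
  moreover have "(\<lambda>z. f z * cnj (h z) * fs_weight z powi (- k)) \<in> borel_measurable fubini_study"
  proof -
    have "continuous_on UNIV (\<lambda>z. f z * cnj (h z) * fs_weight z powi (- k))"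
      by (intro smooth_imp_continuous smooth_intros is_section_smooth[OF f] is_section_smooth[OF h])
    thus ?thesis unfolding fubini_study_def by (simp add: borel_measurable_continuous_onI)
  qed
  ultimately show ?thesis
    by (intro finite_measure.integrable_const_bound[OF finite_measure_fubini_study, of _ "C + D"]) auto
qed

lemma fubini_study_density:
  fixes f :: "complex \<Rightarrow> complex"
  assumes f: "continuous_on UNIV f"
  shows "integrable fubini_study f \<longleftrightarrow> integrable lborel (\<lambda>z. f z / (of_real pi * (fs_weight z)\<^sup>2))"
    and "(LINT z|fubini_study. f z) = (LINT z|lborel. f z / (of_real pi * (fs_weight z)\<^sup>2))"
proof -
  have fm [measurable]: "f \<in> borel_measurable lborel" using f by (simp add: borel_measurable_continuous_onI)
  have eq: "(1 / (pi * (1 + (cmod z)\<^sup>2)\<^sup>2)) *\<^sub>R f z = f z / (of_real pi * (fs_weight z)\<^sup>2)" for z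
    by (simp add: fs_weight_of_real scaleR_conv_of_real)
  show "integrable fubini_study f \<longleftrightarrow> integrable lborel (\<lambda>z. f z / (of_real pi * (fs_weight z)\<^sup>2))"
    unfolding fubini_study_def eq[symmetric] by (rule integrable_density) auto
  show "(LINT z|fubini_study. f z) = (LINT z|lborel. f z / (of_real pi * (fs_weight z)\<^sup>2))"
    unfolding fubini_study_def eq[symmetric] by (rule integral_density) auto
qed

text \<open>Integration by parts: up to the factor \<open>pi\<close>, the two integrands differ by
  \<open>wirtinger_bar F\<close>. The boundary term vanishes because boundedness of the two
  pointwise norms makes \<open>F\<close> decay like the inverse weight.\<close>

lemma section_inner_raise_lower:
  assumes f: "is_section k f" and u: "is_section (k + 2) u"
  shows "section_inner (k + 2) (raise_op f) u = section_inner k f (lower_op (k + 2) u)"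
proof -
  note sm = is_section_smooth[OF f] is_section_smooth[OF u]
  define A where "A z = raise_op f z * cnj (u z) * fs_weight z powi (- (k + 2))" for z
  define B where "B z = f z * cnj (lower_op (k + 2) u z) * fs_weight z powi (- k)" for z
  define F where "F z = f z * cnj (u z) * fs_weight z powi (- (k + 2))" for z
  have F: "smooth F" unfolding F_def by (intro smooth_intros sm)
  have contA: "continuous_on UNIV A" unfolding A_def by (intro smooth_imp_continuous smooth_intros sm)
  have contB: "continuous_on UNIV B" unfolding B_def by (intro smooth_imp_continuous smooth_intros sm)
  have intA: "integrable lborel (\<lambda>z. A z / (of_real pi * (fs_weight z)\<^sup>2))"
    unfolding fubini_study_density(1)[OF contA, symmetric] unfolding A_def
    by (intro section_inner_integrable is_section_raise_op f u)
  have intB: "integrable lborel (\<lambda>z. B z / (of_real pi * (fs_weight z)\<^sup>2))"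
    unfolding fubini_study_density(1)[OF contB, symmetric] unfolding B_def
    by (intro section_inner_integrable is_section_lower_op f u)
  have dF: "wirtinger_bar F z = of_real pi * (A z / (of_real pi * (fs_weight z)\<^sup>2) - B z / (of_real pi * (fs_weight z)\<^sup>2))" for z
  proof -
    define w where "w = fs_weight z"
    have w: "w \<noteq> 0" and cw: "cnj w = w" by (simp_all add: w_def)
    define p where "p = w powi (- (k + 2))"
    have p: "w powi (- (k + 2) - 1) = p / w" "w powi (- k) = p * w\<^sup>2"
      using power_int_add[of w "- (k + 2)" "-1"] power_int_add[of w "- (k + 2)" 2] w
      by (simp_all add: p_def power_int_minus divide_inverse)
    have "has_wirtinger (\<lambda>z. f z * cnj (u z) * fs_weight z powi (- (k + 2)))
       ((wirtinger f z * cnj (u z) + f z * cnj (wirtinger_bar u z)) * fs_weight z powi (- (k + 2))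
        + f z * cnj (u z) * (of_int (- (k + 2)) * fs_weight z powi (- (k + 2) - 1) * cnj z))
       ((wirtinger_bar f z * cnj (u z) + f z * cnj (wirtinger u z)) * fs_weight z powi (- (k + 2))
        + f z * cnj (u z) * (of_int (- (k + 2)) * fs_weight z powi (- (k + 2) - 1) * z)) z"
      by (intro has_wirtinger_mult has_wirtinger_cnj has_wirtinger_fs_weight_powi smooth_has_wirtinger sm)
    from has_wirtinger_imp(2)[OF this]
    have "wirtinger_bar F z = (wirtinger_bar f z * cnj (u z) + f z * cnj (wirtinger u z)) * p
        + f z * cnj (u z) * (of_int (- (k + 2)) * (p / w) * z)"
      unfolding F_def[abs_def] w_def[symmetric] p p_def[symmetric] .
    also have "\<dots> = of_real pi * (A z / (of_real pi * w\<^sup>2) - B z / (of_real pi * w\<^sup>2))"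
      unfolding A_def B_def raise_op_def lower_op_def w_def[symmetric] p p_def[symmetric]
      using w cw by (simp add: w_def[symmetric] power2_eq_square field_simps)
    finally show ?thesis by (simp add: w_def)
  qed
  obtain C where C: "\<And>z. (cmod (f z))\<^sup>2 * (1 + (cmod z)\<^sup>2) powi (- k) \<le> C" using section_bounded[OF f] by blast
  obtain D where D: "\<And>z. (cmod (u z))\<^sup>2 * (1 + (cmod z)\<^sup>2) powi (- (k + 2)) \<le> D" using section_bounded[OF u] by blast
  have bound: "norm (F z) * (1 + (cmod z)\<^sup>2) \<le> C + D" for z
  proof -
    define N where "N = 1 + (cmod z)\<^sup>2"
    have N: "N > 0" unfolding N_def by (rule one_plus_norm_pos)
    define P where "P = N powi (- (k + 2))"
    have P: "P > 0" using N by (simp add: P_def)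
    have PN: "N powi (- k) = P * N\<^sup>2"
      using power_int_add[of N "- (k + 2)" 2] N by (simp add: P_def)
    define a b where "a = cmod (f z)" and "b = cmod (u z)"
    have ab: "a \<ge> 0" "b \<ge> 0" by (simp_all add: a_def b_def)
    \<comment> \<open>Grouped for the inequality \<open>2 * x * y \<le> x^2 + y^2\<close> with
      \<open>x = a * N\<close>: then \<open>(a * N)\<^sup>2 * P\<close> and
      \<open>b\<^sup>2 * P\<close> are the squared pointwise norms in degrees \<open>k\<close> and
      \<open>k + 2\<close>.\<close>
    have "norm (F z) * N = (2 * (a * N) * b) * P / 2"
      using P unfolding F_def fs_weight_powi N_def[symmetric] P_def[symmetric] by (simp add: norm_mult a_def b_def)
    also have "\<dots> \<le> ((a * N)\<^sup>2 + b\<^sup>2) * P / 2"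
      using P sum_squares_bound[of "a * N" b] by (intro divide_right_mono mult_right_mono) auto
    also have "\<dots> \<le> ((a * N)\<^sup>2 + b\<^sup>2) * P" using P by simp
    also have "\<dots> = a\<^sup>2 * N powi (- k) + b\<^sup>2 * P" unfolding PN by (simp add: power_mult_distrib algebra_simps)
    also have "\<dots> \<le> C + D" unfolding P_def N_def a_def b_def by (intro add_mono C D)
    finally show ?thesis by (simp add: N_def)
  qed
  have "integrable lborel (wirtinger_bar F)"
    unfolding dF[abs_def] by (intro Bochner_Integration.integrable_mult_right Bochner_Integration.integrable_diff intA intB)
  from integral_wirtinger_bar_eq_0[OF F bound this]
  have "(LINT z|lborel. A z / (of_real pi * (fs_weight z)\<^sup>2)) = (LINT z|lborel. B z / (of_real pi * (fs_weight z)\<^sup>2))"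
    unfolding dF by (simp add: Bochner_Integration.integral_diff[OF intA intB])
  thus ?thesis
    unfolding section_inner_def A_def[symmetric] B_def[symmetric] fubini_study_density(2)[OF contA] fubini_study_density(2)[OF contB] .
qed

lemma AE_lborel_continuous_eq_0:
  fixes f :: "complex \<Rightarrow> complex"
  assumes "continuous_on UNIV f" "AE z in lborel. f z = 0"
  shows "f z = 0"
proof -
  define N where "N = {z. f z \<noteq> 0}"
  have op: "open N"
    using open_Collect_neq[OF assms(1) continuous_on_const] by (simp add: N_def)
  hence "N \<in> sets lborel" by simp
  moreover have "AE z in lborel. z \<notin> N" using assms(2) by (simp add: N_def)
  ultimately have "N \<in> null_sets lborel" by (simp only: AE_iff_null_sets)
  hence "negligible N" by (simp add: negligible_iff_null_sets null_sets_completionI)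
  hence "N = {}" using op open_not_negligible by blast
  thus ?thesis by (auto simp: N_def)
qed

text \<open>For definiteness, the positive density carries the null set over to Lebesgue measure,
  and a continuous function that vanishes almost everywhere vanishes.\<close>

lemma section_inner_self:
  assumes f: "is_section k f"
  shows "\<exists>r\<ge>0. section_inner k f f = complex_of_real r \<and> (r = 0 \<longrightarrow> f = (\<lambda>_. 0))"
proof -
  define h where "h z = (cmod (f z))\<^sup>2 * (1 + (cmod z)\<^sup>2) powi (- k)" for z
  have eq: "f z * cnj (f z) * fs_weight z powi (- k) = of_real (h z)" for z
    by (simp only: fs_weight_powi h_def of_real_mult complex_norm_square)
  have cf: "continuous_on UNIV f" by (rule smooth_imp_continuous[OF is_section_smooth[OF f]])
  have h0: "h z \<ge> 0" for z using one_plus_norm_pos[of z] by (simp add: h_def)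
  have int: "integrable fubini_study h"
    using section_inner_integrable[OF f f] unfolding eq by (simp add: complex_of_real_integrable_eq)
  have "section_inner k f f = of_real (LINT z|fubini_study. h z)"
    unfolding section_inner_def eq by (rule integral_complex_of_real)
  moreover have "(LINT z|fubini_study. h z) \<ge> 0" by (rule integral_nonneg_AE) (use h0 in auto)
  moreover have "f = (\<lambda>_. 0)" if "(LINT z|fubini_study. h z) = 0"
  proof -
    have "AE z in fubini_study. h z = 0"
      using integral_nonneg_eq_0_iff_AE[OF int] h0 that by auto
    hence "AE z in lborel. 0 < ennreal (1 / (pi * (1 + (cmod z)\<^sup>2)\<^sup>2)) \<longrightarrow> h z = 0"
      unfolding fubini_study_def by (subst (asm) AE_density) measurable
    moreover have "0 < ennreal (1 / (pi * (1 + (cmod z)\<^sup>2)\<^sup>2))" for z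
      using one_plus_norm_pos[of z] by (simp add: zero_less_divide_iff)
    ultimately have "AE z in lborel. h z = 0" by simp
    moreover have "h z = 0 \<longleftrightarrow> f z = 0" for z
      using one_plus_norm_pos[of z] by (simp add: h_def)
    ultimately have "AE z in lborel. f z = 0" by simp
    thus ?thesis using AE_lborel_continuous_eq_0[OF cf] by blast
  qed
  ultimately show ?thesis by blast
qed

lemma section_inner_cmult_left: "section_inner k (\<lambda>z. c * f z) h = c * section_inner k f h"
  unfolding section_inner_def integral_mult_right_zero[symmetric] by (simp add: mult_ac)

lemma section_inner_cmult_right: "section_inner k f (\<lambda>z. c * h z) = cnj c * section_inner k f h"
  unfolding section_inner_def integral_mult_right_zero[symmetric] by (simp add: mult_ac)

lemma section_inner_diff_right:
  assumes "is_section k f" "is_section k g" "is_section k h"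
  shows "section_inner k f (\<lambda>z. g z - h z) = section_inner k f g - section_inner k f h"
  unfolding section_inner_def
    Bochner_Integration.integral_diff[OF section_inner_integrable[OF assms(1,2)] section_inner_integrable[OF assms(1,3)], symmetric]
  by (rule Bochner_Integration.integral_cong) (simp_all add: algebra_simps)

text \<open>By adjointness, \<open>c\<close> is the ratio of the squared norms of
  \<open>raise_op f\<close> and \<open>f\<close>. The first clause forces the ladder to stop, the
  third turns its end into an equation for the eigenvalue, the second makes null eigensections
  holomorphic.\<close>

lemma raise_adjoint_nonneg:
  assumes f: "is_section k f" "f \<noteq> (\<lambda>_. 0)" and eig: "lower_op (k + 2) (raise_op f) = (\<lambda>z. c * f z)"
  shows "\<exists>r\<ge>0. c = complex_of_real r" and "c = 0 \<Longrightarrow> raise_op f = (\<lambda>_. 0)" and "raise_op f = (\<lambda>_. 0) \<Longrightarrow> c = 0"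
proof -
  obtain r where r: "r \<ge> 0" "section_inner k f f = complex_of_real r" "r = 0 \<longrightarrow> f = (\<lambda>_. 0)"
    using section_inner_self[OF f(1)] by blast
  obtain t where t: "t \<ge> 0" "section_inner (k + 2) (raise_op f) (raise_op f) = complex_of_real t" "t = 0 \<longrightarrow> raise_op f = (\<lambda>_. 0)"
    using section_inner_self[OF is_section_raise_op[OF f(1)]] by blast
  have "section_inner (k + 2) (raise_op f) (raise_op f) = cnj c * section_inner k f f"
    unfolding section_inner_raise_lower[OF f(1) is_section_raise_op[OF f(1)]] eig by (rule section_inner_cmult_right)
  hence "cnj c * of_real r = of_real t" using r t by simp
  moreover have "r > 0" using r f(2) by (cases "r = 0") auto
  ultimately have "cnj c = of_real (t / r)" by (simp add: field_simps)
  hence c: "c = of_real (t / r)" by (metis complex_cnj_cnj complex_cnj_complex_of_real)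
  thus "\<exists>r\<ge>0. c = complex_of_real r" using \<open>r > 0\<close> \<open>t \<ge> 0\<close> by (intro exI[of _ "t / r"]) auto
  show "raise_op f = (\<lambda>_. 0)" if "c = 0" using c t that \<open>r > 0\<close> by auto
  show "c = 0" if "raise_op f = (\<lambda>_. 0)"
    using t that \<open>r > 0\<close> c by (auto simp: section_inner_def)
qed

lemma lower_adjoint_nonneg:
  assumes u: "is_section (k + 2) u" "u \<noteq> (\<lambda>_. 0)" and eig: "raise_op (lower_op (k + 2) u) = (\<lambda>z. c * u z)"
  shows "\<exists>r\<ge>0. c = complex_of_real r"
proof -
  obtain r where r: "r \<ge> 0" "section_inner (k + 2) u u = complex_of_real r" "r = 0 \<longrightarrow> u = (\<lambda>_. 0)"
    using section_inner_self[OF u(1)] by blast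
  note l = is_section_lower_op[OF u(1)]
  obtain t where t: "t \<ge> 0" "section_inner k (lower_op (k + 2) u) (lower_op (k + 2) u) = complex_of_real t"
    using section_inner_self[OF l] by blast
  have "c * section_inner (k + 2) u u = of_real t"
    using section_inner_raise_lower[OF l u(1)] unfolding eig section_inner_cmult_left t .
  hence "c * of_real r = of_real t" using r by simp
  moreover have "r > 0" using r u(2) by (cases "r = 0") auto
  ultimately have "c = of_real (t / r)" by (simp add: field_simps)
  thus ?thesis using \<open>r > 0\<close> \<open>t \<ge> 0\<close> by (intro exI[of _ "t / r"]) auto
qed

text \<open>Gluing determines the second coefficient away from the point at infinity, and continuity
  determines it there.\<close>

lemma form_eqI:
  assumes "(f, g) \<in> forms k q" "(f, h) \<in> forms k q"
  shows "g = h"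
proof (cases "q \<le> 1")
  case True
  hence sm: "smooth g" "smooth h" and
    eq: "\<And>z. z \<noteq> 0 \<Longrightarrow> z powi k * (- 1 / (cnj z)\<^sup>2) ^ q * g (1 / z) = z powi k * (- 1 / (cnj z)\<^sup>2) ^ q * h (1 / z)"
    using assms by (auto simp: forms_def)
  have away: "g w = h w" if w: "w \<noteq> 0" for w
    using eq[of "1 / w"] w by simp
  have "smooth (\<lambda>w. g w - h w)" by (intro smooth_intros sm)
  hence c: "isCont (\<lambda>w. g w - h w) 0"
    using smooth_imp_continuous[of _ UNIV] by (auto simp: continuous_on_eq_continuous_at)
  have "(\<lambda>w. g w - h w) \<midarrow>0\<rightarrow> 0"
    by (rule tendsto_eventually) (auto simp: eventually_at_filter away)
  hence "g 0 - h 0 = 0" using c LIM_unique unfolding isCont_def by blast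
  thus ?thesis using away by (metis eq_iff_diff_eq_0 ext)
qed (use assms in \<open>auto simp: forms_def zero_prod_def\<close>)

lemma form_eqI': "\<alpha> \<in> forms k q \<Longrightarrow> \<beta> \<in> forms k q \<Longrightarrow> fst \<alpha> = fst \<beta> \<Longrightarrow> \<alpha> = \<beta>"
  using form_eqI by (metis prod.collapse)

section \<open>Translation of \<open>(0,1)\<close>-forms into sections of degree
  \<open>m + 2\<close>\<close>

lemma is_section_fst: "\<alpha> \<in> forms k 0 \<Longrightarrow> is_section k (fst \<alpha>)"
  unfolding is_section_def by (metis prod.collapse)

lemma is_section_fst_1: "\<alpha> \<in> forms k (Suc 0) \<Longrightarrow> is_section (k + 2) (\<lambda>z. (fs_weight z)\<^sup>2 * fst \<alpha> z)"
  unfolding is_section_iff_forms_1 by (metis prod.collapse)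

lemma l2_inner_0: "l2_inner m 0 \<alpha> \<beta> = section_inner m (fst \<alpha>) (fst \<beta>)"
  unfolding l2_inner_def section_inner_def fs_weight_powi by simp

lemma l2_inner_1:
  "l2_inner m (Suc 0) \<alpha> \<beta> = section_inner (m + 2) (\<lambda>z. (fs_weight z)\<^sup>2 * fst \<alpha> z) (\<lambda>z. (fs_weight z)\<^sup>2 * fst \<beta> z)"
proof -
  have "complex_of_real ((1 + (cmod z)\<^sup>2) powi (2 - m)) = (fs_weight z)\<^sup>2 * (fs_weight z)\<^sup>2 * fs_weight z powi (- (m + 2))" for z
    using power_int_add[of "fs_weight z" 2 2] power_int_add[of "fs_weight z" 4 "- (m + 2)"]
    unfolding fs_weight_powi[symmetric] by (simp add: algebra_simps)
  thus ?thesis unfolding l2_inner_def section_inner_def by (simp add: mult_ac)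
qed

text \<open>Resolves the definite description: integration by parts gives an adjoint, and testing
  against the difference of two candidates shows that it is the only one.\<close>

lemma dbar_adj_properties:
  assumes \<alpha>: "\<alpha> \<in> forms m (Suc 0)"
  shows "dbar_adj m 0 \<alpha> \<in> forms m 0 \<and> fst (dbar_adj m 0 \<alpha>) = lower_op (m + 2) (\<lambda>z. (fs_weight z)\<^sup>2 * fst \<alpha> z)"
proof -
  define u where "u = (\<lambda>z. (fs_weight z)\<^sup>2 * fst \<alpha> z)"
  have u: "is_section (m + 2) u" unfolding u_def by (rule is_section_fst_1[OF \<alpha>])
  obtain g where g: "(lower_op (m + 2) u, g) \<in> forms m 0"
    using is_section_lower_op[OF u] by (auto simp: is_section_def)
  have adj: "l2_inner m (Suc 0) (dbar 0 \<gamma>) \<alpha> = section_inner m (fst \<gamma>) (lower_op (m + 2) u)" if "\<gamma> \<in> forms m 0" for \<gamma>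
    using section_inner_raise_lower[OF is_section_fst[OF that] u]
    by (simp add: l2_inner_1 dbar_def raise_op_def u_def)
  have "dbar_adj m 0 \<alpha> = (lower_op (m + 2) u, g)"
    unfolding dbar_adj_def
  proof (rule the_equality, intro conjI ballI)
    show "(lower_op (m + 2) u, g) \<in> forms m 0" by (rule g)
    show "l2_inner m (Suc 0) (dbar 0 \<gamma>) \<alpha> = l2_inner m 0 \<gamma> (lower_op (m + 2) u, g)" if "\<gamma> \<in> forms m 0" for \<gamma>
      using adj[OF that] by (simp add: l2_inner_0)
  next
    fix \<beta> assume \<beta>: "\<beta> \<in> forms m 0 \<and> (\<forall>\<gamma>\<in>forms m 0. l2_inner m (Suc 0) (dbar 0 \<gamma>) \<alpha> = l2_inner m 0 \<gamma> \<beta>)"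
    define d where "d = (\<lambda>z. fst \<beta> z - lower_op (m + 2) u z)"
    have sb: "is_section m (fst \<beta>)" using \<beta> is_section_fst by blast
    have sl: "is_section m (lower_op (m + 2) u)" by (rule is_section_lower_op[OF u])
    have d: "is_section m d"
      using is_section_add[OF sb is_section_cmult[OF sl, of "-1"]] by (simp add: d_def)
    then obtain g' where g': "(d, g') \<in> forms m 0" by (auto simp: is_section_def)
    have "section_inner m d (fst \<beta>) = section_inner m d (lower_op (m + 2) u)"
      using \<beta> g' adj[OF g'] by (auto simp: l2_inner_0)
    hence "section_inner m d d = 0"
      using section_inner_diff_right[OF d sb sl] by (simp add: d_def[symmetric])
    hence "d = (\<lambda>_. 0)" using section_inner_self[OF d] by auto
    hence "fst \<beta> = lower_op (m + 2) u" by (simp add: d_def fun_eq_iff)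
    thus "\<beta> = (lower_op (m + 2) u, g)" using \<beta> g by (intro form_eqI') auto
  qed
  thus ?thesis using g by (simp add: u_def)
qed

lemma zero_in_forms_1: "0 \<in> forms m (Suc 0)"
  by (simp add: forms_def zero_prod_def zero_fun_def smooth_const)

text \<open>The Laplacian on \<open>(0,1)\<close>-forms contains the adjoint out of degree 2, where
  the only form is 0. That description has to be resolved as well; here a candidate is tested
  against itself.\<close>

lemma dbar_adj_1_zero: "dbar_adj m (Suc 0) 0 = 0"
  unfolding dbar_adj_def
proof (rule the_equality)
  have z: "l2_inner m q 0 \<beta> = 0" "l2_inner m q \<beta> 0 = 0" for q \<beta> by (simp_all add: l2_inner_def)
  have d: "dbar (Suc 0) \<gamma> = 0" for \<gamma> by (simp add: dbar_def)
  show "0 \<in> forms m (Suc 0) \<and> (\<forall>\<gamma>\<in>forms m (Suc 0). l2_inner m (Suc (Suc 0)) (dbar (Suc 0) \<gamma>) 0 = l2_inner m (Suc 0) \<gamma> 0)"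
    by (simp add: zero_in_forms_1 z)
  fix \<beta> assume \<beta>: "\<beta> \<in> forms m (Suc 0) \<and> (\<forall>\<gamma>\<in>forms m (Suc 0). l2_inner m (Suc (Suc 0)) (dbar (Suc 0) \<gamma>) 0 = l2_inner m (Suc 0) \<gamma> \<beta>)"
  hence "l2_inner m (Suc 0) \<beta> \<beta> = 0" by (auto simp: z)
  hence "(\<lambda>z. (fs_weight z)\<^sup>2 * fst \<beta> z) = (\<lambda>_. 0)"
    using section_inner_self[OF is_section_fst_1, of \<beta> m] \<beta> by (auto simp: l2_inner_1)
  hence "fst \<beta> = fst (0 :: form)" by (simp add: fun_eq_iff)
  thus "\<beta> = 0" using \<beta> zero_in_forms_1 by (intro form_eqI') auto
qed

lemma laplacian_1:
  assumes \<alpha>: "\<alpha> \<in> forms m (Suc 0)"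
  shows "laplacian m (Suc 0) \<alpha> \<in> forms m (Suc 0)"
    and "(\<lambda>z. (fs_weight z)\<^sup>2 * fst (laplacian m (Suc 0) \<alpha>) z) = raise_op (lower_op (m + 2) (\<lambda>z. (fs_weight z)\<^sup>2 * fst \<alpha> z))"
proof -
  have "dbar (Suc 0) \<alpha> = 0" by (simp add: dbar_def)
  hence L: "laplacian m (Suc 0) \<alpha> = dbar 0 (dbar_adj m 0 \<alpha>)" by (simp add: dbar_adj_1_zero)
  show "laplacian m (Suc 0) \<alpha> \<in> forms m (Suc 0)"
    unfolding L using dbar_adj_properties[OF \<alpha>] by (intro dbar_in_forms) blast
  show "(\<lambda>z. (fs_weight z)\<^sup>2 * fst (laplacian m (Suc 0) \<alpha>) z) = raise_op (lower_op (m + 2) (\<lambda>z. (fs_weight z)\<^sup>2 * fst \<alpha> z))"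
    unfolding L using dbar_adj_properties[OF \<alpha>] by (simp add: dbar_def raise_op_def)
qed

lemma form_scale_in_forms_1: "\<alpha> \<in> forms m (Suc 0) \<Longrightarrow> form_scale c \<alpha> \<in> forms m (Suc 0)"
  by (cases \<alpha>) (auto simp: form_scale_def forms_1_iff intro!: smooth_intros)

lemma eigenspace_1_iff:
  "\<alpha> \<in> eigenspace m (Suc 0) l \<longleftrightarrow> \<alpha> \<in> forms m (Suc 0) \<and>
     raise_op (lower_op (m + 2) (\<lambda>z. (fs_weight z)\<^sup>2 * fst \<alpha> z)) = (\<lambda>z. l * ((fs_weight z)\<^sup>2 * fst \<alpha> z))"
proof (cases "\<alpha> \<in> forms m (Suc 0)")
  case True
  have "laplacian m (Suc 0) \<alpha> = form_scale l \<alpha> \<longleftrightarrow> fst (laplacian m (Suc 0) \<alpha>) = fst (form_scale l \<alpha>)"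
    using form_eqI'[OF laplacian_1(1)[OF True] form_scale_in_forms_1[OF True]] by (auto simp del: laplacian.simps)
  also have "\<dots> \<longleftrightarrow> (\<lambda>z. (fs_weight z)\<^sup>2 * fst (laplacian m (Suc 0) \<alpha>) z) = (\<lambda>z. l * ((fs_weight z)\<^sup>2 * fst \<alpha> z))"
    by (auto simp: fun_eq_iff form_scale_def)
  finally show ?thesis using True unfolding laplacian_1(2)[OF True] by (simp add: eigenspace_def del: laplacian.simps)
qed (simp add: eigenspace_def)

section \<open>The spectrum\<close>

interpretation forms: vector_space form_scale
  by (rule vector_space_form_scale)

lemma raise_op_zero: "raise_op (\<lambda>_. 0) = (\<lambda>_. 0)"
  using raise_op_cmult[OF smooth_const, of 0 0] by simp

lemma lower_op_zero: "lower_op k (\<lambda>_. 0) = (\<lambda>_. 0)"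
  using lower_op_cmult[OF smooth_const, of k 0 0] by simp

lemma smooth_sum: "(\<And>i. i \<in> A \<Longrightarrow> smooth (f i)) \<Longrightarrow> smooth (\<lambda>z. \<Sum>i\<in>A. f i z)"
  by (induction A rule: infinite_finite_induct) (auto intro: smooth_intros)

lemma raise_op_sum:
  assumes "finite A" "\<And>i. i \<in> A \<Longrightarrow> smooth (f i)"
  shows "raise_op (\<lambda>z. \<Sum>i\<in>A. c i * f i z) = (\<lambda>z. \<Sum>i\<in>A. c i * raise_op (f i) z)"
  using assms
proof (induction A rule: finite_induct)
  case (insert x A)
  have "smooth (\<lambda>z. c x * f x z)" "smooth (\<lambda>z. \<Sum>i\<in>A. c i * f i z)"
    using insert.prems by (auto intro!: smooth_intros smooth_sum)
  from raise_op_add[OF this] show ?case using insert by (simp add: raise_op_cmult)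
qed (simp add: raise_op_zero)

lemma lower_op_sum:
  assumes "finite A" "\<And>i. i \<in> A \<Longrightarrow> smooth (f i)"
  shows "lower_op k (\<lambda>z. \<Sum>i\<in>A. c i * f i z) = (\<lambda>z. \<Sum>i\<in>A. c i * lower_op k (f i) z)"
  using assms
proof (induction A rule: finite_induct)
  case (insert x A)
  have "smooth (\<lambda>z. c x * f x z)" "smooth (\<lambda>z. \<Sum>i\<in>A. c i * f i z)"
    using insert.prems by (auto intro!: smooth_intros smooth_sum)
  from lower_op_add[OF this] show ?case using insert by (simp add: lower_op_cmult)
qed (simp add: lower_op_zero)

lemma smooth_raise_pow: "smooth f \<Longrightarrow> smooth ((raise_op ^^ j) f)"
  by (induction j) (auto intro: smooth_intros)

lemma raise_pow_sum:
  assumes "finite A" "\<And>i. i \<in> A \<Longrightarrow> smooth (f i)"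
  shows "(raise_op ^^ j) (\<lambda>z. \<Sum>i\<in>A. c i * f i z) = (\<lambda>z. \<Sum>i\<in>A. c i * (raise_op ^^ j) (f i) z)"
  by (induction j) (auto simp: raise_op_sum[OF assms(1)] smooth_raise_pow assms(2))

lemma raise_pow_zero: "(raise_op ^^ j) (\<lambda>_. 0) = (\<lambda>_. 0)"
  by (induction j) (auto simp: raise_op_zero)

text \<open>\<open>lower_pow k j\<close> maps sections of degree \<open>k + 2 * j\<close> to sections of degree \<open>k\<close>.\<close>

primrec lower_pow :: "int \<Rightarrow> nat \<Rightarrow> (complex \<Rightarrow> complex) \<Rightarrow> complex \<Rightarrow> complex" where
  "lower_pow k 0 f = f"
| "lower_pow k (Suc j) f = lower_pow k j (lower_op (k + 2 * int (Suc j)) f)"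

lemma lower_pow_sum:
  assumes "finite A" "\<And>i. i \<in> A \<Longrightarrow> smooth (f i)"
  shows "lower_pow k j (\<lambda>z. \<Sum>i\<in>A. c i * f i z) = (\<lambda>z. \<Sum>i\<in>A. c i * lower_pow k j (f i) z)"
  using assms(2)
proof (induction j arbitrary: f)
  case (Suc j)
  show ?case using Suc.prems
    by (simp add: lower_op_sum[OF assms(1)] Suc.IH smooth_lower_op del: of_nat_Suc)
qed simp

lemma lower_pow_cmult: "smooth f \<Longrightarrow> lower_pow k j (\<lambda>z. c * f z) = (\<lambda>z. c * lower_pow k j f z)"
  using lower_pow_sum[of "{()}" "\<lambda>_. f" k j "\<lambda>_. c"] by simp

text \<open>The eigenvalue of \<open>lower_op\<close> after \<open>raise_op\<close> on the
  \<open>j\<close>-th rung: \<open>l\<close> minus the degrees passed so far, since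
  \<open>k + (k + 2) + ... + (k + 2 * j) = (j + 1) * (k + j)\<close>.\<close>

definition ladder :: "int \<Rightarrow> complex \<Rightarrow> nat \<Rightarrow> complex" where
  "ladder k l j = l - of_int ((int j + 1) * (k + int j))"

lemma ladder_Suc: "ladder k l (Suc j) = ladder k l j - of_int (k + 2 * int (Suc j))"
  by (simp add: ladder_def algebra_simps)

lemma ladder_up:
  assumes u: "is_section k u" and eig: "raise_op (lower_op k u) = (\<lambda>z. l * u z)"
  shows "is_section (k + 2 * int j) ((raise_op ^^ j) u) \<and>
    lower_op (k + 2 * int j + 2) (raise_op ((raise_op ^^ j) u)) = (\<lambda>z. ladder k l j * (raise_op ^^ j) u z)"
proof (induction j)
  case 0
  have "lower_op (k + 2) (raise_op u) z = (l - of_int k) * u z" for z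
    using raise_lower_commute[OF is_section_smooth[OF u], of k z] unfolding eig by (simp add: algebra_simps)
  thus ?case using u by (simp add: ladder_def fun_eq_iff)
next
  case (Suc j)
  define v where "v = (raise_op ^^ j) u"
  define d where "d = k + 2 * int j + 2"
  have d: "k + 2 * int (Suc j) = d" by (simp add: d_def)
  have v: "is_section (k + 2 * int j) v" and e: "lower_op d (raise_op v) = (\<lambda>z. ladder k l j * v z)"
    using Suc by (auto simp: v_def d_def)
  have r: "is_section d (raise_op v)" using is_section_raise_op[OF v] by (simp add: d_def)
  have "lower_op (d + 2) (raise_op (raise_op v)) z = (ladder k l j - of_int d) * raise_op v z" for z
    using raise_lower_commute[OF is_section_smooth[OF r], of d z]
    unfolding e raise_op_cmult[OF is_section_smooth[OF v]] by (simp add: algebra_simps)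
  thus ?case unfolding ladder_Suc d using r by (simp add: v_def[symmetric] fun_eq_iff)
qed

text \<open>Each step down followed by its step up multiplies by one \<open>ladder\<close> value.
  The product shows that lowering is injective as long as none of these values is 0.\<close>

lemma ladder_down:
  assumes "is_section (k + 2 * int j) v" "lower_op (k + 2 * int j + 2) (raise_op v) = (\<lambda>z. ladder k l j * v z)"
  shows "is_section k (lower_pow k j v) \<and>
    raise_op (lower_op k (lower_pow k j v)) = (\<lambda>z. l * lower_pow k j v z) \<and>
    (raise_op ^^ j) (lower_pow k j v) = (\<lambda>z. (\<Prod>i<j. ladder k l i) * v z)"
  using assms
proof (induction j arbitrary: v)
  case 0
  have "raise_op (lower_op k v) z = l * v z" for z
    using raise_lower_commute[OF is_section_smooth[of k v], of k z] 0 by (simp add: ladder_def algebra_simps)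
  thus ?case using 0 by (simp add: fun_eq_iff)
next
  case (Suc j)
  define d where "d = k + 2 * int j + 2"
  have d: "k + 2 * int (Suc j) = d" by (simp add: d_def)
  have v: "is_section d v" and e: "lower_op (d + 2) (raise_op v) = (\<lambda>z. ladder k l (Suc j) * v z)"
    using Suc.prems unfolding d by auto
  define v' where "v' = lower_op d v"
  have v': "is_section (k + 2 * int j) v'"
    using is_section_lower_op[of "k + 2 * int j" v] v by (simp add: v'_def d_def)
  have "raise_op v' z = ladder k l j * v z" for z
    using raise_lower_commute[OF is_section_smooth[OF v], of d z]
    unfolding e v'_def ladder_Suc d by (simp add: algebra_simps)
  hence r: "raise_op v' = (\<lambda>z. ladder k l j * v z)" by blast
  have "lower_op (k + 2 * int j + 2) (raise_op v') = (\<lambda>z. ladder k l j * v' z)"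
    unfolding r d_def[symmetric] lower_op_cmult[OF is_section_smooth[OF v]] by (simp add: v'_def)
  note IH = Suc.IH[OF v' this]
  have low: "lower_pow k (Suc j) v = lower_pow k j v'" by (simp add: v'_def d_def algebra_simps)
  have "(raise_op ^^ Suc j) (lower_pow k j v') = raise_op (\<lambda>z. (\<Prod>i<j. ladder k l i) * v' z)"
    using IH by simp
  also have "\<dots> = (\<lambda>z. (\<Prod>i<Suc j. ladder k l i) * v z)"
    unfolding raise_op_cmult[OF is_section_smooth[OF v']] r by (simp add: mult_ac)
  finally show ?case using IH unfolding low by blast
qed

text \<open>The composite in the other order has the same product, so for nonzero product the
  eigenspaces at the two ends of the ladder are isomorphic.\<close>

lemma lower_raise_pow:
  assumes u: "is_section k u" and eig: "raise_op (lower_op k u) = (\<lambda>z. l * u z)"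
  shows "lower_pow k j ((raise_op ^^ j) u) = (\<lambda>z. (\<Prod>i<j. ladder k l i) * u z)"
proof (induction j)
  case (Suc j)
  have s: "smooth ((raise_op ^^ j) u)" by (rule smooth_raise_pow[OF is_section_smooth[OF u]])
  have "lower_op (k + 2 * int (Suc j)) (raise_op ((raise_op ^^ j) u)) = (\<lambda>z. ladder k l j * (raise_op ^^ j) u z)"
    using ladder_up[OF u eig, of j] by (simp add: algebra_simps)
  thus ?case by (simp add: lower_pow_cmult[OF s] Suc mult_ac del: of_nat_Suc)
qed simp

section \<open>Holomorphic sections and the possible eigenvalues\<close>

lemma raise_op_eq_0_iff: "raise_op f = (\<lambda>_. 0) \<longleftrightarrow> (\<forall>z. wirtinger_bar f z = 0)"
  by (simp add: raise_op_def fun_eq_iff)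

text \<open>Boundedness of the second coefficient on the unit disc says that \<open>h\<close> grows
  at most like \<open>z ^ N\<close>, so Liouville's theorem for polynomial growth applies.\<close>

lemma holomorphic_section_polynomial:
  assumes h: "is_section (int N) h" and r: "raise_op h = (\<lambda>_. 0)"
  obtains c where "h = (\<lambda>z. \<Sum>i\<le>N. c i * z ^ i)"
proof -
  obtain g where g: "smooth h" "smooth g" "\<And>z. z \<noteq> 0 \<Longrightarrow> h z = z powi (int N) * g (1 / z)"
    using h by (auto simp: is_section_def forms_0_iff)
  have "(h has_field_derivative wirtinger h z) (at z)" for z
  proof -
    have "has_wirtinger h (wirtinger h z) 0 z"
      using smooth_has_wirtinger[OF g(1), of z] r unfolding raise_op_eq_0_iff by simp
    thus ?thesis by (simp add: has_wirtinger_def has_field_derivative_def)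
  qed
  hence hol: "h holomorphic_on UNIV" by (auto simp: holomorphic_on_open)
  have "bounded (g ` cball 0 1)"
    by (intro compact_imp_bounded compact_continuous_image smooth_imp_continuous g compact_cball)
  then obtain B where "\<forall>w\<in>cball 0 1. cmod (g w) \<le> B" by (auto simp: bounded_iff)
  hence B: "cmod (g w) \<le> B" if "w \<in> cball 0 1" for w using that by blast
  have "cmod (h z) \<le> B * cmod z ^ N" if z: "1 \<le> cmod z" for z
  proof -
    have "z \<noteq> 0" using z by auto
    moreover have "1 / z \<in> cball 0 1" using z \<open>z \<noteq> 0\<close> by (simp add: norm_divide divide_le_eq)
    ultimately show ?thesis using g(3)[of z] B[of "1 / z"]
      by (simp add: norm_mult norm_power mult.commute mult_left_mono)
  qed
  from Liouville_polynomial[OF hol this]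
  have "h = (\<lambda>z. \<Sum>i\<le>N. ((deriv ^^ i) h 0 / fact i) * z ^ i)" by blast
  thus ?thesis by (rule that)
qed

lemma is_section_monomial:
  assumes "i \<le> N"
  shows "is_section (int N) (\<lambda>z. z ^ i)" and "raise_op (\<lambda>z. z ^ i) = (\<lambda>_. 0)"
proof -
  have "z ^ i = z powi (int N) * (1 / z) ^ (N - i)" if "z \<noteq> 0" for z :: complex
    using that assms by (simp add: power_divide power_diff)
  moreover have "smooth (\<lambda>z. z ^ i)" "smooth (\<lambda>z. z ^ (N - i))" by (intro smooth_intros)+
  ultimately show "is_section (int N) (\<lambda>z. z ^ i)"
    unfolding is_section_def forms_0_iff by blast
  have "((\<lambda>z. z ^ i) has_field_derivative (of_nat i * z ^ (i - 1))) (at z)" for z :: complex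
    by (auto intro!: derivative_eq_intros)
  from has_wirtinger_imp(2)[OF has_wirtinger_holomorphic[OF this]]
  show "raise_op (\<lambda>z. z ^ i) = (\<lambda>_. 0)" by (simp add: raise_op_eq_0_iff)
qed

lemma section_eigenvalue:
  assumes u: "is_section (1 - int b) u" "u \<noteq> (\<lambda>_. 0)"
    and eig: "raise_op (lower_op (1 - int b) u) = (\<lambda>z. l * u z)" and l: "l \<noteq> 0"
  obtains n where "l = of_nat (Suc n * (Suc n + b))"
proof -
  define k where "k = 1 - int b"
  define R where "R j = (raise_op ^^ j) u" for j
  have u': "is_section k u" and eig': "raise_op (lower_op k u) = (\<lambda>z. l * u z)"
    using u(1) eig by (simp_all add: k_def)
  have sec: "is_section (k + 2 * int j) (R j)" and low: "lower_op (k + 2 * int j + 2) (raise_op (R j)) = (\<lambda>z. ladder k l j * R j z)" for j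
    using ladder_up[OF u' eig', of j] by (simp_all add: R_def)
  have "is_section (k - 2 + 2) u" "raise_op (lower_op (k - 2 + 2) u) = (\<lambda>z. l * u z)"
    using u' eig' by simp_all
  then obtain r where r: "r \<ge> 0" "l = of_real r"
    using lower_adjoint_nonneg[OF _ u(2)] by blast
  have ld: "ladder k l j = of_real (r - (real j + 1) * (real j + 1 - real b))" for j
    by (simp add: ladder_def k_def r)
  have ex: "\<exists>j. R j = (\<lambda>_. 0)"
  proof (rule ccontr)
    assume nz: "\<nexists>j. R j = (\<lambda>_. 0)"
    obtain M where M: "r < real M" using reals_Archimedean2 by blast
    \<comment> \<open>Far enough up that \<open>(j + 1) * (j + 1 - b)\<close> exceeds
      \<open>r\<close>, which would make the eigenvalue on this rung negative.\<close>
    define j where "j = M + b"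
    have "\<exists>t\<ge>0. ladder k l j = of_real t" using raise_adjoint_nonneg(1)[OF sec _ low] nz by blast
    hence "r - (real j + 1) * (real j + 1 - real b) \<ge> 0" unfolding ld of_real_eq_iff by auto
    moreover have "real M * 1 \<le> (real j + 1) * (real j + 1 - real b)"
      by (intro mult_mono) (auto simp: j_def)
    ultimately show False using M by linarith
  qed
  \<comment> \<open>The section just before the first zero is nonzero and is killed by
    \<open>raise_op\<close>, so its \<open>ladder\<close> value is 0.\<close>
  define J where "J = (LEAST j. R j = (\<lambda>_. 0))"
  have RJ: "R J = (\<lambda>_. 0)" unfolding J_def using ex by (rule LeastI_ex)
  have "J \<noteq> 0" using RJ u(2) by (auto simp: R_def)
  then obtain j where j: "J = Suc j" using not0_implies_Suc by blast
  have "R j \<noteq> (\<lambda>_. 0)" using not_less_Least[of j "\<lambda>j. R j = (\<lambda>_. 0)"] j by (simp add: J_def)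
  moreover have "raise_op (R j) = (\<lambda>_. 0)" using RJ j by (simp add: R_def)
  ultimately have "ladder k l j = 0" using raise_adjoint_nonneg(3)[OF sec _ low] by blast
  hence req: "r = (real j + 1) * (real j + 1 - real b)" unfolding ld of_real_eq_0_iff by simp
  have "r > 0" using r l by (cases "r = 0") auto
  \<comment> \<open>Here \<open>l \<noteq> 0\<close> is used: rungs with
    \<open>j + 1 \<le> b\<close> would give \<open>r \<le> 0\<close>.\<close>
  hence "real j + 1 > real b" unfolding req by (simp add: zero_less_mult_iff)
  hence "Suc j > b" by linarith
  then obtain n where "Suc j = Suc (b + n)" using less_imp_Suc_add by blast
  hence "real j + 1 = real b + real (Suc n)" by simp
  hence "r = real (Suc n * (Suc n + b))" unfolding req by (simp add: algebra_simps)
  thus ?thesis using that r(2) by simp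
qed

section \<open>Eigenforms and multiplicities\<close>

lemma form_scale_sum_fst: "fst (\<Sum>i\<in>A. form_scale (c i) (\<beta> i)) = (\<lambda>z. \<Sum>i\<in>A. c i * fst (\<beta> i) z)"
  by (induction A rule: infinite_finite_induct) (auto simp: form_scale_def fun_eq_iff)

lemma sum_in_forms_1:
  assumes "\<And>i. i \<in> A \<Longrightarrow> \<beta> i \<in> forms m (Suc 0)"
  shows "(\<Sum>i\<in>A. \<beta> i) \<in> forms m (Suc 0)"
  using assms
proof (induction A rule: infinite_finite_induct)
  case (insert x A)
  have "\<alpha> + \<gamma> \<in> forms m (Suc 0)" if "\<alpha> \<in> forms m (Suc 0)" "\<gamma> \<in> forms m (Suc 0)" for \<alpha> \<gamma>
    using that unfolding plus_prod_def plus_fun_def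
    by (cases \<alpha>; cases \<gamma>) (auto simp: forms_1_iff algebra_simps add_divide_distrib intro!: smooth_intros)
  thus ?case using insert by simp
qed (simp_all add: zero_in_forms_1)

text \<open>The monomials up to degree \<open>N\<close>, lowered \<open>j\<close> times, form a
  basis: raising them back shows independence, and raising an arbitrary eigensection gives a
  polynomial, which shows that they span. Their number is \<open>N + 1\<close>.\<close>

lemma eigenspace_dim:
  fixes b n :: nat
  defines "m \<equiv> - 1 - int b" and "l \<equiv> of_nat (Suc n * (Suc n + b))"
  shows "multiplicity_of m (Suc 0) l = 2 * Suc n + b" and "l \<in> eigenvalues m (Suc 0)"
proof -
  define k where "k = m + 2"
  \<comment> \<open>The rung on which \<open>ladder k l\<close> vanishes for this \<open>l\<close>;
    the sections there have degree \<open>k + 2 * j = N\<close>.\<close>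
  define j where "j = n + b"
  define N where "N = 2 * n + b + 1"
  have kj: "k + 2 * int j = int N" by (simp add: k_def m_def j_def N_def)
  have ld: "ladder k l i = of_real ((real j + 1) * (real j + 1 - real b) - (real i + 1) * (real i + 1 - real b))" for i
    by (simp add: ladder_def k_def m_def l_def j_def algebra_simps)
  have ldj: "ladder k l j = 0" by (simp add: ld)
  define P where "P = (\<Prod>i<j. ladder k l i)"
  have P: "P \<noteq> 0"
  proof -
    have "ladder k l i \<noteq> 0" if "i < j" for i
    proof -
      \<comment> \<open>This factors \<open>ladder k l i\<close> as a difference of two values of
        one quadratic; the second factor is positive because \<open>j \<ge> b\<close>.\<close>
      have "0 < (real j - real i) * (real j + real i + 2 - real b)"
        using that by (intro mult_pos_pos) (auto simp: j_def)
      also have "\<dots> = (real j + 1) * (real j + 1 - real b) - (real i + 1) * (real i + 1 - real b)"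
        by (simp add: algebra_simps)
      finally show ?thesis unfolding ld of_real_eq_0_iff by linarith
    qed
    thus ?thesis by (simp add: P_def)
  qed
  define u where "u i = lower_pow k j (\<lambda>z. z ^ i)" for i
  have u: "is_section k (u i)" "raise_op (lower_op k (u i)) = (\<lambda>z. l * u i z)"
      "(raise_op ^^ j) (u i) = (\<lambda>z. P * z ^ i)" if "i \<le> N" for i
    using ladder_down[of k j "\<lambda>z. z ^ i" l] is_section_monomial[OF that]
    unfolding kj u_def P_def by (simp_all add: lower_op_zero ldj)
  have "\<exists>\<beta>. \<beta> \<in> forms m (Suc 0) \<and> fst \<beta> = (\<lambda>z. u i z / (fs_weight z)\<^sup>2)" if "i \<le> N" for i
  proof -
    have "is_section (m + 2) (\<lambda>z. (fs_weight z)\<^sup>2 * (u i z / (fs_weight z)\<^sup>2))"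
      using u(1)[OF that] by (simp add: k_def)
    then obtain g where "(\<lambda>z. u i z / (fs_weight z)\<^sup>2, g) \<in> forms m (Suc 0)"
      unfolding is_section_iff_forms_1 by blast
    thus ?thesis by (intro exI[of _ "(\<lambda>z. u i z / (fs_weight z)\<^sup>2, g)"]) simp
  qed
  then obtain \<beta> where \<beta>: "\<And>i. i \<le> N \<Longrightarrow> \<beta> i \<in> forms m (Suc 0)"
      "\<And>i. i \<le> N \<Longrightarrow> fst (\<beta> i) = (\<lambda>z. u i z / (fs_weight z)\<^sup>2)" by metis
  have W\<beta>: "(\<lambda>z. (fs_weight z)\<^sup>2 * fst (\<beta> i) z) = u i" if "i \<le> N" for i
    using \<beta>(2)[OF that] by simp
  have E: "\<beta> i \<in> eigenspace m (Suc 0) l" if "i \<le> N" for i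
    unfolding eigenspace_1_iff W\<beta>[OF that] fun_cong[OF W\<beta>[OF that]] k_def[symmetric]
    using \<beta>(1)[OF that] u(2)[OF that] by blast
  have smooth_u: "smooth (u i)" if "i \<le> N" for i by (rule is_section_smooth[OF u(1)[OF that]])
  have indep: "c i = 0" if c: "(\<Sum>i\<le>N. form_scale (c i) (\<beta> i)) = 0" and i: "i \<le> N" for c i
  proof -
    have "(\<lambda>z. \<Sum>i\<le>N. c i * fst (\<beta> i) z) = (\<lambda>_. 0)"
      using arg_cong[OF c, of fst] unfolding form_scale_sum_fst by (simp add: zero_fun_def)
    hence *: "(\<Sum>i\<le>N. c i * fst (\<beta> i) z) = 0" for z by (rule fun_cong)
    have "(\<Sum>i\<le>N. c i * u i z) = 0" for z
    proof -
      have "(\<Sum>i\<le>N. c i * u i z) = (fs_weight z)\<^sup>2 * (\<Sum>i\<le>N. c i * fst (\<beta> i) z)"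
        unfolding sum_distrib_left by (rule sum.cong) (auto simp: \<beta>(2))
      thus ?thesis using * by simp
    qed
    hence "(\<lambda>z. \<Sum>i\<le>N. c i * u i z) = (\<lambda>_. 0)" by blast
    hence "(raise_op ^^ j) (\<lambda>z. \<Sum>i\<le>N. c i * u i z) = (\<lambda>_. 0)" by (simp add: raise_pow_zero)
    moreover have "(raise_op ^^ j) (\<lambda>z. \<Sum>i\<le>N. c i * u i z) = (\<lambda>z. \<Sum>i\<le>N. c i * (raise_op ^^ j) (u i) z)"
      by (rule raise_pow_sum) (use smooth_u in auto)
    ultimately have "(\<lambda>z. \<Sum>i\<le>N. c i * (raise_op ^^ j) (u i) z) = (\<lambda>_. 0)" by (simp only:)
    hence "(\<Sum>i\<le>N. c i * (raise_op ^^ j) (u i) z) = 0" for z by (rule fun_cong)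
    moreover have "(\<Sum>i\<le>N. c i * (raise_op ^^ j) (u i) z) = P * (\<Sum>i\<le>N. c i * z ^ i)" for z
      unfolding sum_distrib_left by (rule sum.cong) (auto simp: u(3))
    ultimately have "\<forall>z. (\<Sum>i\<le>N. c i * z ^ i) = 0" using P by simp
    thus ?thesis using polyfun_eq_0[of c N] i by blast
  qed
  have inj: "inj_on \<beta> {..N}"
  proof (rule inj_onI, rule ccontr)
    fix i i' assume ii: "i \<in> {..N}" "i' \<in> {..N}" "\<beta> i = \<beta> i'" "i \<noteq> i'"
    \<comment> \<open>Two equal images would give this nontrivial linear relation, so injectivity
      follows from \<open>indep\<close>.\<close>
    define c where "c x = (if x = i then 1 else 0) - (if x = i' then 1 else (0::complex))" for x
    have "(\<Sum>x\<le>N. form_scale (c x) (\<beta> x)) = (\<Sum>x\<le>N. (if x = i then \<beta> x else 0) - (if x = i' then \<beta> x else 0))"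
      by (rule sum.cong) (auto simp: c_def forms.scale_left_diff_distrib)
    also have "\<dots> = 0" using ii by (simp add: sum_subtractf)
    finally have "c i = 0" using ii by (intro indep) auto
    thus False using ii by (simp add: c_def)
  qed
  have independent: "forms.independent (\<beta> ` {..N})"
  proof (rule forms.independent_if_scalars_zero)
    fix f x assume "(\<Sum>x\<in>\<beta> ` {..N}. form_scale (f x) x) = 0" "x \<in> \<beta> ` {..N}"
    thus "f x = 0" using indep[of "f \<circ> \<beta>"] by (auto simp: sum.reindex[OF inj])
  qed simp
  have span: "\<alpha> \<in> forms.span (\<beta> ` {..N})" if \<alpha>: "\<alpha> \<in> eigenspace m (Suc 0) l" for \<alpha>
  proof -
    define v where "v = (\<lambda>z. (fs_weight z)\<^sup>2 * fst \<alpha> z)"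
    have \<alpha>f: "\<alpha> \<in> forms m (Suc 0)" and eig: "raise_op (lower_op k v) = (\<lambda>z. l * v z)"
      using \<alpha> unfolding eigenspace_1_iff v_def k_def by auto
    have v: "is_section k v" unfolding v_def k_def by (rule is_section_fst_1[OF \<alpha>f])
    define h where "h = (raise_op ^^ j) v"
    have h: "is_section (int N) h" "lower_op (int N + 2) (raise_op h) = (\<lambda>z. 0 * h z)"
      using ladder_up[OF v eig, of j] unfolding kj ldj h_def by auto
    \<comment> \<open>On the rung with eigenvalue 0, the norm of \<open>raise_op h\<close> is 0, so
      \<open>h\<close> is holomorphic.\<close>
    have "raise_op h = (\<lambda>_. 0)"
    proof (cases "h = (\<lambda>_. 0)")
      case False
      show ?thesis by (rule raise_adjoint_nonneg(2)[OF h(1) False h(2)]) simp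
    qed (simp add: raise_op_zero)
    then obtain c where c: "h = (\<lambda>z. \<Sum>i\<le>N. c i * z ^ i)"
      using holomorphic_section_polynomial[OF h(1)] by blast
    have "(\<lambda>z. P * v z) = lower_pow k j h" unfolding h_def P_def by (rule lower_raise_pow[OF v eig, symmetric])
    also have "\<dots> = (\<lambda>z. \<Sum>i\<le>N. c i * u i z)"
      unfolding c u_def by (intro lower_pow_sum smooth_intros) auto
    finally have Pv: "P * v z = (\<Sum>i\<le>N. c i * u i z)" for z by (rule fun_cong)
    have "\<alpha> = (\<Sum>i\<le>N. form_scale (c i / P) (\<beta> i))"
    proof (rule form_eqI'[OF \<alpha>f])
      show "(\<Sum>i\<le>N. form_scale (c i / P) (\<beta> i)) \<in> forms m (Suc 0)"
        by (intro sum_in_forms_1 form_scale_in_forms_1 \<beta>) auto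
      show "fst \<alpha> = fst (\<Sum>i\<le>N. form_scale (c i / P) (\<beta> i))"
      proof
        fix z
        have "fst \<alpha> z = (P * v z) / (P * (fs_weight z)\<^sup>2)" using P by (simp add: v_def)
        also have "\<dots> = (\<Sum>i\<le>N. c i / P * fst (\<beta> i) z)"
          unfolding Pv sum_divide_distrib by (rule sum.cong) (auto simp: \<beta>(2))
        finally show "fst \<alpha> z = fst (\<Sum>i\<le>N. form_scale (c i / P) (\<beta> i)) z"
          unfolding form_scale_sum_fst .
      qed
    qed
    also have "\<dots> \<in> forms.span (\<beta> ` {..N})"
      by (intro forms.span_sum forms.span_scale forms.span_base) auto
    finally show ?thesis .
  qed
  show "multiplicity_of m (Suc 0) l = 2 * Suc n + b"
    unfolding multiplicity_of_def
  proof (rule forms.dim_unique)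
    show "\<beta> ` {..N} \<subseteq> eigenspace m (Suc 0) l" using E by auto
    show "eigenspace m (Suc 0) l \<subseteq> forms.span (\<beta> ` {..N})" using span by blast
    show "card (\<beta> ` {..N}) = 2 * Suc n + b" using card_image[OF inj] by (simp add: N_def)
  qed (rule independent)
  have "\<beta> 0 \<noteq> 0"
  proof
    assume "\<beta> 0 = 0"
    hence "0 \<in> \<beta> ` {..N}" by (metis atMost_iff image_eqI le0)
    from forms.dependent_zero[OF this] independent show False by contradiction
  qed
  thus "l \<in> eigenvalues m (Suc 0)" unfolding eigenvalues_def using E[of 0] by blast
qed

lemma nonzero_eigenvalues:
  "eigenvalues (- 1 - int b) (Suc 0) - {0} = range (\<lambda>n. of_nat (Suc n * (Suc n + b)))"
proof
  show "range (\<lambda>n. of_nat (Suc n * (Suc n + b))) \<subseteq> eigenvalues (- 1 - int b) (Suc 0) - {0}"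
    using eigenspace_dim(2)[of _ b] by (auto simp del: of_nat_Suc of_nat_mult mult_Suc mult_Suc_right)
  show "eigenvalues (- 1 - int b) (Suc 0) - {0} \<subseteq> range (\<lambda>n. of_nat (Suc n * (Suc n + b)))"
  proof
    fix l assume l: "l \<in> eigenvalues (- 1 - int b) (Suc 0) - {0}"
    then obtain \<alpha> where \<alpha>: "\<alpha> \<in> eigenspace (- 1 - int b) (Suc 0) l" "\<alpha> \<noteq> 0" by (auto simp: eigenvalues_def)
    define v where "v = (\<lambda>z. (fs_weight z)\<^sup>2 * fst \<alpha> z)"
    have e: "- 1 - int b + 2 = 1 - int b" by simp
    have \<alpha>f: "\<alpha> \<in> forms (- 1 - int b) (Suc 0)" and eig: "raise_op (lower_op (1 - int b) v) = (\<lambda>z. l * v z)"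
      using \<alpha>(1) unfolding eigenspace_1_iff v_def e by auto
    have v: "is_section (1 - int b) v" using is_section_fst_1[OF \<alpha>f] unfolding v_def e .
    have "v \<noteq> (\<lambda>_. 0)"
    proof
      assume "v = (\<lambda>_. 0)"
      hence "fst \<alpha> = fst (0 :: form)" by (simp add: v_def fun_eq_iff)
      hence "\<alpha> = 0" by (intro form_eqI'[OF \<alpha>f zero_in_forms_1])
      thus False using \<alpha>(2) by blast
    qed
    from section_eigenvalue[OF v this eig] l show "l \<in> range (\<lambda>n. of_nat (Suc n * (Suc n + b)))" by blast
  qed
qed

text \<open>Different \<open>n\<close> give different eigenvalues, so the sum over the set of
  eigenvalues can be reindexed without merging multiplicities.\<close>

lemma has_sum_spectrum:
  "((\<lambda>l. of_nat (multiplicity_of (- 1 - int b) (Suc 0) l) * l powr (- s)) has_sum S) (eigenvalues (- 1 - int b) (Suc 0) - {0}) \<longleftrightarrow>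
   ((\<lambda>n. of_nat (2 * Suc n + b) * of_nat (Suc n * (Suc n + b)) powr (- s)) has_sum S) UNIV"
proof -
  have "strict_mono (\<lambda>n. Suc n * (Suc n + b))"
    by (rule strict_monoI) (rule mult_strict_mono, auto)
  hence "inj (\<lambda>n. Suc n * (Suc n + b))" by (rule strict_mono_imp_inj_on)
  hence "inj (\<lambda>n. of_nat (Suc n * (Suc n + b)) :: complex)"
    unfolding inj_on_def of_nat_eq_iff .
  thus ?thesis
    unfolding nonzero_eigenvalues by (simp only: has_sum_reindex o_def eigenspace_dim(1))
qed

theorem mainTheorem7:
  fixes a :: nat
  assumes "a \<ge> 1"
  shows "analytic_torsion (- int a) =
    complex_of_real
      (1 / 2 * (- real a + 1)\<^sup>2 +
       ln (\<Prod>i<a - 1. fact i * fact (a - 2 - i) / fact (a - 1)))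
    - 4 * deriv riemann_zeta (- 1)"
proof -
  define b where "b = a - 1"
  have a: "a = Suc b" using assms by (simp add: b_def)
  have m: "- int a = - 1 - int b" by (simp add: a)
  obtain F where F: "F meromorphic_on {s. Re s > -1/2}" "F analytic_on {0}"
    "\<And>s. Re s > 1 \<Longrightarrow> ((\<lambda>n. of_nat (2 * Suc n + b) * of_nat (Suc n * (Suc n + b)) powr (- s)) has_sum F s) UNIV"
    "deriv F 0 = 4 * deriv riemann_zeta (- 1) + of_real (2 * (\<Sum>n<b. real (Suc n) * ln (real (Suc n))) - (real b)\<^sup>2 / 2 - real b * ln (fact b))"
    using spectral_continuation by blast
  have "is_spectral_zeta (- int a) (Suc 0) F"
    unfolding is_spectral_zeta_def m has_sum_spectrum
  proof (intro conjI exI allI impI)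
    show "(- 1 / 2 :: real) < 0" by simp
  qed (use F in auto)
  hence "spectral_zeta_deriv_0 (- int a) (Suc 0) = deriv F 0" by (rule spectral_zeta_deriv_0_eq)
  \<comment> \<open>The weight \<open>(- 1) ^ q * q\<close> is 0 for functions and
    \<open>- 1\<close> for \<open>(0,1)\<close>-forms.\<close>
  hence "analytic_torsion (- int a) = - deriv F 0" by (simp add: analytic_torsion_def)
  also have "\<dots> = of_real (1 / 2 * (real b)\<^sup>2 + (real b * ln (fact b) - 2 * (\<Sum>n<b. real (Suc n) * ln (real (Suc n))))) - 4 * deriv riemann_zeta (- 1)"
    unfolding F(4) by (simp only: of_real_add of_real_diff) simp
  also have "real b * ln (fact b) - 2 * (\<Sum>n<b. real (Suc n) * ln (real (Suc n))) = ln (\<Prod>i<a - 1. fact i * fact (a - 2 - i) / fact (a - 1))"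
    using ln_prod_fact[of b] by (simp add: a)
  also have "(real b)\<^sup>2 = (- real a + 1)\<^sup>2" by (simp add: a)
  finally show ?thesis .
qed

end
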